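(* Let $N_4\subset\mathbb{Z}^3$ be the set of the $15$ vectors $\pm e_1,\pm e_2,\pm e_3,\pm(e_1-e_2),\pm(e_1-e_3),\pm(e_2-e_3),(1,-1,-1),(-1,1,-1),(-1,-1,1)$. For every ordered pair $(n,n')$ of nonparallel vectors in $N_4$, the Berline--Vergne weight $\alpha(\mathrm{cone}(n,n'))$ of the pointed two-dimensional transverse (normal) cone generated by $n$ and $n'$ is positive; over the $99$ (unordered) nonparallel pairs its minimum value is $1/9$.
   Context: $e_1,e_2,e_3$ is the standard basis of $\mathbb{R}^3$; $N_4$ is the set of primitive outward normals of the rhombus inequalities of size-$4$ hives. $\mathrm{cone}(\cdot)$ denotes the set of nonnegative real linear combinations. Berline--Vergne weight $\alpha$ (with respect to the standard scalar product of $\mathbb{R}^D$; here $D=3$). Let $L\subset\mathbb{R}^D$ be a rational subspace with a lattice $\Lambda\subset L$ (of full rank, contained in $L\cap\mathbb{Q}^D$). For a pointed rational cone $C\subset L$ let $S(C)(\xi)=\sum_{x\in C\cap\Lambda}e^{\langle\xi,x\rangle}$ and, for a face $F$ of $C$, $I(F)(\xi)=\int_F e^{\langle\xi,x\rangle}\,dx$, with Lebesgue measure on $\mathrm{lin}(F)$ normalized so that $\Lambda\cap\mathrm{lin}(F)$ has covolume $1$ (and $I(\{0\})=1$); both are understood as meromorphic functions of $\xi\in L$. The Berline--Vergne functions $\mu(C)=\mu_{L,\Lambda}(C)$, analytic near $\xi=0$, are defined recursively by $\mu(\{0\})=1$ in the zero space and $S(C)(\xi)=\sum_{F}\mu(t(C,F))(\mathrm{pr}_F\,\xi)\,I(F)(\xi)$,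 the sum over all faces $F$ of $C$ (including $\{0\}$ and $C$), where $\mathrm{pr}_F$ is the orthogonal projection of $L$ onto $L\cap\mathrm{lin}(F)^{\perp}$ and $t(C,F)=\mathrm{pr}_F(C)$ is considered in $L\cap\mathrm{lin}(F)^\perp$ with lattice $\mathrm{pr}_F(\Lambda)$. For a pointed rational cone $N\subset\mathbb{R}^D$ with linear span $L$, put $\Lambda_L=$ orthogonal projection of $\mathbb{Z}^D$ onto $L$ (the dual lattice of $L\cap\mathbb{Z}^D$) and $N^{\circ}=\{x\in L:\langle x,n\rangle\le0\ \forall n\in N\}$; then $\alpha(N)=\mu_{L,\Lambda_L}(N^\circ)(0)$. *)

theory Defs
  imports "HOL-Analysis.Analysis"
begin

definition integer_points :: "(real^'n) set" where
  "integer_points = {x. \<forall>i. x $ i \<in> \<int>}"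

definition rational_points :: "(real^'n) set" where
  "rational_points = {x. \<forall>i. x $ i \<in> \<rat>}"

definition lattice_basis :: "(real^'n) set \<Rightarrow> (real^'n) set \<Rightarrow> bool" where
  "lattice_basis B \<Lambda> \<longleftrightarrow>
     independent B \<and> \<Lambda> = {(\<Sum>b\<in>B. of_int (c b) *\<^sub>R b) | c :: real^'n \<Rightarrow> int. True}"

definition rational_lattice_in :: "(real^'n) set \<Rightarrow> (real^'n) set \<Rightarrow> bool" where
  "rational_lattice_in L \<Lambda> \<longleftrightarrow>
     (\<exists>B. lattice_basis B \<Lambda> \<and> B \<subseteq> rational_points \<and> span B = L)"

text \<open>A cone \<^term>\<open>C\<close> is pointed, i.e. contains no line, iff \<^term>\<open>{0}\<close> is one of its faces.\<close>

definition pointed_rational_cone :: "(real^'n) set \<Rightarrow> bool" where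
  "pointed_rational_cone C \<longleftrightarrow>
     (\<exists>V. finite V \<and> V \<subseteq> rational_points \<and> C = convex_cone hull V) \<and> {0} face_of C"

definition orth_proj :: "(real^'n) set \<Rightarrow> real^'n \<Rightarrow> real^'n" where
  "orth_proj W x = (THE y. y \<in> W \<and> x - y \<in> W\<^sup>\<bottom>)"

text \<open>The library's \<^const>\<open>face_of\<close> also counts the empty set as a face.\<close>

definition cone_faces :: "(real^'n) set \<Rightarrow> (real^'n) set set" where
  "cone_faces C = {F. F face_of C \<and> F \<noteq> {}}"

text \<open>
  Lebesgue measure on \<^term>\<open>span \<Lambda>\<close>, normalized so that \<^term>\<open>\<Lambda>\<close> has covolume 1: the image of
  the Lebesgue measure on coordinate vectors with respect to a lattice basis. It does not depend
  on the basis, as two of them differ by an integer matrix of determinant 1 or -1.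
  For \<^term>\<open>\<Lambda> = {0}\<close> the basis is empty and this is the unit point mass at 0.
\<close>

definition lattice_measure :: "(real^'n) set \<Rightarrow> (real^'n) measure" where
  "lattice_measure \<Lambda> =
     (let B = (SOME B. lattice_basis B \<Lambda>)
      in distr (\<Pi>\<^sub>M b\<in>B. lborel) borel (\<lambda>c. \<Sum>b\<in>B. c b *\<^sub>R b))"

definition exp_sum :: "(real^'n) set \<Rightarrow> (real^'n) set \<Rightarrow> real^'n \<Rightarrow> real" where
  "exp_sum \<Lambda> C \<xi> = (\<Sum>\<^sub>\<infinity>x\<in>C \<inter> \<Lambda>. exp (\<xi> \<bullet> x))"

definition exp_integral :: "(real^'n) set \<Rightarrow> (real^'n) set \<Rightarrow> real^'n \<Rightarrow> real" where
  "exp_integral \<Lambda> F \<xi> = (LINT x:F|lattice_measure (\<Lambda> \<inter> span F). exp (\<xi> \<bullet> x))"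

text \<open>
  The open set of all \<open>\<xi> \<in> L\<close> for which the sum and all the integrals over the faces of \<open>C\<close>
  converge absolutely. It is nonempty if \<open>C\<close> is pointed, and it is invariant under scaling by
  positive reals, so it has points arbitrarily close to 0.
\<close>

definition convergence_domain :: "(real^'n) set \<Rightarrow> (real^'n) set \<Rightarrow> (real^'n) set" where
  "convergence_domain L C = {\<xi> \<in> L. \<forall>x \<in> C - {0}. \<xi> \<bullet> x < 0}"

text \<open>
  Analyticity near 0 of a function on a subspace \<open>L\<close>: near 0 it is the restriction to \<open>L\<close> of the
  sum of a power series in the ambient coordinates (\<open>m\<close> ranges over multi-indices).
\<close>

definition analytic_near_0_on :: "(real^'n) set \<Rightarrow> (real^'n \<Rightarrow> real) \<Rightarrow> bool" where
  "analytic_near_0_on L f \<longleftrightarrow>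
     (\<exists>g a \<epsilon>. \<epsilon> > 0 \<and>
        (\<forall>\<xi>. norm \<xi> < \<epsilon> \<longrightarrow>
           ((\<lambda>m :: 'n \<Rightarrow> nat. a m * (\<Prod>i\<in>UNIV. (\<xi> $ i) ^ m i)) has_sum g \<xi>) UNIV) \<and>
        (\<forall>\<xi>\<in>L. norm \<xi> < \<epsilon> \<longrightarrow> f \<xi> = g \<xi>))"

text \<open>
  \<^term>\<open>BV_function L \<Lambda> C f\<close> says that \<open>f\<close> represents the germ at 0 of the Berline--Vergne function
  of the pointed rational cone \<open>C\<close> in the space \<open>L\<close> with lattice \<open>\<Lambda>\<close>; values of \<open>f\<close> off \<open>L\<close> or
  away from 0 are irrelevant. In the recursive clause \<open>M F\<close> is the function of the transverse cone
  along \<open>F\<close>; the transverse cone along \<open>{0}\<close> is \<open>C\<close> itself, hence the conclusion is about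
  \<^term>\<open>M {0}\<close>.

  The defining identity is an identity of meromorphic functions near 0 in \<open>L\<close>. All terms are
  given near 0 on \<^term>\<open>convergence_domain L C\<close> by convergent sums and integrals; by
  uniqueness of meromorphic continuation it suffices to demand the identity there.
\<close>

inductive BV_function ::
  "(real^'n) set \<Rightarrow> (real^'n) set \<Rightarrow> (real^'n) set \<Rightarrow> (real^'n \<Rightarrow> real) \<Rightarrow> bool"
where
  zero: "f 0 = 1 \<Longrightarrow> BV_function {0} {0} {0} f"
| rec: "BV_function L \<Lambda> C (M {0})"
    if "rational_lattice_in L \<Lambda>" and "pointed_rational_cone C" and "C \<subseteq> L"
    and "\<And>F. F \<in> cone_faces C \<Longrightarrow> F \<noteq> {0} \<Longrightarrow>
           BV_function (L \<inter> (span F)\<^sup>\<bottom>)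
             (orth_proj (L \<inter> (span F)\<^sup>\<bottom>) ` \<Lambda>)
             (orth_proj (L \<inter> (span F)\<^sup>\<bottom>) ` C)
             (M F)"
    and "analytic_near_0_on L (M {0})"
    and "\<forall>\<^sub>F \<xi> in nhds 0. \<xi> \<in> convergence_domain L C \<longrightarrow>
           exp_sum \<Lambda> C \<xi> =
             (\<Sum>F\<in>cone_faces C.
                M F (orth_proj (L \<inter> (span F)\<^sup>\<bottom>) \<xi>) * exp_integral \<Lambda> F \<xi>)"

definition polar_in_span :: "(real^'n) set \<Rightarrow> (real^'n) set" where
  "polar_in_span N = {x \<in> span N. \<forall>n\<in>N. x \<bullet> n \<le> 0}"

definition BV_weight :: "(real^'n) set \<Rightarrow> real" where
  "BV_weight N =
     (THE r. \<exists>f. BV_function (span N) (orth_proj (span N) ` integer_points) (polar_in_span N) f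
                 \<and> r = f 0)"

definition N4 :: "(real^3) set" where
  "N4 = {vector [1, 0, 0], vector [-1, 0, 0],
         vector [0, 1, 0], vector [0, -1, 0],
         vector [0, 0, 1], vector [0, 0, -1],
         vector [1, -1, 0], vector [-1, 1, 0],
         vector [1, 0, -1], vector [-1, 0, 1],
         vector [0, 1, -1], vector [0, -1, 1],
         vector [1, -1, -1], vector [-1, 1, -1], vector [-1, -1, 1]}"

definition parallel :: "real^3 \<Rightarrow> real^3 \<Rightarrow> bool" where
  "parallel x y \<longleftrightarrow> collinear {0, x, y}"

definition nonparallel_pairs :: "(real^3) set set" where
  "nonparallel_pairs = {{n, n'} | n n'. n \<in> N4 \<and> n' \<in> N4 \<and> \<not> parallel n n'}"

end

theory Submission
  imports Defs
begin

text \<open>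
  Let \<open>m\<close>, \<open>n\<close> be two nonparallel integer vectors and \<open>L\<close> the plane that they span. The polar cone of
  \<open>cone(m, n)\<close> in \<open>L\<close> is generated by two vectors \<open>u\<close>, \<open>v\<close>, multiples of the negative dual basis. Suppose
  that the pairs \<open>(\<langle>z, m\<rangle>, \<langle>z, n\<rangle>)\<close> for integral \<open>z\<close> are all pairs of integers congruent modulo \<open>k\<close>. Then
  \<open>u\<close> and \<open>v\<close> can be chosen primitive in the projected lattice, and this lattice is generated by \<open>u\<close>, \<open>v\<close> and
  \<open>(1/k)(u + v)\<close>. For pairs of hive normals \<open>k = 1\<close>, except that \<open>k = 2\<close> for the three pairs among
  \<open>(1,-1,-1)\<close>, \<open>(-1,1,-1)\<close>, \<open>(-1,-1,1)\<close>.

  For \<open>k \<in> {1, 2}\<close> the Berline--Vergne recursion of such a cone can be solved in closed form. The function of a ray is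
  \<open>h(s) = 1/(1 - exp s) + 1/s = 1/2 - s/12 + \<dots>\<close>. With \<open>x = \<langle>\<xi>, u\<rangle>\<close>, \<open>y = \<langle>\<xi>, v\<rangle>\<close>, \<open>a = \<langle>u, v\<rangle>/\<langle>u, u\<rangle>\<close> and
  \<open>b = \<langle>u, v\<rangle>/\<langle>v, v\<rangle>\<close> the transverse cones along the two rays contribute \<open>- h((y - ax)/k)/x\<close> and
  \<open>- h((x - by)/k)/y\<close> to the exponential sum. Subtracting them and the integral \<open>k/(xy)\<close> over the cone from the
  sum leaves the function \<open>cone_BV\<close>. Its apparent poles are divided differences of \<open>h\<close>, such as
  \<open>(h(y/k) - h((y - ax)/k))/x\<close>, so it is analytic (\<open>BV_function_cone\<close>), and its value at 0 is
  \<open>1/4 + (a + b)/(12 k)\<close>. Analyticity in the sense of convergent multivariate series is obtained from an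
  algebra of power series with a weighted \<open>\<ell>\<^sup>1\<close> norm, which contains \<open>h\<close> and its divided differences
  evaluated at linear forms.

  The weight is well defined because the value at 0 is forced (\<open>BV_function_cone_value\<close>). No analytic
  continuation is needed for this: there is a direction \<open>\<eta>\<close> in which the defining series and integrals converge
  for the cone and for both transverse rays at once. Along it the recursion determines the function near 0, and
  continuity at 0 does the rest.

  In terms of \<open>m\<close> and \<open>n\<close> the weight is \<open>1/4 - (\<langle>m, n\<rangle>/\<langle>m, m\<rangle> + \<langle>m, n\<rangle>/\<langle>n, n\<rangle>)/(12 k)\<close> (\<open>BV_weight_pair\<close>). It remains
  to go through the finitely many pairs. The largest correction is \<open>2/3 + 1\<close> with \<open>k = 1\<close>, for example for
  \<open>(1,-1,-1)\<close> and \<open>(1,-1,0)\<close>, and \<open>1/4 - (5/3)/12 = 1/9\<close>.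
\<close>

section \<open>Power series in several variables\<close>

definition monomial :: "('n::finite \<Rightarrow> nat) \<Rightarrow> real^'n \<Rightarrow> real" where
  "monomial m \<xi> = (\<Prod>i\<in>UNIV. (\<xi> $ i) ^ m i)"

text \<open>
  The functions on the cube \<open>\<bar>\<xi>\<^sub>i\<bar> \<le> r\<close> given by power series form a Banach algebra under the weighted
  \<open>\<ell>\<^sup>1\<close> norm \<open>\<Sum>\<^sub>m \<bar>a\<^sub>m\<bar> r\<^bsup>|m|\<^esup>\<close>, and \<open>K\<close> bounds this norm. Carrying the bound along is what makes the
  substitution of a function into a one-variable series converge.
\<close>
definition series_bounded :: "real \<Rightarrow> real \<Rightarrow> (real^'n \<Rightarrow> real) \<Rightarrow> bool" where
  "series_bounded r K g \<longleftrightarrow>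
     r > 0 \<and> (\<exists>a S. S \<le> K \<and> ((\<lambda>m::'n \<Rightarrow> nat. \<bar>a m\<bar> * r ^ sum m UNIV) has_sum S) UNIV \<and>
        (\<forall>\<xi>. (\<forall>i. \<bar>\<xi> $ i\<bar> \<le> r) \<longrightarrow> ((\<lambda>m. a m * monomial m \<xi>) has_sum g \<xi>) UNIV))"

lemma monomial_add: "monomial (\<lambda>i. m i + n i) \<xi> = monomial m \<xi> * monomial n \<xi>"
  by (simp add: monomial_def power_add prod.distrib)

lemma abs_monomial_le:
  assumes "\<And>i. \<bar>\<xi> $ i\<bar> \<le> r"
  shows "\<bar>monomial m \<xi>\<bar> \<le> r ^ sum m UNIV"
  unfolding monomial_def abs_prod power_sum using assms
  by (intro prod_mono) (simp add: power_abs power_mono)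

text \<open>
  All closure properties rest on this lemma: an absolutely convergent sum of monomials over any
  index set, in which an exponent may occur many times, becomes a power series when the terms are
  collected by their exponent.
\<close>
lemma series_bounded_regroup:
  fixes e :: "'k \<Rightarrow> 'n::finite \<Rightarrow> nat"
  assumes r: "r > 0" and "S \<le> K"
    and S: "((\<lambda>t. \<bar>c t\<bar> * r ^ sum (e t) UNIV) has_sum S) T"
    and g: "\<And>\<xi>. (\<And>i. \<bar>\<xi> $ i\<bar> \<le> r) \<Longrightarrow> ((\<lambda>t. c t * monomial (e t) \<xi>) has_sum g \<xi>) T"
  shows "series_bounded r K g"
proof -
  define fib where "fib m = {t\<in>T. e t = m}" for m
  define a where "a m = infsum c (fib m)" for m
  have abs_fib: "(\<lambda>t. \<bar>c t\<bar>) summable_on fib m" for m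
  proof -
    have "(\<lambda>t. \<bar>c t\<bar> * r ^ sum (e t) UNIV) summable_on fib m"
      by (rule summable_on_subset_banach[of _ T]) (use S fib_def in \<open>auto simp: summable_on_def\<close>)
    hence "(\<lambda>t. \<bar>c t\<bar> * r ^ sum m UNIV) summable_on fib m"
      by (rule summable_on_cong[THEN iffD1, rotated]) (simp add: fib_def)
    thus ?thesis using r by (simp add: summable_on_cmult_left')
  qed
  have c_fib: "(c has_sum a m) (fib m)" for m
    unfolding a_def by (rule has_sum_infsum) (use summable_on_iff_abs_summable_on_real[THEN iffD2] abs_fib[of m] in simp)
  have fibers: "((\<lambda>(m,t). h t) has_sum s) (Sigma UNIV fib)" if "(h has_sum s) T" for h :: "'k \<Rightarrow> real" and s
  proof -
    have "((\<lambda>(m,t). h t) has_sum s) (Sigma UNIV fib) \<longleftrightarrow> (h has_sum s) T"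
      by (rule has_sum_reindex_bij_witness[of _ "\<lambda>t. (e t, t)" snd]) (auto simp: fib_def)
    thus ?thesis using that by simp
  qed
  have abs: "((\<lambda>t. \<bar>c t\<bar> * r ^ sum (e t) UNIV) has_sum infsum (\<lambda>t. \<bar>c t\<bar>) (fib m) * r ^ sum m UNIV) (fib m)" for m
  proof -
    have "((\<lambda>t. \<bar>c t\<bar> * r ^ sum m UNIV) has_sum infsum (\<lambda>t. \<bar>c t\<bar>) (fib m) * r ^ sum m UNIV) (fib m)"
      by (intro has_sum_cmult_left has_sum_infsum abs_fib)
    thus ?thesis by (rule has_sum_cong[THEN iffD1, rotated]) (simp add: fib_def)
  qed
  have N: "((\<lambda>m. infsum (\<lambda>t. \<bar>c t\<bar>) (fib m) * r ^ sum m UNIV) has_sum S) UNIV"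
    by (rule has_sum_SigmaD[OF fibers[OF S]]) (use abs in simp)
  have a_le: "\<bar>a m\<bar> \<le> infsum (\<lambda>t. \<bar>c t\<bar>) (fib m)" for m
    using norm_has_sum_bound[of c "fib m" _ "a m"] c_fib has_sum_infsum[OF abs_fib] by auto
  have a_sum: "(\<lambda>m. \<bar>a m\<bar> * r ^ sum m UNIV) summable_on UNIV"
    by (rule summable_on_comparison_test[where f = "\<lambda>m. infsum (\<lambda>t. \<bar>c t\<bar>) (fib m) * r ^ sum m UNIV"])
      (use N a_le r in \<open>auto simp: summable_on_def intro!: mult_right_mono\<close>)
  have "infsum (\<lambda>m. \<bar>a m\<bar> * r ^ sum m UNIV) UNIV \<le> S"
    using has_sum_mono[OF has_sum_infsum[OF a_sum] N] a_le r by (auto intro!: mult_right_mono)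
  moreover have "((\<lambda>m. a m * monomial m \<xi>) has_sum g \<xi>) UNIV" if "\<forall>i. \<bar>\<xi> $ i\<bar> \<le> r" for \<xi>
  proof (rule has_sum_SigmaD[OF fibers[OF g]])
    fix m :: "'n \<Rightarrow> nat"
    have "((\<lambda>t. c t * monomial m \<xi>) has_sum (a m * monomial m \<xi>)) (fib m)"
      by (intro has_sum_cmult_left c_fib)
    hence "((\<lambda>t. c t * monomial (e t) \<xi>) has_sum (a m * monomial m \<xi>)) (fib m)"
      by (rule has_sum_cong[THEN iffD1, rotated]) (simp add: fib_def)
    thus "((\<lambda>t. case (m, t) of (m, t) \<Rightarrow> c t * monomial (e t) \<xi>) has_sum (a m * monomial m \<xi>)) (fib m)"
      by simp
  qed (use that in auto)
  ultimately show ?thesis unfolding series_bounded_def using r a_sum \<open>S \<le> K\<close>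
    by (intro conjI exI[of _ a] exI[of _ "infsum (\<lambda>m. \<bar>a m\<bar> * r ^ sum m UNIV) UNIV"]) auto
qed

lemma series_boundedE:
  assumes "series_bounded r K (g :: real^'n \<Rightarrow> real)"
  obtains a S where "r > 0" "S \<le> K" "S \<ge> 0"
    "((\<lambda>m::'n \<Rightarrow> nat. \<bar>a m\<bar> * r ^ sum m UNIV) has_sum S) UNIV"
    "\<And>\<xi>. (\<And>i. \<bar>\<xi> $ i\<bar> \<le> r) \<Longrightarrow> ((\<lambda>m. a m * monomial m \<xi>) has_sum g \<xi>) UNIV"
    "\<And>\<xi>. (\<And>i. \<bar>\<xi> $ i\<bar> \<le> r) \<Longrightarrow> \<bar>g \<xi>\<bar> \<le> S"
proof -
  obtain a S where a: "r > 0" "S \<le> K" "((\<lambda>m::'n \<Rightarrow> nat. \<bar>a m\<bar> * r ^ sum m UNIV) has_sum S) UNIV"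
    "\<And>\<xi>. (\<And>i. \<bar>\<xi> $ i\<bar> \<le> r) \<Longrightarrow> ((\<lambda>m. a m * monomial m \<xi>) has_sum g \<xi>) UNIV"
    using assms unfolding series_bounded_def by auto
  have "S \<ge> 0" by (rule has_sum_nonneg[OF a(3)]) (use a(1) in auto)
  moreover have "\<bar>g \<xi>\<bar> \<le> S" if \<xi>: "\<And>i. \<bar>\<xi> $ i\<bar> \<le> r" for \<xi>
  proof -
    have le: "\<bar>a m * monomial m \<xi>\<bar> \<le> \<bar>a m\<bar> * r ^ sum m UNIV" for m
      by (simp add: abs_mult mult_left_mono abs_monomial_le \<xi>)
    have "(\<lambda>m. \<bar>a m * monomial m \<xi>\<bar>) summable_on UNIV"
      by (rule summable_on_comparison_test[OF has_sum_imp_summable[OF a(3)]]) (use le in auto)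
    then have h: "((\<lambda>m. \<bar>a m * monomial m \<xi>\<bar>) has_sum infsum (\<lambda>m. \<bar>a m * monomial m \<xi>\<bar>) UNIV) UNIV"
      by (rule has_sum_infsum)
    have "\<bar>g \<xi>\<bar> \<le> infsum (\<lambda>m. \<bar>a m * monomial m \<xi>\<bar>) UNIV"
      using norm_has_sum_bound[OF _ a(4)[OF \<xi>]] h by simp
    also have "\<dots> \<le> S" by (rule has_sum_mono[OF h a(3) le])
    finally show ?thesis .
  qed
  ultimately show ?thesis using a that by blast
qed

lemma series_bounded_mono:
  assumes "series_bounded r K g" "0 < r'" "r' \<le> r" "K \<le> K'"
  shows "series_bounded r' K' g"
proof -
  obtain a S where a: "S \<le> K" "((\<lambda>m. \<bar>a m\<bar> * r ^ sum m UNIV) has_sum S) UNIV"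
    "\<And>\<xi>. (\<And>i. \<bar>\<xi> $ i\<bar> \<le> r) \<Longrightarrow> ((\<lambda>m. a m * monomial m \<xi>) has_sum g \<xi>) UNIV"
    by (rule series_boundedE[OF assms(1)]) blast
  have le: "\<bar>a m\<bar> * r' ^ sum m UNIV \<le> \<bar>a m\<bar> * r ^ sum m UNIV" for m
    using assms by (intro mult_left_mono power_mono) auto
  have "(\<lambda>m. \<bar>a m\<bar> * r' ^ sum m UNIV) summable_on UNIV"
    by (rule summable_on_comparison_test[OF has_sum_imp_summable[OF a(2)]]) (use le assms in auto)
  from has_sum_infsum[OF this] has_sum_mono[OF has_sum_infsum[OF this] a(2) le] show ?thesis
    unfolding series_bounded_def using a(1,3) assms
    by (intro conjI exI[of _ a] exI[of _ "infsum (\<lambda>m. \<bar>a m\<bar> * r' ^ sum m UNIV) UNIV"]) (auto intro: order_trans)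
qed

lemma series_bounded_const: "r > 0 \<Longrightarrow> series_bounded r \<bar>c\<bar> (\<lambda>\<xi> :: real^'n. c)"
  by (rule series_bounded_regroup[where T = "{()}" and c = "\<lambda>_. c" and e = "\<lambda>_ _. 0" and S = "\<bar>c\<bar>"])
     (auto simp: monomial_def intro!: has_sum_finiteI)

lemma series_bounded_linear:
  fixes l :: "real^'n"
  assumes "r > 0"
  shows "series_bounded r (r * (\<Sum>i\<in>UNIV. \<bar>l $ i\<bar>)) (\<lambda>\<xi>. \<xi> \<bullet> l)"
proof (rule series_bounded_regroup[where T = "UNIV :: 'n set" and c = "\<lambda>i. l $ i"
      and e = "\<lambda>i j. if j = i then 1 else 0"])
  have [simp]: "monomial (\<lambda>j. if j = i then 1 else 0) \<xi> = \<xi> $ i" for i and \<xi> :: "real^'n"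
    unfolding monomial_def by (subst prod.remove[of _ i]) (auto intro!: prod.neutral)
  show "((\<lambda>t. l $ t * monomial (\<lambda>j. if j = t then 1 else 0) \<xi>) has_sum \<xi> \<bullet> l) UNIV" for \<xi>
    by (auto intro!: has_sum_finiteI simp: inner_vec_def mult.commute)
qed (use assms in \<open>auto intro!: has_sum_finiteI simp: sum_distrib_left mult.commute\<close>)

lemma series_bounded_add:
  assumes "series_bounded r K f" "series_bounded r K' g"
  shows "series_bounded r (K + K') (\<lambda>\<xi>. f \<xi> + g \<xi>)"
proof -
  obtain a S where a: "S \<le> K" "((\<lambda>m. \<bar>a m\<bar> * r ^ sum m UNIV) has_sum S) UNIV"
    "\<And>\<xi>. (\<forall>i. \<bar>\<xi> $ i\<bar> \<le> r) \<Longrightarrow> ((\<lambda>m. a m * monomial m \<xi>) has_sum f \<xi>) UNIV"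
    using assms(1) unfolding series_bounded_def by auto
  obtain b S' where b: "S' \<le> K'" "((\<lambda>m. \<bar>b m\<bar> * r ^ sum m UNIV) has_sum S') UNIV"
    "\<And>\<xi>. (\<forall>i. \<bar>\<xi> $ i\<bar> \<le> r) \<Longrightarrow> ((\<lambda>m. b m * monomial m \<xi>) has_sum g \<xi>) UNIV"
    using assms(2) unfolding series_bounded_def by auto
  have True: "r > 0" using assms(1) by (simp add: series_bounded_def)
  have ab: "((\<lambda>m. \<bar>a m\<bar> * r ^ sum m UNIV + \<bar>b m\<bar> * r ^ sum m UNIV) has_sum S + S') UNIV"
    by (intro has_sum_add a b)
  have le: "\<bar>a m + b m\<bar> * r ^ sum m UNIV \<le> \<bar>a m\<bar> * r ^ sum m UNIV + \<bar>b m\<bar> * r ^ sum m UNIV" for m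
    using True mult_right_mono[OF abs_triangle_ineq[of "a m" "b m"], of "r ^ sum m UNIV"]
    by (simp add: distrib_right)
  have "(\<lambda>m. \<bar>a m + b m\<bar> * r ^ sum m UNIV) summable_on UNIV"
    by (rule summable_on_comparison_test[OF has_sum_imp_summable[OF ab]]) (use le True in auto)
  from has_sum_infsum[OF this] has_sum_mono[OF has_sum_infsum[OF this] ab le] show ?thesis
    unfolding series_bounded_def using True a(1,3) b(1,3)
    by (intro conjI exI[of _ "\<lambda>m. a m + b m"] exI[of _ "infsum (\<lambda>m. \<bar>a m + b m\<bar> * r ^ sum m UNIV) UNIV"])
       (auto simp: distrib_right intro!: has_sum_add)
qed

lemma series_bounded_mult:
  fixes f g :: "real^'n \<Rightarrow> real"
  assumes "series_bounded r K f" "series_bounded r K' g"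
  shows "series_bounded r (K * K') (\<lambda>\<xi>. f \<xi> * g \<xi>)"
proof -
  obtain a S where r: "r > 0" and S: "0 \<le> S" and a: "S \<le> K" "((\<lambda>m::'n \<Rightarrow> nat. \<bar>a m\<bar> * r ^ sum m UNIV) has_sum S) UNIV"
    "\<And>\<xi>. (\<And>i. \<bar>\<xi> $ i\<bar> \<le> r) \<Longrightarrow> ((\<lambda>m. a m * monomial m \<xi>) has_sum f \<xi>) UNIV"
    by (rule series_boundedE[OF assms(1)]) blast
  obtain b S' where S': "0 \<le> S'" and b: "S' \<le> K'" "((\<lambda>m::'n \<Rightarrow> nat. \<bar>b m\<bar> * r ^ sum m UNIV) has_sum S') UNIV"
    "\<And>\<xi>. (\<And>i. \<bar>\<xi> $ i\<bar> \<le> r) \<Longrightarrow> ((\<lambda>m. b m * monomial m \<xi>) has_sum g \<xi>) UNIV"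
    by (rule series_boundedE[OF assms(2)]) blast
  let ?e = "\<lambda>(p :: 'n \<Rightarrow> nat, q :: 'n \<Rightarrow> nat) i. p i + q i"
  let ?h = "\<lambda>(p, q). (\<bar>a p\<bar> * r ^ sum p UNIV) * (\<bar>b q\<bar> * r ^ sum q UNIV)"
  have row: "((\<lambda>q. ?h (p, q)) has_sum (\<bar>a p\<bar> * r ^ sum p UNIV) * S') UNIV" for p
    using has_sum_cmult_right[OF b(2)] by simp
  have "?h summable_on (UNIV \<times> UNIV)"
    by (rule summable_on_SigmaI[OF row]) (use a(2) r in \<open>auto intro!: summable_on_cmult_left dest: has_sum_imp_summable\<close>)
  hence sum_h: "(?h has_sum S * S') (UNIV \<times> UNIV)"
    by (rule has_sum_SigmaI[OF row has_sum_cmult_left[OF a(2)]])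
  have SS: "S * S' \<le> K * K'" using S S' a(1) b(1) by (intro mult_mono) auto
  show ?thesis
  proof (rule series_bounded_regroup[OF r SS, where T = "UNIV \<times> UNIV" and c = "\<lambda>(p, q). a p * b q" and e = ?e])
    show "((\<lambda>t. \<bar>case t of (p, q) \<Rightarrow> a p * b q\<bar> * r ^ sum (?e t) UNIV) has_sum S * S') (UNIV \<times> UNIV)"
      using sum_h by (rule has_sum_cong[THEN iffD1, rotated])
        (auto simp: abs_mult power_add sum.distrib)
    fix \<xi> :: "real^'n" assume \<xi>: "\<And>i. \<bar>\<xi> $ i\<bar> \<le> r"
    let ?t = "\<lambda>(p, q). (a p * monomial p \<xi>) * (b q * monomial q \<xi>)"
    have row': "((\<lambda>q. ?t (p, q)) has_sum (a p * monomial p \<xi>) * g \<xi>) UNIV" for p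
      using has_sum_cmult_right[OF b(3)[OF \<xi>]] by simp
    have "(\<lambda>x. norm (?t x)) summable_on (UNIV \<times> UNIV)"
      by (rule Infinite_Sum.abs_summable_on_comparison_test'[OF has_sum_imp_summable[OF sum_h]])
        (auto simp: abs_mult intro!: mult_mono mult_nonneg_nonneg abs_monomial_le \<xi> r[THEN less_imp_le] zero_le_power)
    hence "?t summable_on (UNIV \<times> UNIV)" by (rule abs_summable_summable)
    hence "(?t has_sum f \<xi> * g \<xi>) (UNIV \<times> UNIV)"
      by (rule has_sum_SigmaI[OF row' has_sum_cmult_left[OF a(3)[OF \<xi>]]])
    thus "((\<lambda>t. (case t of (p, q) \<Rightarrow> a p * b q) * monomial (?e t) \<xi>) has_sum f \<xi> * g \<xi>) (UNIV \<times> UNIV)"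
      by (rule has_sum_cong[THEN iffD1, rotated]) (auto simp: monomial_add)
  qed
qed

lemma series_bounded_power:
  "series_bounded r K f \<Longrightarrow> series_bounded r (K ^ n) (\<lambda>\<xi>. f \<xi> ^ n)"
proof (induction n)
  case 0
  then show ?case using series_bounded_const[of r 1] by (simp add: series_bounded_def)
qed (simp add: series_bounded_mult)

lemma series_bounded_suminf:
  fixes f :: "nat \<Rightarrow> real^'n \<Rightarrow> real"
  assumes "\<And>n. series_bounded r (K n) (f n)" "K sums Kt"
  shows "series_bounded r Kt (\<lambda>\<xi>. \<Sum>n. f n \<xi>)"
proof -
  have r: "r > 0" using assms(1) by (auto simp: series_bounded_def)
  define Q where "Q n a S \<longleftrightarrow> 0 \<le> S \<and> S \<le> K n \<and> ((\<lambda>m::'n \<Rightarrow> nat. \<bar>a m\<bar> * r ^ sum m UNIV) has_sum S) UNIV \<and>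
    (\<forall>\<xi>. (\<forall>i. \<bar>\<xi> $ i\<bar> \<le> r) \<longrightarrow> ((\<lambda>m. a m * monomial m \<xi>) has_sum f n \<xi>) UNIV \<and> \<bar>f n \<xi>\<bar> \<le> S)" for n a S
  have "\<exists>a S. Q n a S" for n
  proof (rule series_boundedE[OF assms(1)[of n]])
    show "\<exists>a S. Q n a S" if "0 \<le> S" "S \<le> K n" "((\<lambda>m. \<bar>a m\<bar> * r ^ sum m UNIV) has_sum S) UNIV"
      "\<And>\<xi>. (\<And>i. \<bar>\<xi> $ i\<bar> \<le> r) \<Longrightarrow> ((\<lambda>m. a m * monomial m \<xi>) has_sum f n \<xi>) UNIV"
      "\<And>\<xi>. (\<And>i. \<bar>\<xi> $ i\<bar> \<le> r) \<Longrightarrow> \<bar>f n \<xi>\<bar> \<le> S" for a S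
      using that unfolding Q_def by (intro exI[of _ a] exI[of _ S]) auto
  qed
  then obtain a S where Q: "\<And>n. Q n (a n) (S n)" by metis
  have S: "0 \<le> S n" "S n \<le> K n"
    and a: "((\<lambda>m::'n \<Rightarrow> nat. \<bar>a n m\<bar> * r ^ sum m UNIV) has_sum S n) UNIV"
    "\<And>\<xi>. (\<And>i. \<bar>\<xi> $ i\<bar> \<le> r) \<Longrightarrow> ((\<lambda>m. a n m * monomial m \<xi>) has_sum f n \<xi>) UNIV"
    "\<And>\<xi>. (\<And>i. \<bar>\<xi> $ i\<bar> \<le> r) \<Longrightarrow> \<bar>f n \<xi>\<bar> \<le> S n" for n
    using Q[of n] unfolding Q_def by auto
  have K: "(K has_sum Kt) UNIV"
    by (rule sums_nonneg_imp_has_sum[OF assms(2)]) (use order.trans[OF S(1,2)] in simp)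
  have S_sum: "S summable_on UNIV"
    by (rule summable_on_comparison_test[OF has_sum_imp_summable[OF K]]) (use S in auto)
  let ?h = "\<lambda>(n, m). \<bar>a n m\<bar> * r ^ sum m UNIV"
  have "?h summable_on (UNIV \<times> UNIV)"
    by (rule summable_on_SigmaI[OF _ S_sum]) (use a(1) r in auto)
  hence sum_h: "(?h has_sum infsum S UNIV) (UNIV \<times> UNIV)"
    by (rule has_sum_SigmaI[OF _ has_sum_infsum[OF S_sum], rotated]) (use a(1) in auto)
  have le: "infsum S UNIV \<le> Kt" by (rule has_sum_mono[OF has_sum_infsum[OF S_sum] K S(2)])
  show ?thesis
  proof (rule series_bounded_regroup[OF r le, where T = "UNIV \<times> UNIV" and c = "\<lambda>(n, m). a n m" and e = snd])
    show "((\<lambda>t. \<bar>case t of (n, m) \<Rightarrow> a n m\<bar> * r ^ sum (snd t) UNIV) has_sum infsum S UNIV) (UNIV \<times> UNIV)"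
      using sum_h by (rule has_sum_cong[THEN iffD1, rotated]) auto
    fix \<xi> :: "real^'n" assume \<xi>: "\<And>i. \<bar>\<xi> $ i\<bar> \<le> r"
    let ?t = "\<lambda>(n, m). a n m * monomial m \<xi>"
    have "(\<lambda>x. norm (?t x)) summable_on (UNIV \<times> UNIV)"
      by (rule Infinite_Sum.abs_summable_on_comparison_test'[OF has_sum_imp_summable[OF sum_h]])
        (auto simp: abs_mult intro!: mult_mono mult_nonneg_nonneg abs_monomial_le \<xi> r[THEN less_imp_le] zero_le_power)
    hence t: "?t summable_on (UNIV \<times> UNIV)" by (rule abs_summable_summable)
    have "(\<lambda>n. norm (f n \<xi>)) summable_on UNIV"
      by (rule Infinite_Sum.abs_summable_on_comparison_test'[OF S_sum]) (use a(3)[OF \<xi>] in auto)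
    hence "(\<lambda>n. f n \<xi>) summable_on UNIV" by (rule abs_summable_summable)
    hence f: "((\<lambda>n. f n \<xi>) has_sum (\<Sum>n. f n \<xi>)) UNIV"
      using has_sum_infsum has_sum_imp_sums sums_unique by metis
    have "(?t has_sum (\<Sum>n. f n \<xi>)) (UNIV \<times> UNIV)"
      by (rule has_sum_SigmaI[OF _ f t]) (use a(2)[OF \<xi>] in auto)
    thus "((\<lambda>t. (case t of (n, m) \<Rightarrow> a n m) * monomial (snd t) \<xi>) has_sum (\<Sum>n. f n \<xi>)) (UNIV \<times> UNIV)"
      by (rule has_sum_cong[THEN iffD1, rotated]) auto
  qed
qed

text \<open>
  An analytic germ is a function of finite norm for some \<open>r\<close>. Two germs live on a common cube because
  shrinking \<open>r\<close> does not increase the norm.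
\<close>
definition analytic_germ :: "(real^'n \<Rightarrow> real) \<Rightarrow> bool" where
  "analytic_germ g \<longleftrightarrow> (\<exists>r K. series_bounded r K g)"

lemma common_radius:
  assumes "analytic_germ f" "analytic_germ g"
  obtains r K K' where "series_bounded r K f" "series_bounded r K' g"
proof -
  obtain r K r' K' where *: "series_bounded r K f" "series_bounded r' K' g"
    using assms by (auto simp: analytic_germ_def)
  then have "min r r' > 0" by (auto simp: series_bounded_def)
  then have "series_bounded (min r r') K f" "series_bounded (min r r') K' g"
    using * by (auto intro: series_bounded_mono)
  then show ?thesis using that by blast
qed

lemma analytic_germ_const [intro]: "analytic_germ (\<lambda>\<xi>. c)"
  unfolding analytic_germ_def using series_bounded_const zero_less_one by blast

lemma analytic_germ_add [intro]:
  "analytic_germ f \<Longrightarrow> analytic_germ g \<Longrightarrow> analytic_germ (\<lambda>\<xi>. f \<xi> + g \<xi>)"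
  by (erule (1) common_radius) (auto simp: analytic_germ_def intro: series_bounded_add)

lemma analytic_germ_mult [intro]:
  "analytic_germ f \<Longrightarrow> analytic_germ g \<Longrightarrow> analytic_germ (\<lambda>\<xi>. f \<xi> * g \<xi>)"
  by (erule (1) common_radius) (auto simp: analytic_germ_def intro: series_bounded_mult)

lemma analytic_germ_diff [intro]:
  "analytic_germ f \<Longrightarrow> analytic_germ g \<Longrightarrow> analytic_germ (\<lambda>\<xi>. f \<xi> - g \<xi>)"
  using analytic_germ_add[OF _ analytic_germ_mult[OF analytic_germ_const[of "-1"]], of f g] by simp

lemma analytic_germ_imp_analytic_near_0_on:
  assumes "analytic_germ g"
  shows "analytic_near_0_on L g"
proof -
  obtain r K where "series_bounded r K g" using assms by (auto simp: analytic_germ_def)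
  then obtain a where "r > 0" and a: "\<And>\<xi>. (\<And>i. \<bar>\<xi> $ i\<bar> \<le> r) \<Longrightarrow> ((\<lambda>m. a m * monomial m \<xi>) has_sum g \<xi>) UNIV"
    by (rule series_boundedE) blast
  have "\<bar>\<xi> $ i\<bar> \<le> r" if "norm \<xi> < r" for \<xi> :: "real^'n" and i
    using component_le_norm_cart[of \<xi> i] that by linarith
  with a \<open>r > 0\<close> show ?thesis unfolding analytic_near_0_on_def monomial_def
    by (intro exI[of _ g] exI[of _ a] exI[of _ r]) auto
qed

lemma series_bounded_eval_fps:
  assumes "series_bounded r K f" "0 \<le> K" "ereal K < fps_conv_radius F"
  shows "series_bounded r (\<Sum>n. \<bar>fps_nth F n\<bar> * K ^ n) (\<lambda>\<xi>. eval_fps F (f \<xi>))"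
  unfolding eval_fps_def
proof (rule series_bounded_suminf)
  show "series_bounded r (\<bar>fps_nth F n\<bar> * K ^ n) (\<lambda>\<xi>. fps_nth F n * f \<xi> ^ n)" for n
    by (intro series_bounded_mult series_bounded_const series_bounded_power assms(1))
      (use assms(1) in \<open>simp add: series_bounded_def\<close>)
  have "summable (\<lambda>n. \<bar>fps_nth F n\<bar> * K ^ n)"
    using norm_summable_fps[of K F] assms by (simp add: abs_mult)
  thus "(\<lambda>n. \<bar>fps_nth F n\<bar> * K ^ n) sums (\<Sum>n. \<bar>fps_nth F n\<bar> * K ^ n)" by (rule summable_sums)
qed

text \<open>
  The quotient \<open>(F(s) - F(t)) / (s - t)\<close>, continued to \<open>s = t\<close>. The inner sum is
  \<open>(s\<^bsup>n+1\<^esup> - t\<^bsup>n+1\<^esup>) / (s - t)\<close>; the constant term of \<open>F\<close> cancels, hence the shifted index.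
\<close>
definition divided_difference :: "real fps \<Rightarrow> real \<Rightarrow> real \<Rightarrow> real" where
  "divided_difference F s t = (\<Sum>n. fps_nth F (Suc n) * (\<Sum>i<Suc n. t ^ (n - i) * s ^ i))"

lemma divided_difference_0: "divided_difference F 0 0 = fps_nth F 1"
proof -
  have "fps_nth F (Suc n) * (\<Sum>i<Suc n. 0 ^ (n - i) * 0 ^ i) = (if n = 0 then fps_nth F 1 else 0)" for n
  proof -
    have "(\<Sum>i<Suc n. 0 ^ (n - i) * 0 ^ i :: real) = 0" if "n \<noteq> 0"
      using that by (intro sum.neutral) (auto simp: power_0_left)
    thus ?thesis by auto
  qed
  thus ?thesis unfolding divided_difference_def by (subst suminf_finite[of "{0}"]) auto
qed

lemma divided_difference:
  assumes "ereal \<bar>s\<bar> < fps_conv_radius F" "ereal \<bar>t\<bar> < fps_conv_radius F"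
  shows "(s - t) * divided_difference F s t = eval_fps F s - eval_fps F t"
proof (cases "s = t")
  case False
  have "(\<lambda>n. fps_nth F n * s ^ n - fps_nth F n * t ^ n) sums (eval_fps F s - eval_fps F t)"
    using assms by (intro sums_diff sums_eval_fps) auto
  hence "(\<lambda>n. fps_nth F (Suc n) * s ^ Suc n - fps_nth F (Suc n) * t ^ Suc n) sums (eval_fps F s - eval_fps F t)"
    by (subst sums_Suc_iff) simp
  also have "(\<lambda>n. fps_nth F (Suc n) * s ^ Suc n - fps_nth F (Suc n) * t ^ Suc n) =
    (\<lambda>n. (s - t) * (fps_nth F (Suc n) * (\<Sum>i<Suc n. t ^ (n - i) * s ^ i)))"
  proof
    fix n
    have "fps_nth F (Suc n) * s ^ Suc n - fps_nth F (Suc n) * t ^ Suc n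
      = fps_nth F (Suc n) * (s ^ Suc n - t ^ Suc n)" by (simp only: right_diff_distrib)
    also have "\<dots> = (s - t) * (fps_nth F (Suc n) * (\<Sum>i<Suc n. t ^ (n - i) * s ^ i))"
      by (subst power_diff_sumr2) (simp only: diff_Suc_Suc mult_ac)
    finally show "fps_nth F (Suc n) * s ^ Suc n - fps_nth F (Suc n) * t ^ Suc n
      = (s - t) * (fps_nth F (Suc n) * (\<Sum>i<Suc n. t ^ (n - i) * s ^ i))" .
  qed
  finally have *: "(\<lambda>n. (s - t) * (fps_nth F (Suc n) * (\<Sum>i<Suc n. t ^ (n - i) * s ^ i)))
    sums (eval_fps F s - eval_fps F t)" .
  hence "(\<lambda>n. fps_nth F (Suc n) * (\<Sum>i<Suc n. t ^ (n - i) * s ^ i)) sums ((eval_fps F s - eval_fps F t) / (s - t))"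
    using sums_divide[OF *, of "s - t"] False by simp
  hence "divided_difference F s t = (eval_fps F s - eval_fps F t) / (s - t)"
    unfolding divided_difference_def by (rule sums_unique[symmetric])
  thus ?thesis using False by simp
qed simp

lemma series_bounded_sum:
  assumes "finite I" "r > 0" "\<And>i. i \<in> I \<Longrightarrow> series_bounded r (K i) (f i)"
  shows "series_bounded r (\<Sum>i\<in>I. K i) (\<lambda>\<xi>. \<Sum>i\<in>I. f i \<xi>)"
  using assms(1,3) 
proof induction
  case empty
  then show ?case using series_bounded_const[OF assms(2), of 0] by simp
qed (simp add: series_bounded_add)

text \<open>
  If \<open>s\<close> and \<open>t\<close> have norm at most \<open>K\<close>, the inner sum has norm at most \<open>(n + 1) K\<^sup>n\<close>, so the series is
  majorized by that of the derivative of \<open>F\<close>, which has at least the radius of convergence of \<open>F\<close>.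
\<close>
lemma series_bounded_divided_difference:
  assumes f: "series_bounded r K f" and g: "series_bounded r K g" and "0 \<le> K" "ereal K < fps_conv_radius F"
  shows "series_bounded r (\<Sum>n. \<bar>fps_nth F (Suc n)\<bar> * (real (Suc n) * K ^ n))
           (\<lambda>\<xi>. divided_difference F (f \<xi>) (g \<xi>))"
  unfolding divided_difference_def
proof (rule series_bounded_suminf)
  have r: "r > 0" using f by (simp add: series_bounded_def)
  show "series_bounded r (\<bar>fps_nth F (Suc n)\<bar> * (real (Suc n) * K ^ n))
      (\<lambda>\<xi>. fps_nth F (Suc n) * (\<Sum>i<Suc n. g \<xi> ^ (n - i) * f \<xi> ^ i))" for n
  proof (rule series_bounded_mult[OF series_bounded_const[OF r]])
    have "series_bounded r (\<Sum>i<Suc n. K ^ (n - i) * K ^ i) (\<lambda>\<xi>. \<Sum>i<Suc n. g \<xi> ^ (n - i) * f \<xi> ^ i)"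
      by (intro series_bounded_sum series_bounded_mult series_bounded_power f g r) simp
    also have "(\<Sum>i<Suc n. K ^ (n - i) * K ^ i) = (\<Sum>i<Suc n. K ^ n)"
      by (intro sum.cong) (auto simp flip: power_add)
    finally show "series_bounded r (real (Suc n) * K ^ n) (\<lambda>\<xi>. \<Sum>i<Suc n. g \<xi> ^ (n - i) * f \<xi> ^ i)"
      by simp
  qed
  have "ereal K < fps_conv_radius (fps_deriv F)"
    using assms(4) fps_conv_radius_deriv[of F] by (rule less_le_trans)
  then have "summable (\<lambda>n. norm (fps_nth (fps_deriv F) n * K ^ n))"
    using norm_summable_fps[of K "fps_deriv F"] \<open>0 \<le> K\<close> by simp
  also have "(\<lambda>n. norm (fps_nth (fps_deriv F) n * K ^ n)) = (\<lambda>n. \<bar>fps_nth F (Suc n)\<bar> * (real (Suc n) * K ^ n))"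
    using \<open>0 \<le> K\<close> by (auto simp: abs_mult simp del: of_nat_Suc)
  finally show "(\<lambda>n. \<bar>fps_nth F (Suc n)\<bar> * (real (Suc n) * K ^ n)) sums
      (\<Sum>n. \<bar>fps_nth F (Suc n)\<bar> * (real (Suc n) * K ^ n))" by (rule summable_sums)
qed

text \<open>
  The norm of a linear form is proportional to \<open>r\<close>, so it falls below any given radius \<open>R\<close>.
\<close>
lemma linear_forms_bounded:
  fixes l l' :: "real^'n"
  assumes "R > 0"
  obtains r K where "0 \<le> K" "ereal K < R" "series_bounded r K (\<lambda>\<xi>. \<xi> \<bullet> l)" "series_bounded r K (\<lambda>\<xi>. \<xi> \<bullet> l')"
proof -
  obtain K where K: "0 < K" "ereal K < R"
    using ereal_dense2[OF assms] by auto
  let ?A = "(\<Sum>i\<in>UNIV. \<bar>l $ i\<bar>)" and ?B = "(\<Sum>i\<in>UNIV. \<bar>l' $ i\<bar>)"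
  define r where "r = K / (1 + ?A + ?B)"
  have nn: "?A \<ge> 0" "?B \<ge> 0" by (auto intro: sum_nonneg)
  have pos: "1 + ?A + ?B > 0" using nn by linarith
  have r: "r > 0" unfolding r_def using K pos by simp
  have rK: "r * (1 + ?A + ?B) = K" using pos unfolding r_def by simp
  have "r * ?A \<le> r * (1 + ?A + ?B)" "r * ?B \<le> r * (1 + ?A + ?B)"
    using r nn by (auto intro!: mult_left_mono)
  hence "r * ?A \<le> K" "r * ?B \<le> K" unfolding rK by auto
  with r have "series_bounded r K (\<lambda>\<xi>. \<xi> \<bullet> l)" "series_bounded r K (\<lambda>\<xi>. \<xi> \<bullet> l')"
    using series_bounded_mono[OF series_bounded_linear[OF r]] by auto
  with K show ?thesis using that[of K r] by simp
qed

lemma analytic_germ_eval_fps [intro]: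
  "fps_conv_radius F > 0 \<Longrightarrow> analytic_germ (\<lambda>\<xi>. eval_fps F (\<xi> \<bullet> l))"
  unfolding analytic_germ_def
  by (erule linear_forms_bounded[of _ l l]) (intro exI, rule series_bounded_eval_fps)

lemma analytic_germ_divided_difference [intro]:
  "fps_conv_radius F > 0 \<Longrightarrow> analytic_germ (\<lambda>\<xi>. divided_difference F (\<xi> \<bullet> l) (\<xi> \<bullet> l'))"
  unfolding analytic_germ_def
  by (erule linear_forms_bounded[of _ l l']) (intro exI, rule series_bounded_divided_difference)

text \<open>
  Continuity at 0 along a ray. In absolute value every nonconstant monomial is at most \<open>t / t\<^sub>0\<close> times its value at
  \<open>t\<^sub>0 \<eta>\<close>, and the series at \<open>t\<^sub>0 \<eta>\<close> converges absolutely.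
\<close>
lemma analytic_near_0_on_tendsto:
  fixes \<eta> :: "real^'n"
  assumes "analytic_near_0_on L f" "subspace L" "\<eta> \<in> L"
  shows "((\<lambda>t. f (t *\<^sub>R \<eta>)) \<longlongrightarrow> f 0) (at_right 0)"
proof -
  obtain g a \<epsilon> where \<epsilon>: "\<epsilon> > 0" and g: "\<And>\<xi>. norm \<xi> < \<epsilon> \<Longrightarrow> ((\<lambda>m. a m * monomial m \<xi>) has_sum g \<xi>) UNIV"
    and fg: "\<And>\<xi>. \<xi> \<in> L \<Longrightarrow> norm \<xi> < \<epsilon> \<Longrightarrow> f \<xi> = g \<xi>"
    using assms(1) unfolding analytic_near_0_on_def monomial_def by blast
  \<comment> \<open>the summand 1 covers the case that \<open>\<eta>\<close> is zero\<close>
  define t0 where "t0 = \<epsilon> / (norm \<eta> + 1)"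
  have pos: "norm \<eta> + 1 > 0" using norm_ge_zero[of \<eta>] by linarith
  have t0: "t0 > 0" using \<epsilon> pos unfolding t0_def by simp
  have small: "norm (t *\<^sub>R \<eta>) < \<epsilon>" if "0 \<le> t" "t \<le> t0" for t
  proof -
    have "t * norm \<eta> \<le> t0 * norm \<eta>" using that by (intro mult_right_mono) auto
    also have "\<dots> < t0 * (norm \<eta> + 1)" using t0 by (simp add: distrib_left)
    also have "\<dots> = \<epsilon>" using pos unfolding t0_def by simp
    finally show ?thesis using that by simp
  qed
  have hom: "monomial m (c *\<^sub>R \<xi>) = c ^ sum m UNIV * monomial m \<xi>" for c m and \<xi> :: "real^'n"
    by (simp add: monomial_def power_mult_distrib prod.distrib power_sum)
  have sum0: "sum m UNIV = 0 \<longleftrightarrow> m = (\<lambda>_. 0)" for m :: "'n \<Rightarrow> nat" by auto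
  let ?b = "\<lambda>m. a m * monomial m (t0 *\<^sub>R \<eta>)"
  have "?b summable_on UNIV" using has_sum_imp_summable[OF g[OF small[of t0]]] t0 by simp
  hence b: "(\<lambda>m. \<bar>?b m\<bar>) summable_on UNIV"
    by (drule_tac summable_on_iff_abs_summable_on_real[THEN iffD1]) simp
  define S where "S = infsum (\<lambda>m. \<bar>?b m\<bar>) UNIV"
  have S: "((\<lambda>m. \<bar>?b m\<bar>) has_sum S) UNIV" unfolding S_def by (rule has_sum_infsum[OF b])
  have bound: "\<bar>g (t *\<^sub>R \<eta>) - g 0\<bar> \<le> t / t0 * S" if t: "0 \<le> t" "t \<le> t0" for t
  proof -
    let ?d = "\<lambda>m. a m * monomial m (t *\<^sub>R \<eta>) - a m * monomial m 0"
    have d: "(?d has_sum (g (t *\<^sub>R \<eta>) - g 0)) UNIV"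
      using has_sum_add[OF g[OF small[OF t]] has_sum_uminusI[OF g[of 0]]] \<epsilon> by simp
    have le: "norm (?d m) \<le> t / t0 * \<bar>?b m\<bar>" for m
    proof (cases "m = (\<lambda>_. 0)")
      case False
      then obtain n where n: "sum m UNIV = Suc n" using sum0 not0_implies_Suc by blast
      have "?d m = (t / t0) ^ Suc n * ?b m"
        using hom[of m t \<eta>] hom[of m t0 \<eta>] hom[of m 0 0] n t0 by (simp add: power_divide)
      moreover have "(t / t0) ^ Suc n \<le> t / t0"
        using t t0 mult_left_mono[of "(t / t0) ^ n" 1 "t / t0"] by (simp add: power_le_one)
      ultimately show ?thesis using t t0 mult_right_mono[of "(t / t0) ^ Suc n" "t / t0" "\<bar>?b m\<bar>"]
        by (simp add: abs_mult power_abs del: power_Suc)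
    qed (use t t0 in \<open>auto simp: monomial_def\<close>)
    have tS: "((\<lambda>m. t / t0 * \<bar>?b m\<bar>) has_sum t / t0 * S) UNIV" by (rule has_sum_cmult_right[OF S])
    have "(\<lambda>m. norm (?d m)) summable_on UNIV"
      by (rule Infinite_Sum.abs_summable_on_comparison_test'[OF has_sum_imp_summable[OF tS] le])
    from norm_has_sum_bound[OF has_sum_infsum[OF this] d] has_sum_mono[OF has_sum_infsum[OF this] tS le]
    show ?thesis by simp
  qed
  have small_t: "\<forall>\<^sub>F t in at_right 0. 0 \<le> t \<and> t \<le> t0"
    using t0 by (auto simp: eventually_at_right_field intro!: exI[of _ t0])
  have "((\<lambda>t. t / t0 * S) \<longlongrightarrow> 0 / t0 * S) (at_right 0)"
    by (intro tendsto_intros) (use t0 in auto)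
  hence lim0: "((\<lambda>t. t / t0 * S) \<longlongrightarrow> 0) (at_right 0)" by simp
  have "((\<lambda>t. g (t *\<^sub>R \<eta>) - g 0) \<longlongrightarrow> 0) (at_right 0)"
    by (rule Lim_null_comparison[OF _ lim0]) (rule eventually_mono[OF small_t], use bound in simp)
  hence "((\<lambda>t. g (t *\<^sub>R \<eta>)) \<longlongrightarrow> g 0) (at_right 0)" by (simp add: LIM_zero_iff)
  moreover have "\<forall>\<^sub>F t in at_right 0. g (t *\<^sub>R \<eta>) = f (t *\<^sub>R \<eta>)"
    using small_t by eventually_elim (use fg small assms(2,3) in \<open>auto simp: subspace_scale\<close>)
  moreover have "g 0 = f 0" using fg[of 0] \<epsilon> assms(2) by (simp add: subspace_0)
  ultimately show ?thesis using tendsto_cong[of "\<lambda>t. g (t *\<^sub>R \<eta>)" "\<lambda>t. f (t *\<^sub>R \<eta>)"] by simp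
qed

section \<open>The generating function of a ray\<close>

text \<open>
  The Taylor series at 0 of \<open>(exp s - 1) / s\<close>.
\<close>
definition exp_quotient :: "real fps" where
  "exp_quotient = fps_shift 1 (fps_exp 1 - 1)"

text \<open>
  The Taylor series at 0 of \<open>h(s) = 1 / (1 - exp s) + 1 / s\<close>. For a ray with generator \<open>w\<close> and lattice
  \<open>\<int> w\<close> the sum is \<open>1 / (1 - exp s)\<close> and the integral \<open>- 1 / s\<close> at \<open>s = \<langle>\<xi>, w\<rangle>\<close>, so \<open>h(s)\<close> is its
  Berline--Vergne function.
\<close>
definition ray_series :: "real fps" where
  "ray_series = fps_shift 1 (1 - inverse exp_quotient)"

lemma subdegree_shifted: "fps_nth f 0 = (0 :: real) \<Longrightarrow> f \<noteq> 0 \<Longrightarrow> 1 \<le> subdegree f"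
  by (metis One_nat_def Suc_leI nth_subdegree_nonzero neq0_conv)

lemma exp_quotient_nth: "fps_nth exp_quotient n = 1 / fact (Suc n)"
  by (simp add: exp_quotient_def algebra_simps)

lemma fps_conv_radius_exp_quotient: "fps_conv_radius exp_quotient = \<infinity>"
proof -
  have "\<infinity> \<le> fps_conv_radius (fps_exp 1 - 1 :: real fps)"
    using fps_conv_radius_diff[of "fps_exp 1 :: real fps" 1] by simp
  thus ?thesis by (simp add: exp_quotient_def)
qed

lemma inverse_exp_quotient: "exp_quotient * inverse exp_quotient = 1"
  by (rule inverse_mult_eq_1') (simp add: exp_quotient_nth)

lemma inverse_exp_quotient_radius: "fps_conv_radius (inverse exp_quotient) > 0"
  by (rule fps_conv_radius_inverse_pos) (simp_all add: exp_quotient_nth fps_conv_radius_exp_quotient)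

lemma inverse_exp_quotient_nth:
  "fps_nth (inverse exp_quotient) 0 = 1"
  "fps_nth (inverse exp_quotient) 1 = -1/2"
  "fps_nth (inverse exp_quotient) 2 = 1/12"
proof -
  have eq: "(\<Sum>i=0..n. fps_nth exp_quotient i * fps_nth (inverse exp_quotient) (n - i)) = (if n = 0 then 1 else 0)" for n
    using arg_cong[OF inverse_exp_quotient, of "\<lambda>f. fps_nth f n"] by (simp add: fps_mult_nth)
  show *: "fps_nth (inverse exp_quotient) 0 = 1"
    using eq[of 0] by (simp add: exp_quotient_nth)
  show **: "fps_nth (inverse exp_quotient) 1 = -1/2"
    using eq[of 1] * by (simp add: exp_quotient_nth)
  show "fps_nth (inverse exp_quotient) 2 = 1/12"
    using eq[of 2] * ** by (simp add: exp_quotient_nth numeral_2_eq_2 fact_Suc)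
qed

lemma ray_series_nth: "fps_nth ray_series 0 = 1/2" "fps_nth ray_series 1 = -1/12"
  using inverse_exp_quotient_nth by (simp_all add: ray_series_def numeral_2_eq_2)

lemma ray_series_radius: "fps_conv_radius ray_series > 0"
  using fps_conv_radius_diff[of "1 :: real fps" "inverse exp_quotient"] inverse_exp_quotient_radius
  unfolding ray_series_def fps_conv_radius_shift by (auto intro: less_le_trans)

lemma eval_ray_series:
  obtains R where "R > 0" "ereal R \<le> fps_conv_radius ray_series"
    "\<And>s. \<lbrakk>s \<noteq> 0; \<bar>s\<bar> < R\<rbrakk> \<Longrightarrow> eval_fps ray_series s = 1 / (1 - exp s) + 1 / s"
proof -
  have "min (fps_conv_radius (inverse exp_quotient)) (fps_conv_radius ray_series) > 0"
    using inverse_exp_quotient_radius ray_series_radius by simp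
  then obtain R where R: "R > 0" "ereal R < min (fps_conv_radius (inverse exp_quotient)) (fps_conv_radius ray_series)"
    using ereal_dense2 by (metis ereal_less(2))
  have "eval_fps ray_series s = 1 / (1 - exp s) + 1 / s" if s: "s \<noteq> 0" "\<bar>s\<bar> < R" for s
  proof -
    have s1: "ereal \<bar>s\<bar> < fps_conv_radius (inverse exp_quotient)"
      using s R by (metis ereal_less_eq(3) less_imp_le min.strict_boundedE order.strict_trans2 le_less_trans)
    have sub: "1 \<le> subdegree (fps_exp 1 - 1 :: real fps)"
    proof (rule subdegree_shifted)
      have "fps_nth (fps_exp 1 - 1 :: real fps) 1 \<noteq> 0" by simp
      thus "(fps_exp 1 - 1 :: real fps) \<noteq> 0" by (metis fps_zero_nth)
    qed simp
    have "eval_fps (fps_exp 1 - 1) s = exp s - 1" by (subst eval_fps_diff) auto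
    hence E: "eval_fps exp_quotient s = (exp s - 1) / s"
      unfolding exp_quotient_def using s sub fps_conv_radius_exp_quotient
      by (subst eval_fps_shift) (auto simp: exp_quotient_def)
    have "eval_fps exp_quotient s * eval_fps (inverse exp_quotient) s = 1"
      using arg_cong[OF inverse_exp_quotient, of "\<lambda>f. eval_fps f s"] s1
      by (subst (asm) eval_fps_mult) (auto simp: fps_conv_radius_exp_quotient)
    hence G: "eval_fps (inverse exp_quotient) s = s / (exp s - 1)"
      using E s by (simp add: field_simps)
    have radius: "ereal \<bar>s\<bar> < fps_conv_radius (1 - inverse exp_quotient)"
      using s1 fps_conv_radius_diff[of "1 :: real fps" "inverse exp_quotient"] by (auto intro: less_le_trans)
    have "1 \<le> subdegree (1 - inverse exp_quotient)"
    proof (rule subdegree_shifted)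
      have "fps_nth (1 - inverse exp_quotient) 1 \<noteq> 0" using inverse_exp_quotient_nth(2) by simp
      thus "1 - inverse exp_quotient \<noteq> 0" by (metis fps_zero_nth)
    qed (use inverse_exp_quotient_nth(1) in simp)
    hence "eval_fps ray_series s = eval_fps (1 - inverse exp_quotient) s / s"
      unfolding ray_series_def using radius s by (subst eval_fps_shift) auto
    also have "\<dots> = (1 - s / (exp s - 1)) / s"
      using s1 by (subst eval_fps_diff) (auto simp: G)
    also have "\<dots> = 1 / (1 - exp s) + 1 / s"
    proof -
      have "exp s \<noteq> 1" using s by simp
      then show ?thesis using s by (simp add: field_simps)
    qed
    finally show ?thesis .
  qed
  with R show ?thesis using that[of R] by (simp add: less_imp_le)
qed

section \<open>Lattice bases and normalized Lebesgue measures\<close>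

lemma span_pair: "x \<in> span {u, v :: real^'n} \<longleftrightarrow> (\<exists>a b. x = a *\<^sub>R u + b *\<^sub>R v)"
proof
  assume "x \<in> span {u, v}"
  then obtain a where "x - a *\<^sub>R u \<in> span {v}" by (auto simp: span_insert)
  then obtain b where "x - a *\<^sub>R u = b *\<^sub>R v" by (auto simp: span_singleton)
  hence "x = a *\<^sub>R u + b *\<^sub>R v" by (simp add: algebra_simps)
  thus "\<exists>a b. x = a *\<^sub>R u + b *\<^sub>R v" by blast
qed (auto intro!: span_add span_scale intro: span_base)

lemma independent_pair_coeffs:
  assumes "independent {u, v :: real^'n}" "u \<noteq> v" "a *\<^sub>R u + b *\<^sub>R v = a' *\<^sub>R u + b' *\<^sub>R v"
  shows "a = a'" "b = b'"
proof -
  let ?c = "\<lambda>w. if w = u then a - a' else b - b'"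
  have "(\<Sum>w\<in>{u, v}. ?c w *\<^sub>R w) = 0"
    using assms(2,3) by (simp add: algebra_simps)
  hence *: "?c w = 0" if "w \<in> {u, v}" for w
    using independentD[OF assms(1) finite.insertI[OF finite.insertI[OF finite.emptyI]] order.refl _ that, of ?c] by blast
  show "a = a'" "b = b'" using *[of u] *[of v] assms(2) by (auto split: if_splits)
qed

lemma lattice_basis_single:
  "lattice_basis {u} \<Lambda> \<longleftrightarrow> u \<noteq> 0 \<and> \<Lambda> = range (\<lambda>i :: int. of_int i *\<^sub>R (u :: real^'n))"
proof -
  have "(\<exists>c :: real^'n \<Rightarrow> int. x = of_int (c u) *\<^sub>R u) \<longleftrightarrow> (\<exists>i :: int. x = of_int i *\<^sub>R u)" for x
  proof
    assume "\<exists>i :: int. x = of_int i *\<^sub>R u"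
    then obtain i :: int where "x = of_int i *\<^sub>R u" by blast
    then show "\<exists>c :: real^'n \<Rightarrow> int. x = of_int (c u) *\<^sub>R u" by (intro exI[of _ "\<lambda>_. i"]) simp
  qed blast
  thus ?thesis unfolding lattice_basis_def by (auto simp: image_def)
qed

lemma lattice_basis_pair:
  assumes "u \<noteq> v"
  shows "lattice_basis {u, v} \<Lambda> \<longleftrightarrow>
    independent {u, v} \<and> \<Lambda> = {of_int i *\<^sub>R u + of_int j *\<^sub>R (v :: real^'n) | i j :: int. True}"
proof -
  have "(\<exists>c :: real^'n \<Rightarrow> int. x = of_int (c u) *\<^sub>R u + of_int (c v) *\<^sub>R v) \<longleftrightarrow>
     (\<exists>i j :: int. x = of_int i *\<^sub>R u + of_int j *\<^sub>R v)" for x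
  proof
    assume "\<exists>i j :: int. x = of_int i *\<^sub>R u + of_int j *\<^sub>R v"
    then obtain i j :: int where "x = of_int i *\<^sub>R u + of_int j *\<^sub>R v" by blast
    then show "\<exists>c :: real^'n \<Rightarrow> int. x = of_int (c u) *\<^sub>R u + of_int (c v) *\<^sub>R v"
      using assms by (intro exI[of _ "\<lambda>w. if w = u then i else j"]) auto
  qed blast
  thus ?thesis unfolding lattice_basis_def using assms by auto
qed

lemma lattice_basis_subset: "lattice_basis B \<Lambda> \<Longrightarrow> B \<subseteq> \<Lambda>"
proof
  fix b assume *: "lattice_basis B \<Lambda>" "b \<in> B"
  have "finite B" using * independent_imp_finite by (auto simp: lattice_basis_def)
  hence "(\<Sum>w\<in>B. of_int (if w = b then 1 else 0) *\<^sub>R w) = b"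
    using *(2) by (subst sum.remove[of _ b]) (auto intro!: sum.neutral)
  hence "\<exists>c :: real^'a \<Rightarrow> int. b = (\<Sum>w\<in>B. of_int (c w) *\<^sub>R w)"
    by (intro exI[of _ "\<lambda>w. if w = b then 1 else 0"]) simp
  thus "b \<in> \<Lambda>" using *(1) by (auto simp: lattice_basis_def)
qed

lemma lattice_basis_span: "lattice_basis B \<Lambda> \<Longrightarrow> span \<Lambda> = span B"
proof (rule span_eq[THEN iffD2], intro conjI)
  assume *: "lattice_basis B \<Lambda>"
  show "\<Lambda> \<subseteq> span B" using * by (auto simp: lattice_basis_def intro!: span_sum span_scale intro: span_base)
  show "B \<subseteq> span \<Lambda>" using lattice_basis_subset[OF *] span_superset by blast
qed

lemma lattice_basis_card:
  assumes "lattice_basis B \<Lambda>" "lattice_basis B' \<Lambda>"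
  shows "card B' = card B"
proof -
  have dim: "card A = dim (span \<Lambda>)" if "lattice_basis A \<Lambda>" for A
    using dim_eq_card_independent[of A] lattice_basis_span[OF that] dim_span[of A] that
    by (simp add: lattice_basis_def)
  show ?thesis using dim assms by simp
qed

lemma some_lattice_basis: "lattice_basis B \<Lambda> \<Longrightarrow> lattice_basis (SOME B. lattice_basis B \<Lambda>) \<Lambda>"
  by (rule someI)

text \<open>
  Two one-dimensional affine substitutions with Fubini's theorem between them, that is, a
  factorization of the matrix into shears and a scaling; for \<open>r = 0\<close> the matrix is already triangular.
\<close>
lemma nn_integral_linear_substitution:
  fixes G :: "real \<Rightarrow> real \<Rightarrow> ennreal"
  assumes G [measurable]: "(\<lambda>(x, y). G x y) \<in> borel_measurable (borel \<Otimes>\<^sub>M borel)"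
    and det: "p * s - q * r \<noteq> 0"
  shows "(\<integral>\<^sup>+x. \<integral>\<^sup>+y. G x y \<partial>lborel \<partial>lborel)
    = ennreal \<bar>p * s - q * r\<bar> * (\<integral>\<^sup>+x. \<integral>\<^sup>+y. G (p * x + r * y) (q * x + s * y) \<partial>lborel \<partial>lborel)"
proof -
  have [measurable]: "(\<lambda>w. G (f w) (g w)) \<in> borel_measurable M"
    if "f \<in> borel_measurable M" "g \<in> borel_measurable M" for f g and M :: "(real \<times> real) measure"
    using measurable_compose[OF measurable_Pair[OF that] G] by simp
  have [measurable]: "(\<lambda>w. G (f w) (g w)) \<in> borel_measurable M"
    if "f \<in> borel_measurable M" "g \<in> borel_measurable M" for f g and M :: "real measure"
    using measurable_compose[OF measurable_Pair[OF that] G] by simp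
  show ?thesis
  proof (cases "r = 0")
    case True
    hence ps: "p \<noteq> 0" "s \<noteq> 0" using det by auto
    have "(\<integral>\<^sup>+x. \<integral>\<^sup>+y. G x y \<partial>lborel \<partial>lborel) = \<bar>p\<bar> * (\<integral>\<^sup>+x. \<integral>\<^sup>+y. G (0 + p * x) y \<partial>lborel \<partial>lborel)"
      by (rule nn_integral_real_affine[OF _ ps(1)]) measurable
    also have "(\<integral>\<^sup>+x. \<integral>\<^sup>+y. G (0 + p * x) y \<partial>lborel \<partial>lborel)
        = (\<integral>\<^sup>+x. \<bar>s\<bar> * (\<integral>\<^sup>+y. G (p * x) (q * x + s * y) \<partial>lborel) \<partial>lborel)"
    proof (rule nn_integral_cong)
      show "(\<integral>\<^sup>+y. G (0 + p * x) y \<partial>lborel) = \<bar>s\<bar> * (\<integral>\<^sup>+y. G (p * x) (q * x + s * y) \<partial>lborel)" for x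
        unfolding add_0 by (rule nn_integral_real_affine[OF _ ps(2)]) measurable
    qed
    also have "\<dots> = \<bar>s\<bar> * (\<integral>\<^sup>+x. \<integral>\<^sup>+y. G (p * x) (q * x + s * y) \<partial>lborel \<partial>lborel)"
      by (rule nn_integral_cmult) measurable
    finally show ?thesis using True by (simp add: abs_mult ennreal_mult mult.assoc)
  next
    case False
    define c where "c = q - s * p / r"
    have rc: "r * c = q * r - p * s" using False by (simp add: c_def field_simps)
    hence c: "c \<noteq> 0" using det by auto
    have "(\<integral>\<^sup>+x. \<integral>\<^sup>+y. G x y \<partial>lborel \<partial>lborel) = (\<integral>\<^sup>+z. \<bar>c\<bar> * (\<integral>\<^sup>+x. G z ((s / r) * z + c * x) \<partial>lborel) \<partial>lborel)"
    proof (rule nn_integral_cong)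
      show "(\<integral>\<^sup>+y. G z y \<partial>lborel) = \<bar>c\<bar> * (\<integral>\<^sup>+x. G z ((s / r) * z + c * x) \<partial>lborel)" for z
        by (rule nn_integral_real_affine[OF _ c]) measurable
    qed
    also have "\<dots> = \<bar>c\<bar> * (\<integral>\<^sup>+z. \<integral>\<^sup>+x. G z ((s / r) * z + c * x) \<partial>lborel \<partial>lborel)"
      by (rule nn_integral_cmult) measurable
    also have "(\<integral>\<^sup>+z. \<integral>\<^sup>+x. G z ((s / r) * z + c * x) \<partial>lborel \<partial>lborel)
       = (\<integral>\<^sup>+x. \<integral>\<^sup>+z. G z ((s / r) * z + c * x) \<partial>lborel \<partial>lborel)"
      by (rule lborel_pair.Fubini') measurable
    also have "\<dots> = (\<integral>\<^sup>+x. \<bar>r\<bar> * (\<integral>\<^sup>+y. G (p * x + r * y) (q * x + s * y) \<partial>lborel) \<partial>lborel)"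
    proof (rule nn_integral_cong)
      fix x :: real
      \<comment> \<open>\<open>c\<close> was chosen so that substituting \<open>z = p x + r y\<close> makes the second argument \<open>q x + s y\<close>\<close>
      have "(\<integral>\<^sup>+z. G z ((s / r) * z + c * x) \<partial>lborel)
        = \<bar>r\<bar> * (\<integral>\<^sup>+y. G (p * x + r * y) ((s / r) * (p * x + r * y) + c * x) \<partial>lborel)"
        by (rule nn_integral_real_affine[OF _ False]) measurable
      also have "(\<lambda>y. (s / r) * (p * x + r * y) + c * x) = (\<lambda>y. q * x + s * y)"
        using False by (intro ext) (simp add: c_def field_simps)
      hence "(\<integral>\<^sup>+y. G (p * x + r * y) ((s / r) * (p * x + r * y) + c * x) \<partial>lborel)
        = (\<integral>\<^sup>+y. G (p * x + r * y) (q * x + s * y) \<partial>lborel)" by metis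
      finally show "(\<integral>\<^sup>+z. G z ((s / r) * z + c * x) \<partial>lborel)
        = \<bar>r\<bar> * (\<integral>\<^sup>+y. G (p * x + r * y) (q * x + s * y) \<partial>lborel)" .
    qed
    also have "\<dots> = \<bar>r\<bar> * (\<integral>\<^sup>+x. \<integral>\<^sup>+y. G (p * x + r * y) (q * x + s * y) \<partial>lborel \<partial>lborel)"
      by (rule nn_integral_cmult) measurable
    finally have "(\<integral>\<^sup>+x. \<integral>\<^sup>+y. G x y \<partial>lborel \<partial>lborel) =
      ennreal \<bar>c\<bar> * (ennreal \<bar>r\<bar> * (\<integral>\<^sup>+x. \<integral>\<^sup>+y. G (p * x + r * y) (q * x + s * y) \<partial>lborel \<partial>lborel))" .
    moreover have "ennreal \<bar>p * s - q * r\<bar> = ennreal \<bar>c\<bar> * ennreal \<bar>r\<bar>"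
      using rc by (simp add: abs_mult[symmetric] ennreal_mult[symmetric] mult.commute abs_minus_commute)
    ultimately show ?thesis by (simp add: mult.assoc)
  qed
qed

lemma nn_integral_lattice_sum_single:
  assumes [measurable]: "F \<in> borel_measurable borel"
  shows "(\<integral>\<^sup>+x. F x \<partial>distr (\<Pi>\<^sub>M b\<in>{u}. lborel) borel (\<lambda>c. \<Sum>b\<in>{u}. c b *\<^sub>R b))
    = (\<integral>\<^sup>+t. F (t *\<^sub>R (u :: real^'n)) \<partial>lborel)"
proof -
  interpret product_sigma_finite "\<lambda>_. lborel :: real measure" ..
  show ?thesis
    by (subst nn_integral_distr) (simp_all add: product_nn_integral_singleton[of "\<lambda>t. F (t *\<^sub>R u)"])
qed

lemma nn_integral_lattice_sum_pair:
  assumes [measurable]: "F \<in> borel_measurable borel" and "u \<noteq> v"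
  shows "(\<integral>\<^sup>+x. F x \<partial>distr (\<Pi>\<^sub>M b\<in>{u, v}. lborel) borel (\<lambda>c. \<Sum>b\<in>{u, v}. c b *\<^sub>R b))
    = (\<integral>\<^sup>+s. \<integral>\<^sup>+t. F (s *\<^sub>R u + t *\<^sub>R (v :: real^'n)) \<partial>lborel \<partial>lborel)"
proof -
  interpret product_sigma_finite "\<lambda>_. lborel :: real measure" ..
  have "(\<integral>\<^sup>+x. F x \<partial>distr (\<Pi>\<^sub>M b\<in>{u, v}. lborel) borel (\<lambda>c. \<Sum>b\<in>{u, v}. c b *\<^sub>R b))
    = (\<integral>\<^sup>+c. F (c u *\<^sub>R u + c v *\<^sub>R v) \<partial>(\<Pi>\<^sub>M b\<in>{v, u}. lborel))"
    using assms(2) by (subst nn_integral_distr) (simp_all add: insert_commute)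
  also have "\<dots> = (\<integral>\<^sup>+c. \<integral>\<^sup>+t. F (c u *\<^sub>R u + t *\<^sub>R v) \<partial>lborel \<partial>(\<Pi>\<^sub>M b\<in>{u}. lborel))"
    using assms(2) by (subst product_nn_integral_insert) simp_all
  also have "\<dots> = (\<integral>\<^sup>+s. \<integral>\<^sup>+t. F (s *\<^sub>R u + t *\<^sub>R v) \<partial>lborel \<partial>lborel)"
    by (rule product_nn_integral_singleton[of "\<lambda>s. \<integral>\<^sup>+t. F (s *\<^sub>R u + t *\<^sub>R v) \<partial>lborel"]) measurable
  finally show ?thesis .
qed

lemma nn_integral_lattice_measure_single:
  assumes [measurable]: "F \<in> borel_measurable borel" and L: "lattice_basis {u} \<Lambda>"
  shows "(\<integral>\<^sup>+x. F x \<partial>lattice_measure \<Lambda>) = (\<integral>\<^sup>+t. F (t *\<^sub>R u) \<partial>lborel)"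
proof -
  define B where "B = (SOME B. lattice_basis B \<Lambda>)"
  have B: "lattice_basis B \<Lambda>" unfolding B_def by (rule some_lattice_basis[OF L])
  obtain w where w: "B = {w}" using lattice_basis_card[OF L B] card_1_singletonE by auto
  have u: "u \<noteq> 0" "\<Lambda> = range (\<lambda>i :: int. of_int i *\<^sub>R u)" using L by (auto simp: lattice_basis_single)
  have w': "w \<noteq> 0" "\<Lambda> = range (\<lambda>i :: int. of_int i *\<^sub>R w)" using B w by (auto simp: lattice_basis_single)
  obtain i :: int where i: "w = of_int i *\<^sub>R u" using lattice_basis_subset[OF B] w u(2) by auto
  obtain j :: int where j: "u = of_int j *\<^sub>R w" using lattice_basis_subset[OF L] w'(2) by auto
  have "of_int (j * i) *\<^sub>R u = of_int j *\<^sub>R (of_int i *\<^sub>R u)" by simp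
  also have "\<dots> = 1 *\<^sub>R u" using i j by simp
  finally have "of_int (j * i) *\<^sub>R u = 1 *\<^sub>R u" .
  hence "of_int (j * i) = (1 :: real)" using u(1) by (metis scaleR_cancel_right)
  hence "j * i = 1" by linarith
  hence "\<bar>i\<bar> = 1" by (metis abs_1 abs_mult abs_zmult_eq_1 mult.commute)
  hence i1: "\<bar>real_of_int i\<bar> = 1" "real_of_int i \<noteq> 0" by auto
  have "(\<integral>\<^sup>+x. F x \<partial>lattice_measure \<Lambda>) = (\<integral>\<^sup>+t. F (t *\<^sub>R w) \<partial>lborel)"
    using nn_integral_lattice_sum_single[of F w] unfolding lattice_measure_def Let_def B_def[symmetric] w by simp
  also have "\<dots> = (\<integral>\<^sup>+t. F ((0 + of_int i * t) *\<^sub>R u) \<partial>lborel)" by (simp add: i mult.commute)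
  also have "\<dots> = (\<integral>\<^sup>+t. F (t *\<^sub>R u) \<partial>lborel)"
    by (subst (2) nn_integral_real_affine[OF _ i1(2), of _ 0]) (simp_all add: i1(1))
  finally show ?thesis .
qed

text \<open>
  The measure is defined by an unspecified lattice basis. The two transition matrices between it and
  the given basis are integral and inverse to each other, so their determinants are 1 or -1 and the
  substitution costs no factor.
\<close>
lemma nn_integral_lattice_measure_pair:
  assumes F [measurable]: "F \<in> borel_measurable borel" and L: "lattice_basis {u, v} \<Lambda>" and uv: "u \<noteq> v"
  shows "(\<integral>\<^sup>+x. F x \<partial>lattice_measure \<Lambda>) = (\<integral>\<^sup>+s. \<integral>\<^sup>+t. F (s *\<^sub>R u + t *\<^sub>R v) \<partial>lborel \<partial>lborel)"
proof -
  define B where "B = (SOME B. lattice_basis B \<Lambda>)"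
  have B: "lattice_basis B \<Lambda>" unfolding B_def by (rule some_lattice_basis[OF L])
  have "card B = 2" using lattice_basis_card[OF L B] uv by simp
  then obtain u' v' where B': "B = {u', v'}" and uv': "u' \<noteq> v'" by (auto simp: card_2_iff)
  have 1: "independent {u, v}" "\<Lambda> = {of_int i *\<^sub>R u + of_int j *\<^sub>R v | i j :: int. True}"
    using L by (auto simp: lattice_basis_pair[OF uv])
  have 2: "\<Lambda> = {of_int i *\<^sub>R u' + of_int j *\<^sub>R v' | i j :: int. True}"
    using B unfolding B' by (auto simp: lattice_basis_pair[OF uv'])
  have "u' \<in> \<Lambda>" "v' \<in> \<Lambda>" using lattice_basis_subset[OF B] B' by auto
  then obtain p q r s :: int where pq: "u' = of_int p *\<^sub>R u + of_int q *\<^sub>R v"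
    and rs: "v' = of_int r *\<^sub>R u + of_int s *\<^sub>R v" unfolding 1 by blast
  have "u \<in> \<Lambda>" "v \<in> \<Lambda>" using lattice_basis_subset[OF L] by auto
  then obtain a b c d :: int where ab: "u = of_int a *\<^sub>R u' + of_int b *\<^sub>R v'"
    and cd: "v = of_int c *\<^sub>R u' + of_int d *\<^sub>R v'" unfolding 2 by blast
  have "of_int (a * p + b * r) *\<^sub>R u + of_int (a * q + b * s) *\<^sub>R v = 1 *\<^sub>R u + 0 *\<^sub>R v"
    using ab unfolding pq rs by (simp add: algebra_simps)
  from independent_pair_coeffs[OF 1(1) uv this]
  have e1: "a * p + b * r = 1" "a * q + b * s = 0" by (metis of_int_eq_1_iff, metis of_int_eq_0_iff)
  have "of_int (c * p + d * r) *\<^sub>R u + of_int (c * q + d * s) *\<^sub>R v = 0 *\<^sub>R u + 1 *\<^sub>R v"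
    using cd unfolding pq rs by (simp add: algebra_simps)
  from independent_pair_coeffs[OF 1(1) uv this]
  have e2: "c * p + d * r = 0" "c * q + d * s = 1" by (metis of_int_eq_0_iff, metis of_int_eq_1_iff)
  \<comment> \<open>the product of the two transition matrices is the identity, so their determinants multiply to 1\<close>
  have "(a * d - b * c) * (p * s - q * r) = (a * p + b * r) * (c * q + d * s) - (a * q + b * s) * (c * p + d * r)"
    by (simp add: algebra_simps)
  also have "\<dots> = 1" using e1 e2 by simp
  finally have "\<bar>p * s - q * r\<bar> = 1" by (metis abs_1 abs_mult abs_zmult_eq_1 mult.commute)
  hence "\<bar>real_of_int (p * s - q * r)\<bar> = 1" by linarith
  hence det: "\<bar>real_of_int p * of_int s - of_int q * of_int r\<bar> = 1" by simp
  have "(\<integral>\<^sup>+x. F x \<partial>lattice_measure \<Lambda>) = (\<integral>\<^sup>+s. \<integral>\<^sup>+t. F (s *\<^sub>R u' + t *\<^sub>R v') \<partial>lborel \<partial>lborel)"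
    using nn_integral_lattice_sum_pair[of F u' v'] uv' unfolding lattice_measure_def Let_def B_def[symmetric] B' by simp
  also have "\<dots> = (\<integral>\<^sup>+x. \<integral>\<^sup>+y. F ((p * x + r * y) *\<^sub>R u + (q * x + s * y) *\<^sub>R v) \<partial>lborel \<partial>lborel)"
    by (simp add: pq rs algebra_simps)
  also have "\<dots> = (\<integral>\<^sup>+s. \<integral>\<^sup>+t. F (s *\<^sub>R u + t *\<^sub>R v) \<partial>lborel \<partial>lborel)"
    by (subst (2) nn_integral_linear_substitution[of _ "of_int p" "of_int s" "of_int q" "of_int r"])
       (use det in auto)
  finally show ?thesis .
qed

lemma nn_integral_exp_ray:
  assumes "x < 0"
  shows "(\<integral>\<^sup>+t. indicator {0..} t * ennreal (exp (t * x)) \<partial>lborel) = ennreal (- 1 / x)"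
proof -
  have "(\<integral>\<^sup>+t. ennreal (exp (t * x)) * indicator {0..} t \<partial>lborel) = ennreal (0 - exp (0 * x) / x)"
  proof (rule nn_integral_FTC_atLeast)
    show "((\<lambda>t. exp (t * x) / x) has_real_derivative exp (t * x)) (at t)" for t
      using assms by (auto intro!: derivative_eq_intros)
    have "LIM t at_top. t * x :> at_bot"
      using filterlim_tendsto_neg_mult_at_bot[OF tendsto_const assms filterlim_ident] by (simp add: mult.commute)
    hence "((\<lambda>t. exp (t * x)) \<longlongrightarrow> 0) at_top"
      by (rule filterlim_compose[OF exp_at_bot])
    thus "((\<lambda>t. exp (t * x) / x) \<longlongrightarrow> 0) at_top" using tendsto_divide_zero by blast
  qed auto
  thus ?thesis by (simp add: mult.commute)
qed

lemma nn_integral_exp_quadrant: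
  assumes "x < 0" "y < 0"
  shows "(\<integral>\<^sup>+s. \<integral>\<^sup>+t. indicator {0..} s * indicator {0..} t * ennreal (exp (s * x + t * y)) \<partial>lborel \<partial>lborel) = ennreal (1 / (x * y))"
proof -
  have "(\<integral>\<^sup>+s. \<integral>\<^sup>+t. indicator {0..} s * indicator {0..} t * ennreal (exp (s * x + t * y)) \<partial>lborel \<partial>lborel)
    = (\<integral>\<^sup>+s. (indicator {0..} s * ennreal (exp (s * x))) * (\<integral>\<^sup>+t. indicator {0..} t * ennreal (exp (t * y)) \<partial>lborel) \<partial>lborel)"
    by (intro nn_integral_cong, subst nn_integral_cmult[symmetric]) (auto simp: exp_add ennreal_mult mult_ac)
  also have "\<dots> = ennreal (- 1 / x) * ennreal (- 1 / y)"
    unfolding nn_integral_exp_ray[OF assms(2)] 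
    by (subst nn_integral_multc) (simp_all add: nn_integral_exp_ray[OF assms(1)])
  also have "\<dots> = ennreal (1 / (x * y))"
    using assms by (subst ennreal_mult[symmetric]) (auto simp: divide_nonneg_neg)
  finally show ?thesis .
qed

section \<open>Faces of cones of dimension at most two\<close>

lemma convex_cone_hull_singleton: "convex_cone hull {u} = {t *\<^sub>R u | t. 0 \<le> t}"
proof (rule hull_unique)
  show "{u} \<subseteq> {t *\<^sub>R u | t. 0 \<le> t}" by (auto intro!: exI[of _ 1])
  show "convex_cone {t *\<^sub>R u | t. 0 \<le> t}"
    unfolding convex_cone_iff
  proof (intro conjI ballI allI impI)
    show "0 \<in> {t *\<^sub>R u | t. 0 \<le> t}" by (auto intro!: exI[of _ 0])
  next
    fix x y assume "x \<in> {t *\<^sub>R u | t. 0 \<le> t}" "y \<in> {t *\<^sub>R u | t. 0 \<le> t}"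
    then obtain s t where "x = s *\<^sub>R u" "y = t *\<^sub>R u" "0 \<le> s" "0 \<le> t" by auto
    thus "x + y \<in> {t *\<^sub>R u | t. 0 \<le> t}" by (auto intro!: exI[of _ "s + t"] simp: scaleR_add_left)
  next
    fix x c assume "x \<in> {t *\<^sub>R u | t. 0 \<le> t}" "(0::real) \<le> c"
    then obtain s where "x = s *\<^sub>R u" "0 \<le> s" by auto
    thus "c *\<^sub>R x \<in> {t *\<^sub>R u | t. 0 \<le> t}" using \<open>0 \<le> c\<close> by (auto intro!: exI[of _ "c * s"])
  qed
  fix T assume T: "{u} \<subseteq> T" "convex_cone T"
  show "{t *\<^sub>R u | t. 0 \<le> t} \<subseteq> T" using T by (auto simp: convex_cone_iff)
qed

lemma convex_cone_hull_pair: "convex_cone hull {u, v} = {s *\<^sub>R u + t *\<^sub>R v | s t. 0 \<le> s \<and> 0 \<le> t}"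
proof -
  have "convex_cone hull ({u} \<union> {v}) = (\<Union>x\<in>convex_cone hull {u}. \<Union>y\<in>convex_cone hull {v}. {x + y})"
    by (rule convex_cone_hull_Un)
  also have "{u} \<union> {v} = {u, v}" by auto
  finally show ?thesis unfolding convex_cone_hull_singleton by auto
qed

lemma span_convex_cone_hull: "span (convex_cone hull S) = span (S :: (real^'n) set)"
proof (rule span_eq[THEN iffD2], intro conjI)
  have "convex_cone (span S)" by (simp add: convex_cone_iff span_zero span_add span_scale)
  thus "convex_cone hull S \<subseteq> span S" by (intro hull_minimal span_superset)
  show "S \<subseteq> span (convex_cone hull S)" by (meson hull_subset order_trans span_superset)
qed

text \<open>
  A positive multiple of a point of a face lies on a segment inside the cone that has the point in its
  interior; the segment ends at \<open>2x\<close> for a factor below 1 and at 0 for a factor above 1.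
\<close>
lemma face_of_cone_scale:
  assumes F: "F face_of C" and C: "convex_cone C" and x: "x \<in> F" and c: "0 \<le> c"
  shows "c *\<^sub>R x \<in> F"
proof (cases "x = 0 \<or> c = 1")
  case False
  have xC: "x \<in> C" using F x by (auto simp: face_of_def)
  have mem: "d *\<^sub>R x \<in> C" if "0 \<le> d" for d using C xC that by (simp add: convex_cone_iff)
  show ?thesis
  proof (cases "c < 1")
    case True
    define t where "t = (1 - c) / (2 - c)"
    have "t * (2 - c) = 1 - c" using True by (simp add: t_def)
    hence "(1 - t) * c + t * 2 = 1" by (simp add: algebra_simps)
    moreover have "0 < t" "t < 1" using True c by (auto simp: t_def field_simps)
    ultimately have t: "0 < t" "t < 1" "(1 - t) * c + t * 2 = 1" by auto
    have "(1 - t) *\<^sub>R (c *\<^sub>R x) + t *\<^sub>R (2 *\<^sub>R x) = ((1 - t) * c + t * 2) *\<^sub>R x"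
      by (simp add: scaleR_add_left)
    hence "x = (1 - t) *\<^sub>R (c *\<^sub>R x) + t *\<^sub>R (2 *\<^sub>R x)" using t(3) by simp
    moreover have "c *\<^sub>R x \<noteq> 2 *\<^sub>R x" using False True by auto
    ultimately have "x \<in> open_segment (c *\<^sub>R x) (2 *\<^sub>R x)" using t in_segment by blast
    from face_ofD[OF F this mem mem x] show ?thesis using c by simp
  next
    case *: False
    hence c1: "c > 1" using False by auto
    have "x = (1 - 1 / c) *\<^sub>R 0 + (1 / c) *\<^sub>R (c *\<^sub>R x)" using c1 by simp
    moreover have "0 \<noteq> c *\<^sub>R x" using False c1 by auto
    moreover have "0 < 1 / c" "1 / c < 1" using c1 by auto
    ultimately have "x \<in> open_segment 0 (c *\<^sub>R x)" using in_segment(2) by blast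
    from face_ofD[OF F this _ mem x] mem[of 0] show ?thesis using c by simp
  qed
qed (use x in auto)

text \<open>
  \<open>y + z\<close> is the midpoint of \<open>2y\<close> and \<open>2z\<close>.
\<close>
lemma face_of_cone_summand:
  assumes F: "F face_of C" and C: "convex_cone C" and yz: "y \<in> C" "z \<in> C" "y + z \<in> F"
  shows "y \<in> F"
proof (cases "y = z")
  case True
  then show ?thesis using face_of_cone_scale[OF F C yz(3), of "1/2"] by (simp add: scaleR_2[symmetric])
next
  case False
  have "2 *\<^sub>R y \<in> C" "2 *\<^sub>R z \<in> C" using C yz by (auto simp: convex_cone_iff)
  moreover have "y + z \<in> open_segment (2 *\<^sub>R y) (2 *\<^sub>R z)"
    using False unfolding in_segment by (auto intro!: exI[of _ "1/2"])
  ultimately have "2 *\<^sub>R y \<in> F" using face_ofD[OF F _ _ _ yz(3)] by blast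
  then show ?thesis using face_of_cone_scale[OF F C, of "2 *\<^sub>R y" "1/2"] by simp
qed

lemma face_of_convex_cone:
  assumes F: "F face_of C" and C: "convex_cone C" and "F \<noteq> {}"
  shows "convex_cone F"
proof -
  have *: "c *\<^sub>R x \<in> F" if "x \<in> F" "0 \<le> c" for x c using face_of_cone_scale[OF F C] that by blast
  have "conic F" using * by (auto simp: conic_def)
  then show ?thesis using assms face_of_imp_convex by (auto simp: convex_cone_def)
qed

lemma cone_faces_zero: "cone_faces {0} = {{0 :: real^'n}}"
  by (auto simp: cone_faces_def face_of_def)

lemma cone_faces_ray:
  assumes u: "u \<noteq> (0 :: real^'n)"
  shows "cone_faces (convex_cone hull {u}) = {{0}, convex_cone hull {u}}"
proof (intro equalityI subsetI)
  fix F assume "F \<in> cone_faces (convex_cone hull {u})"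
  hence F: "F face_of (convex_cone hull {u})" "F \<noteq> {}" by (auto simp: cone_faces_def)
  have cF: "convex_cone F" by (rule face_of_convex_cone[OF F(1) convex_cone_convex_cone_hull F(2)])
  have sub: "F \<subseteq> convex_cone hull {u}" using F(1) by (simp add: face_of_def)
  show "F \<in> {{0}, convex_cone hull {u}}"
  proof (cases "F \<subseteq> {0}")
    case False
    then obtain t where t: "t *\<^sub>R u \<in> F" "t > 0" using sub unfolding convex_cone_hull_singleton by force
    hence "(1 / t) *\<^sub>R (t *\<^sub>R u) \<in> F" using cF unfolding convex_cone_iff by (metis divide_nonneg_pos zero_le_one)
    hence "u \<in> F" using t by simp
    hence "convex_cone hull {u} \<subseteq> F" using cF by (simp add: hull_minimal)
    thus ?thesis using sub by blast
  qed (use cF in \<open>auto simp: convex_cone_iff\<close>)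
next
  fix F assume *: "F \<in> {{0}, convex_cone hull {u}}"
  have "(convex_cone hull {u} \<inter> {x. u \<bullet> x = 0}) face_of (convex_cone hull {u})"
    by (rule face_of_Int_supporting_hyperplane_ge[OF convex_convex_cone_hull])
       (auto simp: convex_cone_hull_singleton)
  also have "convex_cone hull {u} \<inter> {x. u \<bullet> x = 0} = {0}"
    using u by (auto simp: convex_cone_hull_singleton)
  finally show "F \<in> cone_faces (convex_cone hull {u})" using *
    by (auto simp: cone_faces_def face_of_refl convex_convex_cone_hull convex_cone_hull_nonempty)
qed

text \<open>
  The component of \<open>v\<close> orthogonal to \<open>u\<close> (vector rejection).
\<close>
definition rejection :: "real^'n \<Rightarrow> real^'n \<Rightarrow> real^'n" where
  "rejection u v = v - (u \<bullet> v / (u \<bullet> u)) *\<^sub>R u"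

lemma rejection_orthogonal: "u \<bullet> rejection u v = 0" "rejection u v \<bullet> u = 0"
  by (auto simp: rejection_def inner_diff_right inner_diff_left inner_commute)

lemma independent_pair_nonzero:
  assumes "independent {u, v :: real^'n}"
  shows "u \<noteq> 0" "v \<noteq> 0"
  using assms dependent_zero by blast+

lemma rejection_nonzero:
  assumes "independent {u, v :: real^'n}" "u \<noteq> v"
  shows "rejection u v \<noteq> 0"
proof
  assume "rejection u v = 0"
  hence "(- (u \<bullet> v / (u \<bullet> u))) *\<^sub>R u + 1 *\<^sub>R v = 0 *\<^sub>R u + 0 *\<^sub>R v" by (simp add: rejection_def)
  from independent_pair_coeffs(2)[OF assms this] show False by simp
qed

lemma rejection_inner: "rejection u v \<bullet> v = rejection u v \<bullet> rejection u v"
proof -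
  have "v = rejection u v + (u \<bullet> v / (u \<bullet> u)) *\<^sub>R u" by (simp add: rejection_def)
  hence "rejection u v \<bullet> v = rejection u v \<bullet> (rejection u v + (u \<bullet> v / (u \<bullet> u)) *\<^sub>R u)" by simp
  also have "\<dots> = rejection u v \<bullet> rejection u v" by (simp add: inner_add_right rejection_orthogonal)
  finally show ?thesis .
qed

lemma rejection_inner_pos: 
  assumes "independent {u, v :: real^'n}" "u \<noteq> v"
  shows "rejection u v \<bullet> v > 0"
  using rejection_nonzero[OF assms] by (simp add: rejection_inner)

text \<open>
  The component of \<open>v\<close> orthogonal to \<open>u\<close> vanishes on \<open>u\<close> and is positive on \<open>v\<close>, so it exposes the ray
  of \<open>u\<close>.
\<close>
lemma ray_face_of_cone:
  assumes "independent {u, v :: real^'n}" "u \<noteq> v"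
  shows "(convex_cone hull {u}) face_of (convex_cone hull {u, v})"
proof -
  let ?w = "rejection u v"
  have "(convex_cone hull {u, v} \<inter> {x. ?w \<bullet> x = 0}) face_of (convex_cone hull {u, v})"
    using rejection_inner_pos[OF assms]
    by (intro face_of_Int_supporting_hyperplane_ge[OF convex_convex_cone_hull])
       (auto simp: convex_cone_hull_pair inner_add_right rejection_orthogonal)
  also have "convex_cone hull {u, v} \<inter> {x. ?w \<bullet> x = 0} = convex_cone hull {u}"
    using rejection_inner_pos[OF assms]
    by (force simp: convex_cone_hull_pair convex_cone_hull_singleton inner_add_right rejection_orthogonal)
  finally show ?thesis .
qed

lemma rays_distinct:
  assumes "independent {u, v :: real^'n}" "u \<noteq> v"
  shows "convex_cone hull {u} \<noteq> {0}" "v \<notin> convex_cone hull {u}"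
    "convex_cone hull {u} \<noteq> convex_cone hull {v}" "convex_cone hull {u} \<noteq> convex_cone hull {u, v}"
    "convex_cone hull {u, v} \<noteq> {0}"
proof -
  have u: "u \<in> convex_cone hull {u}" "v \<in> convex_cone hull {v}" "v \<in> convex_cone hull {u, v}"
    by (auto intro!: hull_inc)
  show "convex_cone hull {u} \<noteq> {0}" "convex_cone hull {u, v} \<noteq> {0}"
    using u independent_pair_nonzero[OF assms(1)] by auto
  show v: "v \<notin> convex_cone hull {u}"
  proof
    assume "v \<in> convex_cone hull {u}"
    then obtain t where "0 *\<^sub>R u + 1 *\<^sub>R v = t *\<^sub>R u + 0 *\<^sub>R v" by (auto simp: convex_cone_hull_singleton)
    from independent_pair_coeffs(2)[OF assms this] show False by simp
  qed
  show "convex_cone hull {u} \<noteq> convex_cone hull {v}" "convex_cone hull {u} \<noteq> convex_cone hull {u, v}"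
    using u v by auto
qed

text \<open>
  A face is a convex cone, and by \<open>face_of_cone_summand\<close> it contains every generator that occurs with
  positive coefficient in one of its points; hence it is determined by which of \<open>u\<close>, \<open>v\<close> it contains.
\<close>
lemma cone_faces_pair:
  assumes uv: "independent {u, v :: real^'n}" "u \<noteq> v"
  shows "cone_faces (convex_cone hull {u, v}) =
    {{0}, convex_cone hull {u}, convex_cone hull {v}, convex_cone hull {u, v}}"
proof (intro equalityI subsetI)
  fix F assume "F \<in> cone_faces (convex_cone hull {u, v})"
  hence F: "F face_of (convex_cone hull {u, v})" "F \<noteq> {}" by (auto simp: cone_faces_def)
  have cF: "convex_cone F" by (rule face_of_convex_cone[OF F(1) convex_cone_convex_cone_hull F(2)])
  have sub: "F \<subseteq> convex_cone hull {u, v}" using F(1) by (simp add: face_of_def)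
  have mem: "s *\<^sub>R u \<in> convex_cone hull {u, v}" "s *\<^sub>R v \<in> convex_cone hull {u, v}" if "0 \<le> s" for s
    using that by (auto intro!: convex_cone_hull_mul intro: hull_inc)
  have scale: "x \<in> F" if "t *\<^sub>R x \<in> F" "t > 0" for t x
  proof -
    have "(1 / t) *\<^sub>R (t *\<^sub>R x) \<in> F" using cF that unfolding convex_cone_iff by (metis divide_nonneg_pos zero_le_one)
    thus ?thesis using that(2) by simp
  qed
  have *: "(s = 0 \<or> u \<in> F) \<and> (t = 0 \<or> v \<in> F)" if st: "s *\<^sub>R u + t *\<^sub>R v \<in> F" "0 \<le> s" "0 \<le> t" for s t
  proof -
    have "s *\<^sub>R u \<in> F" "t *\<^sub>R v \<in> F"
      using face_of_cone_summand[OF F(1) convex_cone_convex_cone_hull, of "s *\<^sub>R u" "t *\<^sub>R v"]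
        face_of_cone_summand[OF F(1) convex_cone_convex_cone_hull, of "t *\<^sub>R v" "s *\<^sub>R u"] st mem
      by (auto simp: add.commute)
    thus ?thesis using scale[of s u] scale[of t v] st by fastforce
  qed
  have hull: "convex_cone hull S \<subseteq> F" if "S \<subseteq> F" for S using cF that by (simp add: hull_minimal)
  have "0 \<in> F" using cF by (simp add: convex_cone_iff)
  consider "u \<in> F" "v \<in> F" | "u \<in> F" "v \<notin> F" | "u \<notin> F" "v \<in> F" | "u \<notin> F" "v \<notin> F" by blast
  thus "F \<in> {{0}, convex_cone hull {u}, convex_cone hull {v}, convex_cone hull {u, v}}"
  proof cases
    case 1
    then show ?thesis using hull[of "{u, v}"] sub by auto
  next
    case 2
    have "F \<subseteq> convex_cone hull {u}"
    proof
      fix x assume x: "x \<in> F"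
      then obtain s t where "x = s *\<^sub>R u + t *\<^sub>R v" "0 \<le> s" "0 \<le> t" using sub by (auto simp: convex_cone_hull_pair)
      thus "x \<in> convex_cone hull {u}" using *[of s t] x 2 by (auto simp: convex_cone_hull_singleton)
    qed
    then show ?thesis using hull[of "{u}"] 2 by auto
  next
    case 3
    have "F \<subseteq> convex_cone hull {v}"
    proof
      fix x assume x: "x \<in> F"
      then obtain s t where "x = s *\<^sub>R u + t *\<^sub>R v" "0 \<le> s" "0 \<le> t" using sub by (auto simp: convex_cone_hull_pair)
      thus "x \<in> convex_cone hull {v}" using *[of s t] x 3 by (auto simp: convex_cone_hull_singleton)
    qed
    then show ?thesis using hull[of "{v}"] 3 by auto
  next
    case 4
    have "F \<subseteq> {0}"
    proof
      fix x assume x: "x \<in> F"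
      then obtain s t where "x = s *\<^sub>R u + t *\<^sub>R v" "0 \<le> s" "0 \<le> t" using sub by (auto simp: convex_cone_hull_pair)
      thus "x \<in> {0}" using *[of s t] x 4 by auto
    qed
    then show ?thesis using \<open>0 \<in> F\<close> by auto
  qed
next
  fix F assume *: "F \<in> {{0}, convex_cone hull {u}, convex_cone hull {v}, convex_cone hull {u, v}}"
  have "(convex_cone hull {u}) face_of (convex_cone hull {u, v})" by (rule ray_face_of_cone[OF uv])
  moreover have "(convex_cone hull {v}) face_of (convex_cone hull {u, v})"
    using ray_face_of_cone[of v u] uv by (simp add: insert_commute)
  moreover have "{0} face_of (convex_cone hull {u})"
    using cone_faces_ray[OF independent_pair_nonzero(1)[OF uv(1)]] by (auto simp: cone_faces_def)
  ultimately show "F \<in> cone_faces (convex_cone hull {u, v})" using *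
    by (auto simp: cone_faces_def face_of_refl convex_convex_cone_hull convex_cone_hull_nonempty intro: face_of_trans)
qed

lemma zero_face_of_cone: 
  assumes uv: "independent {u, v :: real^'n}" "u \<noteq> v"
  shows "{0} face_of (convex_cone hull {u, v})"
  using cone_faces_pair[OF assms] by (auto simp: cone_faces_def)

section \<open>Orthogonal projections\<close>

lemma orth_proj_eqI:
  assumes "subspace W" "y \<in> W" "x - y \<in> W\<^sup>\<bottom>"
  shows "orth_proj W x = y"
  unfolding orth_proj_def
proof (rule the_equality)
  fix z assume z: "z \<in> W \<and> x - z \<in> W\<^sup>\<bottom>"
  have "z - y \<in> W" using z assms by (simp add: subspace_diff)
  moreover have "(x - y) - (x - z) \<in> W\<^sup>\<bottom>" using z assms subspace_diff[OF subspace_orthogonal_comp] by blast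
  ultimately have "(z - y) \<bullet> (z - y) = 0" by (auto simp: orthogonal_comp_def orthogonal_def)
  thus "z = y" by simp
qed (use assms in simp)

lemma orth_proj_id: "subspace W \<Longrightarrow> x \<in> W \<Longrightarrow> orth_proj W x = x"
  by (rule orth_proj_eqI) (auto simp: orthogonal_comp_def orthogonal_def)

lemma orth_proj_zero_space: "orth_proj {0} x = 0"
  by (rule orth_proj_eqI) (auto simp: orthogonal_comp_def orthogonal_def)

lemma Int_orthogonal_comp_self: "subspace L \<Longrightarrow> L \<inter> L\<^sup>\<bottom> = {0 :: real^'n}"
  by (auto simp: orthogonal_comp_def orthogonal_def subspace_0)

lemma mem_orthogonal_comp_span: "x \<in> (span {u})\<^sup>\<bottom> \<longleftrightarrow> u \<bullet> x = 0"
  by (auto simp: orthogonal_comp_def orthogonal_def span_singleton)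

lemma orth_proj_line: "w \<noteq> 0 \<Longrightarrow> orth_proj (span {w}) x = (x \<bullet> w / (w \<bullet> w)) *\<^sub>R w"
  by (rule orth_proj_eqI) (auto simp: mem_orthogonal_comp_span inner_diff_right inner_commute intro: span_scale span_base)

lemma plane_orthogonal_line:
  assumes "u \<noteq> (0 :: real^'n)" "c \<noteq> 0"
  shows "span {u, v} \<inter> (span {u})\<^sup>\<bottom> = span {c *\<^sub>R rejection u v}"
proof (intro equalityI subsetI)
  fix x assume x: "x \<in> span {u, v} \<inter> (span {u})\<^sup>\<bottom>"
  then obtain a b where ab: "x = a *\<^sub>R u + b *\<^sub>R v" by (auto simp: span_pair)
  have "x = (a + b * (u \<bullet> v / (u \<bullet> u))) *\<^sub>R u + b *\<^sub>R rejection u v"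
    by (simp add: ab rejection_def algebra_simps)
  moreover from this have "u \<bullet> x = (a + b * (u \<bullet> v / (u \<bullet> u))) * (u \<bullet> u)"
    by (simp add: inner_add_right rejection_orthogonal)
  hence "a + b * (u \<bullet> v / (u \<bullet> u)) = 0" using x assms by (auto simp: mem_orthogonal_comp_span)
  ultimately have "x = (b / c) *\<^sub>R (c *\<^sub>R rejection u v)" using assms by simp
  thus "x \<in> span {c *\<^sub>R rejection u v}" unfolding span_singleton by (rule range_eqI)
next
  fix x assume "x \<in> span {c *\<^sub>R rejection u v}"
  then obtain t where t: "x = t *\<^sub>R (c *\<^sub>R rejection u v)" by (auto simp: span_singleton)
  have "rejection u v \<in> span {u, v}" unfolding rejection_def by (intro span_diff span_scale) (auto intro: span_base)
  hence "x \<in> span {u, v}" unfolding t by (intro span_scale)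
  moreover have "x \<in> (span {u})\<^sup>\<bottom>" by (simp add: mem_orthogonal_comp_span t rejection_orthogonal)
  ultimately show "x \<in> span {u, v} \<inter> (span {u})\<^sup>\<bottom>" by simp
qed

lemma orth_proj_plane_line:
  assumes "u \<noteq> (0 :: real^'n)" "c \<noteq> 0"
  shows "orth_proj (span {c *\<^sub>R rejection u v}) (a *\<^sub>R u + b *\<^sub>R v) = (b / c) *\<^sub>R (c *\<^sub>R rejection u v)"
proof (rule orth_proj_eqI)
  have "a *\<^sub>R u + b *\<^sub>R v - (b / c) *\<^sub>R (c *\<^sub>R rejection u v) = (a + b * (u \<bullet> v / (u \<bullet> u))) *\<^sub>R u"
    using assms by (simp add: rejection_def algebra_simps)
  thus "a *\<^sub>R u + b *\<^sub>R v - (b / c) *\<^sub>R (c *\<^sub>R rejection u v) \<in> (span {c *\<^sub>R rejection u v})\<^sup>\<bottom>"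
    by (simp add: mem_orthogonal_comp_span rejection_orthogonal)
qed (use assms in \<open>auto intro: span_base span_scale simp del: scaleR_scaleR\<close>)

section \<open>Lattices on a line and in a plane\<close>

definition cyclic_lattice :: "real^'n \<Rightarrow> (real^'n) set" where
  "cyclic_lattice w = range (\<lambda>i :: int. of_int i *\<^sub>R w)"

text \<open>
  The lattices in a plane needed here: \<open>u\<close> and \<open>v\<close> are primitive and \<open>(1/k)(u + v)\<close> generates the
  quotient by \<open>\<int> u + \<int> v\<close>, which is cyclic of order \<open>k\<close>. For \<open>k = 1\<close> the cone of \<open>u\<close> and \<open>v\<close> is unimodular.
\<close>
definition diagonal_lattice :: "nat \<Rightarrow> real^'n \<Rightarrow> real^'n \<Rightarrow> (real^'n) set" where
  "diagonal_lattice k u v = {(of_int i / of_nat k) *\<^sub>R u + (of_int j / of_nat k) *\<^sub>R v | i j :: int. int k dvd i - j}"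

lemma diagonal_lattice_commute: "diagonal_lattice k u v = diagonal_lattice k v u"
  unfolding diagonal_lattice_def by (metis (no_types, opaque_lifting) add.commute dvd_diff_commute)

lemma lattice_basis_cyclic: "w \<noteq> 0 \<Longrightarrow> lattice_basis {w} (cyclic_lattice w)"
  by (simp add: lattice_basis_single cyclic_lattice_def)

lemma lattice_basis_diagonal:
  assumes uv: "independent {u, v :: real^'n}" "u \<noteq> v" and k: "k > 0"
  shows "u \<noteq> (1 / of_nat k) *\<^sub>R (u + v)" "lattice_basis {u, (1 / of_nat k) *\<^sub>R (u + v)} (diagonal_lattice k u v)"
    "span {u, (1 / of_nat k) *\<^sub>R (u + v)} = span {u, v}"
proof -
  let ?b = "(1 / of_nat k) *\<^sub>R (u + v)"
  show ne: "u \<noteq> ?b"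
  proof
    assume "u = ?b"
    hence "1 *\<^sub>R u + 0 *\<^sub>R v = (1 / of_nat k) *\<^sub>R u + (1 / of_nat k) *\<^sub>R v" by (simp add: scaleR_add_right)
    from independent_pair_coeffs(2)[OF uv this] k show False by simp
  qed
  have v: "v = of_nat k *\<^sub>R ?b - u" using k by (simp add: algebra_simps)
  show span: "span {u, ?b} = span {u, v}"
  proof (rule span_eq[THEN iffD2], intro conjI)
    show "{u, ?b} \<subseteq> span {u, v}" by (auto intro!: span_scale span_add intro: span_base)
    have "of_nat k *\<^sub>R ?b - u \<in> span {u, ?b}" by (intro span_diff span_scale span_base) auto
    thus "{u, v} \<subseteq> span {u, ?b}" using v by (auto intro: span_base)
  qed
  from span have "dim {u, ?b} = card {u, ?b}"
    using dim_eq_card_independent[OF uv(1)] uv(2) ne dim_span[of "{u, ?b}"] dim_span[of "{u, v}"] by simp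
  hence "independent {u, ?b}" using card_eq_dim[of "{u, ?b}" "{u, ?b}"] span_superset[of "{u, ?b}"] by simp
  moreover have "diagonal_lattice k u v = {of_int i *\<^sub>R u + of_int j *\<^sub>R ?b | i j :: int. True}"
  proof (intro equalityI subsetI)
    fix x assume "x \<in> diagonal_lattice k u v"
    then obtain i j :: int where x: "x = (of_int i / of_nat k) *\<^sub>R u + (of_int j / of_nat k) *\<^sub>R v" and "int k dvd i - j"
      by (auto simp: diagonal_lattice_def)
    then obtain m where "i - j = int k * m" by (elim dvdE)
    hence "of_int i = (of_int j + of_nat k * of_int m :: real)" by (metis add.commute diff_add_cancel of_int_add of_int_mult of_int_of_nat_eq)
    hence "x = of_int m *\<^sub>R u + of_int j *\<^sub>R ?b" using k unfolding x by (simp add: add_divide_distrib algebra_simps)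
    thus "x \<in> {of_int i *\<^sub>R u + of_int j *\<^sub>R ?b | i j :: int. True}" by blast
  next
    fix x assume "x \<in> {of_int i *\<^sub>R u + of_int j *\<^sub>R ?b | i j :: int. True}"
    then obtain i j :: int where x: "x = of_int i *\<^sub>R u + of_int j *\<^sub>R ?b" by blast
    have "x = (of_int (j + int k * i) / of_nat k) *\<^sub>R u + (of_int j / of_nat k) *\<^sub>R v"
      using k unfolding x by (simp add: add_divide_distrib algebra_simps)
    thus "x \<in> diagonal_lattice k u v" unfolding diagonal_lattice_def by fastforce
  qed
  ultimately show "lattice_basis {u, ?b} (diagonal_lattice k u v)"
    by (simp add: lattice_basis_pair[OF ne])
qed

lemma diagonal_lattice_Int_line:
  assumes uv: "independent {u, v :: real^'n}" "u \<noteq> v" and k: "k > 0"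
  shows "diagonal_lattice k u v \<inter> span {u} = cyclic_lattice u"
proof (intro equalityI subsetI)
  fix x assume "x \<in> diagonal_lattice k u v \<inter> span {u}"
  then obtain i j :: int and t where x: "x = (of_int i / of_nat k) *\<^sub>R u + (of_int j / of_nat k) *\<^sub>R v" "int k dvd i - j"
    "x = t *\<^sub>R u" by (auto simp: diagonal_lattice_def span_singleton)
  hence "(of_int i / of_nat k) *\<^sub>R u + (of_int j / of_nat k) *\<^sub>R v = t *\<^sub>R u + 0 *\<^sub>R v" by simp
  from independent_pair_coeffs(2)[OF uv this] k have j: "j = 0" by simp
  then obtain m where "i = int k * m" using x(2) by (auto elim: dvdE)
  hence "x = of_int m *\<^sub>R u" using x(1) j k by simp
  thus "x \<in> cyclic_lattice u" by (auto simp: cyclic_lattice_def)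
next
  fix x assume "x \<in> cyclic_lattice u"
  then obtain m :: int where x: "x = of_int m *\<^sub>R u" by (auto simp: cyclic_lattice_def)
  hence "x = (of_int (int k * m) / of_nat k) *\<^sub>R u + (of_int 0 / of_nat k) *\<^sub>R v" using k by simp
  hence "x \<in> diagonal_lattice k u v" unfolding diagonal_lattice_def by (intro CollectI exI[of _ "int k * m"] exI[of _ 0]) simp
  moreover have "x \<in> span {u}" by (auto simp: x span_singleton)
  ultimately show "x \<in> diagonal_lattice k u v \<inter> span {u}" by blast
qed

text \<open>
  Every \<open>j\<close> occurs as the second coordinate of a lattice point, for instance of the diagonal one with
  \<open>i = j\<close>, so the projection along \<open>u\<close> is generated by the projection of \<open>(1/k) v\<close>.
\<close>
lemma orth_proj_diagonal_lattice:
  assumes "u \<noteq> (0 :: real^'n)" and k: "k > 0"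
  shows "orth_proj (span {(1 / of_nat k) *\<^sub>R rejection u v}) ` diagonal_lattice k u v = cyclic_lattice ((1 / of_nat k) *\<^sub>R rejection u v)"
proof -
  let ?w = "(1 / of_nat k) *\<^sub>R rejection u v"
  have P: "orth_proj (span {?w}) ((of_int i / of_nat k) *\<^sub>R u + (of_int j / of_nat k) *\<^sub>R v) = of_int j *\<^sub>R ?w" for i j :: int
    using orth_proj_plane_line[OF assms(1), of "1 / of_nat k"] k by simp
  show ?thesis
  proof (intro equalityI subsetI)
    fix x assume "x \<in> cyclic_lattice ?w"
    then obtain j :: int where "x = of_int j *\<^sub>R ?w" by (auto simp: cyclic_lattice_def)
    moreover have "(of_int j / of_nat k) *\<^sub>R u + (of_int j / of_nat k) *\<^sub>R v \<in> diagonal_lattice k u v"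
      unfolding diagonal_lattice_def by force
    ultimately show "x \<in> orth_proj (span {?w}) ` diagonal_lattice k u v" using P by (metis imageI)
  next
    fix x assume "x \<in> orth_proj (span {?w}) ` diagonal_lattice k u v"
    then obtain i j :: int where "x = orth_proj (span {?w}) ((of_int i / of_nat k) *\<^sub>R u + (of_int j / of_nat k) *\<^sub>R v)"
      unfolding diagonal_lattice_def by auto
    thus "x \<in> cyclic_lattice ?w" unfolding P unfolding cyclic_lattice_def by (rule range_eqI)
  qed
qed

lemma orth_proj_cone:
  assumes "u \<noteq> (0 :: real^'n)" and k: "k > 0"
  shows "orth_proj (span {(1 / of_nat k) *\<^sub>R rejection u v}) ` (convex_cone hull {u, v}) = convex_cone hull {(1 / of_nat k) *\<^sub>R rejection u v}"
proof -
  let ?w = "(1 / of_nat k) *\<^sub>R rejection u v"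
  have P: "orth_proj (span {?w}) (s *\<^sub>R u + t *\<^sub>R v) = (t * of_nat k) *\<^sub>R ?w" for s t
    using orth_proj_plane_line[OF assms(1), of "1 / of_nat k"] k by simp
  show ?thesis
  proof (intro equalityI subsetI)
    fix x assume "x \<in> convex_cone hull {?w}"
    then obtain t where t: "t \<ge> 0" "x = t *\<^sub>R ?w" by (auto simp: convex_cone_hull_singleton)
    have "x = orth_proj (span {?w}) (0 *\<^sub>R u + (t / of_nat k) *\<^sub>R v)" unfolding P using t k by simp
    moreover have "0 *\<^sub>R u + (t / of_nat k) *\<^sub>R v \<in> convex_cone hull {u, v}"
      unfolding convex_cone_hull_pair using t k by (blast intro: divide_nonneg_nonneg of_nat_0_le_iff)
    ultimately show "x \<in> orth_proj (span {?w}) ` (convex_cone hull {u, v})" by blast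
  next
    fix x assume "x \<in> orth_proj (span {?w}) ` (convex_cone hull {u, v})"
    then obtain s t where "0 \<le> t" "x = orth_proj (span {?w}) (s *\<^sub>R u + t *\<^sub>R v)" by (auto simp: convex_cone_hull_pair)
    hence "x = (t * of_nat k) *\<^sub>R ?w" "0 \<le> t * of_nat k" unfolding P by auto
    thus "x \<in> convex_cone hull {?w}" unfolding convex_cone_hull_singleton by blast
  qed
qed

section \<open>Exponential sums and integrals\<close>

lemma exp_sum_ray:
  assumes w: "w \<noteq> (0 :: real^'n)" and x: "\<xi> \<bullet> w < 0"
  shows "exp_sum (cyclic_lattice w) (convex_cone hull {w}) \<xi> = 1 / (1 - exp (\<xi> \<bullet> w))"
proof -
  have "bij_betw (\<lambda>n :: nat. of_nat n *\<^sub>R w) UNIV (convex_cone hull {w} \<inter> cyclic_lattice w)"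
  proof (rule bij_betwI')
    show "of_nat m *\<^sub>R w = of_nat n *\<^sub>R w \<longleftrightarrow> m = n" for m n using w by simp
    show "of_nat n *\<^sub>R w \<in> convex_cone hull {w} \<inter> cyclic_lattice w" for n
      unfolding convex_cone_hull_singleton cyclic_lattice_def by (auto intro!: range_eqI[of _ _ "int n"])
    fix z assume "z \<in> convex_cone hull {w} \<inter> cyclic_lattice w"
    then obtain t and i :: int where "0 \<le> t" "z = t *\<^sub>R w" "z = of_int i *\<^sub>R w"
      unfolding convex_cone_hull_singleton cyclic_lattice_def by blast
    hence "z = of_nat (nat i) *\<^sub>R w" using w by auto
    thus "\<exists>n\<in>UNIV. z = of_nat n *\<^sub>R w" by blast
  qed
  hence "exp_sum (cyclic_lattice w) (convex_cone hull {w}) \<xi> = (\<Sum>\<^sub>\<infinity>n. exp (\<xi> \<bullet> (of_nat n *\<^sub>R w)))"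
    unfolding exp_sum_def by (rule infsum_reindex_bij_betw[symmetric])
  also have "\<dots> = (\<Sum>\<^sub>\<infinity>n. exp (\<xi> \<bullet> w) ^ n)" by (simp add: exp_of_nat_mult)
  also have "\<dots> = 1 / (1 - exp (\<xi> \<bullet> w))"
    using sums_nonneg_imp_has_sum[OF geometric_sums[of "exp (\<xi> \<bullet> w)"]] x by (intro infsumI) simp
  finally show ?thesis .
qed

text \<open>
  The fundamental parallelogram of the cone contains exactly the \<open>k\<close> lattice points \<open>(j/k)(u + v)\<close>,
  and every lattice point of the cone is one of these plus a point of \<open>\<nat> u + \<nat> v\<close>.
\<close>
lemma diagonal_lattice_cone_points:
  assumes uv: "independent {u, v :: real^'n}" "u \<noteq> v" and k: "k > 0"
  shows "bij_betw (\<lambda>(j, m, n). (of_nat j / of_nat k + of_nat m) *\<^sub>R u + (of_nat j / of_nat k + of_nat n) *\<^sub>R v)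
    ({..<k} \<times> UNIV \<times> UNIV) (convex_cone hull {u, v} \<inter> diagonal_lattice k u v)"
proof (rule bij_betwI', goal_cases)
  case (1 a b)
  obtain j m n j' m' n' where ab: "a = (j, m, n)" "b = (j', m', n')" by (metis prod_cases3)
  have jk: "j < k" "j' < k" using 1 ab by auto
  have "j = j' \<and> m = m'" if "real j / real k + real m = real j' / real k + real m'" for m m'
  proof -
    have "real j + real k * real m = real j' + real k * real m'" using that k by (simp add: field_simps)
    hence eq: "j + k * m = j' + k * m'" by (metis of_nat_add of_nat_eq_iff of_nat_mult)
    hence "j = j'" using jk by (metis mod_less mod_mult_self2)
    thus ?thesis using eq k by simp
  qed
  hence *: "j = j' \<and> m = m' \<and> n = n'"
    if "real j / real k + real m = real j' / real k + real m'" "real j / real k + real n = real j' / real k + real n'"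
    using that by blast
  show ?case unfolding ab prod.case
    using * independent_pair_coeffs[OF uv, of "real j / real k + real m" "real j / real k + real n"
        "real j' / real k + real m'" "real j' / real k + real n'"] by auto
next
  case (2 a)
  obtain j m n where a: "a = (j, m, n)" by (metis prod_cases3)
  have "(real j / real k + real m) *\<^sub>R u + (real j / real k + real n) *\<^sub>R v \<in> convex_cone hull {u, v}"
    unfolding convex_cone_hull_pair by (intro CollectI exI conjI refl) auto
  moreover have "(real j / real k + real m) *\<^sub>R u + (real j / real k + real n) *\<^sub>R v \<in> diagonal_lattice k u v"
    unfolding diagonal_lattice_def
    using k by (intro CollectI exI[of _ "int (j + k * m)"] exI[of _ "int (j + k * n)"])
      (auto simp: add_divide_distrib right_diff_distrib[symmetric])
  ultimately show ?case by (simp add: a)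
next
  case (3 z)
  then obtain s t and i j :: int where z: "0 \<le> s" "0 \<le> t" "z = s *\<^sub>R u + t *\<^sub>R v"
    "z = (of_int i / of_nat k) *\<^sub>R u + (of_int j / of_nat k) *\<^sub>R v" "int k dvd i - j"
    unfolding convex_cone_hull_pair diagonal_lattice_def by auto
  have st: "s = of_int i / of_nat k" "t = of_int j / of_nat k"
    using independent_pair_coeffs[OF uv, of s t "of_int i / of_nat k" "of_int j / of_nat k"] z(3,4) by auto
  hence "0 \<le> i" "0 \<le> j" using z k by (auto simp: zero_le_divide_iff)
  then obtain a b where ab: "i = int a" "j = int b" by (metis nonneg_int_cases)
  have "a mod k = b mod k" using z(5) unfolding ab by (metis mod_eq_dvd_iff nat_int_comparison(1) zmod_int)
  have div: "real a / real k = real (a mod k) / real k + real (a div k)" for a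
  proof -
    have "real a = real (a mod k) + real k * real (a div k)"
      by (metis mod_mult_div_eq of_nat_add of_nat_mult)
    thus ?thesis using k by (simp add: add_divide_distrib)
  qed
  have "real a / real k = real (a mod k) / real k + real (a div k)"
    "real b / real k = real (a mod k) / real k + real (b div k)"
    using div[of a] div[of b] \<open>a mod k = b mod k\<close> by auto
  hence "z = (\<lambda>(j, m, n). (of_nat j / of_nat k + of_nat m) *\<^sub>R u + (of_nat j / of_nat k + of_nat n) *\<^sub>R v) (a mod k, a div k, b div k)"
    using z(4) by (simp add: ab)
  thus ?case using k by (intro bexI[of _ "(a mod k, a div k, b div k)"]) auto
qed

lemma exp_sum_cone:
  assumes uv: "independent {u, v :: real^'n}" "u \<noteq> v" and k: "k > 0"
    and xy: "\<xi> \<bullet> u < 0" "\<xi> \<bullet> v < 0"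
  shows "exp_sum (diagonal_lattice k u v) (convex_cone hull {u, v}) \<xi> =
    (\<Sum>j<k. exp (of_nat j * (\<xi> \<bullet> u + \<xi> \<bullet> v) / of_nat k)) / ((1 - exp (\<xi> \<bullet> u)) * (1 - exp (\<xi> \<bullet> v)))"
proof -
  define X Y where "X = exp (\<xi> \<bullet> u)" and "Y = exp (\<xi> \<bullet> v)"
  have XY: "0 < X" "X < 1" "0 < Y" "Y < 1" using xy by (auto simp: X_def Y_def)
  have gX: "((\<lambda>n. X ^ n) has_sum 1 / (1 - X)) UNIV" and gY: "((\<lambda>n. Y ^ n) has_sum 1 / (1 - Y)) UNIV"
    using XY by (auto intro!: sums_nonneg_imp_has_sum geometric_sums)
  let ?h = "\<lambda>(m, n). X ^ m * Y ^ n"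
  have row: "((\<lambda>n. ?h (m, n)) has_sum X ^ m * (1 / (1 - Y))) UNIV" for m
    using has_sum_cmult_right[OF gY] by simp
  have "?h summable_on (UNIV \<times> UNIV)"
    by (rule summable_on_SigmaI[OF row has_sum_imp_summable[OF has_sum_cmult_left[OF gX]]]) (use XY in auto)
  hence h: "(?h has_sum (1 / (1 - X)) * (1 / (1 - Y))) (UNIV \<times> UNIV)"
    by (rule has_sum_SigmaI[OF row has_sum_cmult_left[OF gX]])
  define c where "c j = exp (of_nat j * (\<xi> \<bullet> u + \<xi> \<bullet> v) / of_nat k)" for j
  let ?g = "\<lambda>(j, p). c j * ?h p"
  have row': "((\<lambda>p. ?g (j, p)) has_sum c j * ((1 / (1 - X)) * (1 / (1 - Y)))) (UNIV \<times> UNIV)" for j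
    using has_sum_cmult_right[OF h] by simp
  have "?g summable_on ({..<k} \<times> UNIV \<times> UNIV)"
    by (rule summable_on_SigmaI[OF row']) (use XY in \<open>auto simp: c_def\<close>)
  hence g: "(?g has_sum (\<Sum>j<k. c j * ((1 / (1 - X)) * (1 / (1 - Y))))) ({..<k} \<times> UNIV \<times> UNIV)"
    by (rule has_sum_SigmaI[OF row' has_sum_finite[OF finite_lessThan]])
  have "exp_sum (diagonal_lattice k u v) (convex_cone hull {u, v}) \<xi> =
    (\<Sum>\<^sub>\<infinity>t\<in>{..<k} \<times> UNIV \<times> UNIV. exp (\<xi> \<bullet> (\<lambda>(j, m, n). (of_nat j / of_nat k + of_nat m) *\<^sub>R u + (of_nat j / of_nat k + of_nat n) *\<^sub>R v) t))"
    unfolding exp_sum_def by (rule infsum_reindex_bij_betw[symmetric, OF diagonal_lattice_cone_points[OF uv k]])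
  also have "\<dots> = infsum ?g ({..<k} \<times> UNIV \<times> UNIV)"
  proof (rule infsum_cong)
    fix t :: "nat \<times> nat \<times> nat"
    obtain j m n where t: "t = (j, m, n)" by (metis prod_cases3)
    have "\<xi> \<bullet> ((of_nat j / of_nat k + of_nat m) *\<^sub>R u + (of_nat j / of_nat k + of_nat n) *\<^sub>R v)
       = of_nat j * (\<xi> \<bullet> u + \<xi> \<bullet> v) / of_nat k + (of_nat m * (\<xi> \<bullet> u) + of_nat n * (\<xi> \<bullet> v))"
      by (simp add: inner_add_right algebra_simps add_divide_distrib)
    also have "exp \<dots> = c j * (X ^ m * Y ^ n)" by (simp only: exp_add exp_of_nat_mult c_def X_def Y_def)
    finally show "exp (\<xi> \<bullet> (\<lambda>(j, m, n). (of_nat j / of_nat k + of_nat m) *\<^sub>R u + (of_nat j / of_nat k + of_nat n) *\<^sub>R v) t) = ?g t"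
      by (simp add: t)
  qed
  also have "\<dots> = (\<Sum>j<k. c j * ((1 / (1 - X)) * (1 / (1 - Y))))" by (rule infsumI[OF g])
  also have "\<dots> = (\<Sum>j<k. c j) / ((1 - X) * (1 - Y))" by (simp add: sum_divide_distrib)
  finally show ?thesis by (simp add: c_def X_def Y_def)
qed

lemma lattice_basis_empty: "lattice_basis {} {0 :: real^'n}"
  by (auto simp: lattice_basis_def independent_empty)

lemma exp_integral_nn_integral:
  assumes "finite S"
  shows "exp_integral \<Lambda> (convex_cone hull S) \<xi> = enn2real (\<integral>\<^sup>+x. indicator (convex_cone hull S) x * ennreal (exp (\<xi> \<bullet> x))
    \<partial>lattice_measure (\<Lambda> \<inter> span (S :: (real^'n) set)))"
proof -
  have sets: "sets (lattice_measure M) = sets borel" for M :: "(real^'n) set"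
    by (simp add: lattice_measure_def Let_def)
  have C: "convex_cone hull S \<in> sets borel" using closed_convex_cone_hull[OF assms] by simp
  have "(\<lambda>x. indicator (convex_cone hull S) x *\<^sub>R exp (\<xi> \<bullet> x)) \<in> borel_measurable borel"
    using C by measurable
  hence "(\<lambda>x. indicator (convex_cone hull S) x *\<^sub>R exp (\<xi> \<bullet> x)) \<in> borel_measurable (lattice_measure (\<Lambda> \<inter> span S))"
    by (simp add: measurable_cong_sets[OF sets refl])
  hence "exp_integral \<Lambda> (convex_cone hull S) \<xi> = enn2real (\<integral>\<^sup>+x. ennreal (indicator (convex_cone hull S) x *\<^sub>R exp (\<xi> \<bullet> x)) \<partial>lattice_measure (\<Lambda> \<inter> span S))"
    unfolding exp_integral_def set_lebesgue_integral_def span_convex_cone_hull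
    by (rule integral_eq_nn_integral) auto
  also have "(\<lambda>x. ennreal (indicator (convex_cone hull S) x *\<^sub>R exp (\<xi> \<bullet> x))) = (\<lambda>x. indicator (convex_cone hull S) x * ennreal (exp (\<xi> \<bullet> x)))"
    by (auto simp: indicator_def)
  finally show ?thesis .
qed

lemma exp_integral_zero:
  assumes "0 \<in> \<Lambda>"
  shows "exp_integral \<Lambda> {0 :: real^'n} \<xi> = 1"
proof -
  define B where "B = (SOME B. lattice_basis B {0 :: real^'n})"
  have "card B = card ({} :: (real^'n) set)" "finite B"
    using lattice_basis_card[OF lattice_basis_empty] some_lattice_basis[OF lattice_basis_empty]
      independent_imp_finite unfolding B_def lattice_basis_def by blast+
  hence B: "B = {}" by simp
  have zero: "\<Lambda> \<inter> span {0} = {0}" using assms by auto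
  have "exp_integral \<Lambda> {0} \<xi> = (LINT x|distr (\<Pi>\<^sub>M b\<in>{} :: (real^'n) set. (lborel :: real measure)) borel (\<lambda>c. 0). indicator {0} x *\<^sub>R exp (\<xi> \<bullet> x))"
    unfolding exp_integral_def set_lebesgue_integral_def lattice_measure_def zero B_def[symmetric] Let_def B by simp
  also have "\<dots> = (LINT c|(\<Pi>\<^sub>M b\<in>{} :: (real^'n) set. (lborel :: real measure)). 1)"
    by (subst integral_distr) auto
  also have "\<dots> = 1" by (simp add: PiM_empty measure_def emeasure_count_space)
  finally show ?thesis .
qed

lemma exp_integral_ray:
  assumes w: "w \<noteq> (0 :: real^'n)" and \<Lambda>: "\<Lambda> \<inter> span {w} = cyclic_lattice w" and x: "\<xi> \<bullet> w < 0"
  shows "exp_integral \<Lambda> (convex_cone hull {w}) \<xi> = - 1 / (\<xi> \<bullet> w)"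
proof -
  have "convex_cone hull {w} \<in> sets borel" using closed_convex_cone_hull[of "{w}"] by simp
  hence [measurable]: "(\<lambda>z. indicator (convex_cone hull {w}) z * ennreal (exp (\<xi> \<bullet> z))) \<in> borel_measurable borel"
    by measurable
  have "indicator (convex_cone hull {w}) (t *\<^sub>R w) = (indicator {0..} t :: ennreal)" for t
    using w by (auto simp: indicator_def convex_cone_hull_singleton)
  hence "(\<integral>\<^sup>+z. indicator (convex_cone hull {w}) z * ennreal (exp (\<xi> \<bullet> z)) \<partial>lattice_measure (\<Lambda> \<inter> span {w})) = ennreal (- 1 / (\<xi> \<bullet> w))"
    unfolding \<Lambda> by (subst nn_integral_lattice_measure_single[OF _ lattice_basis_cyclic[OF w]])
      (simp_all add: nn_integral_exp_ray[OF x])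
  thus ?thesis using x by (subst exp_integral_nn_integral) (auto simp: divide_nonneg_neg)
qed

text \<open>
  In the coordinates with respect to \<open>u\<close> and \<open>v\<close> the cone is a quadrant, where the integral is
  \<open>1 / (xy)\<close>; the factor \<open>k\<close> is the inverse of the determinant that leads to a lattice basis.
\<close>
lemma exp_integral_cone:
  assumes uv: "independent {u, v :: real^'n}" "u \<noteq> v" and k: "k > 0"
    and xy: "\<xi> \<bullet> u < 0" "\<xi> \<bullet> v < 0"
  shows "exp_integral (diagonal_lattice k u v) (convex_cone hull {u, v}) \<xi> = of_nat k / ((\<xi> \<bullet> u) * (\<xi> \<bullet> v))"
proof -
  define b where "b = (1 / of_nat k) *\<^sub>R (u + v)"
  note basis = lattice_basis_diagonal[OF uv k, folded b_def]
  let ?F = "\<lambda>z. indicator (convex_cone hull {u, v}) z * ennreal (exp (\<xi> \<bullet> z))"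
  let ?G = "\<lambda>s t. ?F (s *\<^sub>R u + t *\<^sub>R v)"
  have "convex_cone hull {u, v} \<in> sets borel" using closed_convex_cone_hull[of "{u, v}"] by simp
  hence F [measurable]: "?F \<in> borel_measurable borel" by measurable
  have ind: "indicator (convex_cone hull {u, v}) (s *\<^sub>R u + t *\<^sub>R v) = (indicator {0..} s * indicator {0..} t :: ennreal)" for s t
  proof -
    have "s *\<^sub>R u + t *\<^sub>R v \<in> convex_cone hull {u, v} \<longleftrightarrow> 0 \<le> s \<and> 0 \<le> t"
      unfolding convex_cone_hull_pair using independent_pair_coeffs[OF uv, of s t] by auto
    thus ?thesis by (auto simp: indicator_def)
  qed
  have "(\<integral>\<^sup>+s. \<integral>\<^sup>+t. ?G s t \<partial>lborel \<partial>lborel) = ennreal (1 / ((\<xi> \<bullet> u) * (\<xi> \<bullet> v)))"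
    using nn_integral_exp_quadrant[OF xy] by (simp add: ind inner_add_right)
  moreover have "(\<integral>\<^sup>+s. \<integral>\<^sup>+t. ?G s t \<partial>lborel \<partial>lborel) = ennreal \<bar>1 * (1 / real k) - 0 * (1 / real k)\<bar> *
     (\<integral>\<^sup>+s. \<integral>\<^sup>+t. ?G (1 * s + (1 / real k) * t) (0 * s + (1 / real k) * t) \<partial>lborel \<partial>lborel)"
    using k by (intro nn_integral_linear_substitution) (auto intro!: measurable_compose[OF _ F])
  moreover have "?G (1 * s + (1 / real k) * t) (0 * s + (1 / real k) * t) = ?F (s *\<^sub>R u + t *\<^sub>R b)" for s t
    by (simp add: b_def algebra_simps)
  ultimately have eq: "ennreal (1 / k) * (\<integral>\<^sup>+s. \<integral>\<^sup>+t. ?F (s *\<^sub>R u + t *\<^sub>R b) \<partial>lborel \<partial>lborel) = ennreal (1 / ((\<xi> \<bullet> u) * (\<xi> \<bullet> v)))"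
    by simp
  have "(\<integral>\<^sup>+s. \<integral>\<^sup>+t. ?F (s *\<^sub>R u + t *\<^sub>R b) \<partial>lborel \<partial>lborel)
    = ennreal k * (ennreal (1 / k) * (\<integral>\<^sup>+s. \<integral>\<^sup>+t. ?F (s *\<^sub>R u + t *\<^sub>R b) \<partial>lborel \<partial>lborel))"
    using k by (simp add: mult.assoc[symmetric] ennreal_mult[symmetric])
  also have "\<dots> = ennreal (k / ((\<xi> \<bullet> u) * (\<xi> \<bullet> v)))"
    unfolding eq using xy by (subst ennreal_mult[symmetric]) (auto simp: mult_nonpos_nonpos)
  finally have val: "(\<integral>\<^sup>+s. \<integral>\<^sup>+t. ?F (s *\<^sub>R u + t *\<^sub>R b) \<partial>lborel \<partial>lborel) = ennreal (k / ((\<xi> \<bullet> u) * (\<xi> \<bullet> v)))" .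
  have "diagonal_lattice k u v \<subseteq> span {u, v}"
    unfolding diagonal_lattice_def using span_pair[of _ u v] by blast
  hence "diagonal_lattice k u v \<inter> span {u, v} = diagonal_lattice k u v" by blast
  hence "(\<integral>\<^sup>+z. ?F z \<partial>lattice_measure (diagonal_lattice k u v \<inter> span {u, v})) = ennreal (k / ((\<xi> \<bullet> u) * (\<xi> \<bullet> v)))"
    using nn_integral_lattice_measure_pair[OF F basis(2,1)] val by simp
  thus ?thesis using xy by (subst exp_integral_nn_integral) (auto simp: mult_nonpos_nonpos)
qed

section \<open>Berline--Vergne functions in dimensions 0 and 1\<close>

lemma rational_points_inner: "u \<in> rational_points \<Longrightarrow> v \<in> rational_points \<Longrightarrow> (u :: real^'n) \<bullet> v \<in> \<rat>"
  by (auto simp: inner_vec_def rational_points_def intro!: Rats_sum Rats_mult)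

lemma rational_points_scale: "c \<in> \<rat> \<Longrightarrow> u \<in> rational_points \<Longrightarrow> c *\<^sub>R u \<in> rational_points"
  by (auto simp: rational_points_def)

lemma rational_points_add: "u \<in> rational_points \<Longrightarrow> v \<in> rational_points \<Longrightarrow> u + v \<in> rational_points"
  by (auto simp: rational_points_def)

lemma rational_points_diff: "u \<in> rational_points \<Longrightarrow> v \<in> rational_points \<Longrightarrow> u - v \<in> rational_points"
  by (auto simp: rational_points_def)

lemma rational_points_rejection: "u \<in> rational_points \<Longrightarrow> v \<in> rational_points \<Longrightarrow> rejection u v \<in> rational_points"
  unfolding rejection_def by (intro rational_points_diff rational_points_scale Rats_divide rational_points_inner)

lemma eventually_inner_small:
  fixes l :: "real^'n"
  assumes "R > 0"
  shows "\<forall>\<^sub>F \<xi> in nhds 0. \<bar>\<xi> \<bullet> l\<bar> < R"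
proof -
  have "((\<lambda>\<xi>. \<xi> \<bullet> l) \<longlongrightarrow> 0 \<bullet> l) (nhds 0)" by (intro tendsto_intros filterlim_ident)
  hence "((\<lambda>\<xi>. \<xi> \<bullet> l) \<longlongrightarrow> 0) (nhds 0)" by simp
  from tendstoD[OF this assms] show ?thesis by (simp add: dist_real_def)
qed

lemma convergence_domain_cone:
  "\<xi> \<in> convergence_domain L (convex_cone hull {u, v}) \<longleftrightarrow>
     \<xi> \<in> L \<and> \<xi> \<bullet> u < 0 \<and> \<xi> \<bullet> v < 0" if "u \<noteq> 0" "v \<noteq> 0" for u v :: "real^'n"
proof -
  have "u \<in> convex_cone hull {u, v}" "v \<in> convex_cone hull {u, v}" by (auto intro: hull_inc)
  moreover have "\<xi> \<bullet> (s *\<^sub>R u + t *\<^sub>R v) < 0"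
    if "0 \<le> s" "0 \<le> t" "s *\<^sub>R u + t *\<^sub>R v \<noteq> 0" "\<xi> \<bullet> u < 0" "\<xi> \<bullet> v < 0" for s t
  proof -
    have "s > 0 \<or> t > 0" using that by fastforce
    thus ?thesis using that mult_nonneg_nonpos[of s "\<xi> \<bullet> u"] mult_nonneg_nonpos[of t "\<xi> \<bullet> v"]
        mult_pos_neg[of s "\<xi> \<bullet> u"] mult_pos_neg[of t "\<xi> \<bullet> v"] by (auto simp: inner_add_right)
  qed
  then have "\<xi> \<bullet> x < 0" if "\<xi> \<bullet> u < 0" "\<xi> \<bullet> v < 0" "x \<in> convex_cone hull {u, v} - {0}" for x
    using that unfolding convex_cone_hull_pair by blast
  ultimately show ?thesis using \<open>u \<noteq> 0\<close> \<open>v \<noteq> 0\<close> unfolding convergence_domain_def by blast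
qed

lemma convergence_domain_ray:
  "w \<noteq> 0 \<Longrightarrow> \<xi> \<in> convergence_domain L (convex_cone hull {w}) \<longleftrightarrow> \<xi> \<in> L \<and> \<xi> \<bullet> w < 0"
  using convergence_domain_cone[of w w \<xi> L] by simp

lemma BV_function_zero_space:
  assumes "BV_function {0 :: real^'n} {0} {0} f"
  shows "f 0 = 1"
  using assms
proof cases
  case (rec M)
  have "0 \<in> convergence_domain {0} {0 :: real^'n}" by (simp add: convergence_domain_def)
  with eventually_nhds_x_imp_x[OF rec(7)]
  have "exp_sum {0} {0 :: real^'n} 0 = (\<Sum>F\<in>{{0 :: real^'n}}. M F (orth_proj ({0} \<inter> (span F)\<^sup>\<bottom>) 0) * exp_integral {0} F 0)"
    by (simp add: cone_faces_zero)
  moreover have "exp_sum {0} {0} (0 :: real^'n) = 1" by (simp add: exp_sum_def)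
  ultimately show ?thesis using rec(1) by (simp add: exp_integral_zero orth_proj_zero_space)
qed

lemma orth_proj_zero_image: "A \<noteq> {} \<Longrightarrow> orth_proj {0} ` A = {0}"
  by (auto simp: orth_proj_zero_space)

text \<open>
  Along the full-dimensional face everything is projected to the zero space.
\<close>
lemma BV_function_full_face:
  assumes "subspace L" "span C = L" "\<Lambda> \<noteq> {}" "C \<noteq> {}"
  shows "BV_function (L \<inter> (span C)\<^sup>\<bottom>) (orth_proj (L \<inter> (span C)\<^sup>\<bottom>) ` \<Lambda>) (orth_proj (L \<inter> (span C)\<^sup>\<bottom>) ` C) g \<longleftrightarrow> g 0 = 1"
  unfolding assms(2) Int_orthogonal_comp_self[OF assms(1)] orth_proj_zero_image[OF assms(3)] orth_proj_zero_image[OF assms(4)]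
  using BV_function_zero_space BV_function.zero by blast

lemma ray_face_sum:
  fixes w :: "real^'n"
  assumes w: "w \<noteq> 0" and \<xi>: "\<xi> \<in> span {w}" "\<xi> \<bullet> w < 0"
  shows "(\<Sum>F\<in>cone_faces (convex_cone hull {w}). M F (orth_proj (span {w} \<inter> (span F)\<^sup>\<bottom>) \<xi>) * exp_integral (cyclic_lattice w) F \<xi>)
    = M {0} \<xi> - M (convex_cone hull {w}) 0 / (\<xi> \<bullet> w)"
proof -
  have ne: "{0} \<noteq> convex_cone hull {w}" using w hull_inc[of w "{w}" convex_cone] by auto
  have "0 \<in> cyclic_lattice w" by (auto simp: cyclic_lattice_def intro!: range_eqI[of _ _ 0])
  moreover have "cyclic_lattice w \<inter> span {w} = cyclic_lattice w"
    by (auto simp: cyclic_lattice_def span_singleton)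
  ultimately show ?thesis unfolding cone_faces_ray[OF w] using ne \<xi>
    by (simp add: exp_integral_zero exp_integral_ray[OF w] orth_proj_id subspace_span
       span_convex_cone_hull Int_orthogonal_comp_self orth_proj_zero_space)
qed

lemma BV_function_ray:
  fixes w :: "real^'n"
  assumes w: "w \<noteq> 0" "w \<in> rational_points"
  shows "BV_function (span {w}) (cyclic_lattice w) (convex_cone hull {w}) (\<lambda>\<xi>. eval_fps ray_series (\<xi> \<bullet> w))"
proof -
  define M where "M F = (if F = {0} then (\<lambda>\<xi>. eval_fps ray_series (\<xi> \<bullet> w)) else (\<lambda>_. 1))" for F :: "(real^'n) set"
  have ne: "convex_cone hull {w} \<noteq> {0}" using w hull_inc[of w "{w}" convex_cone] by auto
  obtain R where R: "R > 0" "\<And>s. s \<noteq> 0 \<Longrightarrow> \<bar>s\<bar> < R \<Longrightarrow> eval_fps ray_series s = 1 / (1 - exp s) + 1 / s"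
    by (rule eval_ray_series) blast
  have "BV_function (span {w}) (cyclic_lattice w) (convex_cone hull {w}) (M {0})"
  proof (rule BV_function.rec)
    show "rational_lattice_in (span {w}) (cyclic_lattice w)"
      unfolding rational_lattice_in_def using lattice_basis_cyclic[OF w(1)] w(2) by blast
    have "{0} face_of (convex_cone hull {w})" using cone_faces_ray[OF w(1)] by (auto simp: cone_faces_def)
    thus "pointed_rational_cone (convex_cone hull {w})"
      unfolding pointed_rational_cone_def using w(2) by (intro conjI exI[of _ "{w}"]) auto
    show "convex_cone hull {w} \<subseteq> span {w}" by (metis span_convex_cone_hull span_superset)
    show "analytic_near_0_on (span {w}) (M {0})" unfolding M_def
      by (simp add: analytic_germ_imp_analytic_near_0_on analytic_germ_eval_fps ray_series_radius)
    fix F assume "F \<in> cone_faces (convex_cone hull {w})" "F \<noteq> {0}"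
    hence F: "F = convex_cone hull {w}" using cone_faces_ray[OF w(1)] by blast
    show "BV_function (span {w} \<inter> (span F)\<^sup>\<bottom>) (orth_proj (span {w} \<inter> (span F)\<^sup>\<bottom>) ` cyclic_lattice w)
             (orth_proj (span {w} \<inter> (span F)\<^sup>\<bottom>) ` (convex_cone hull {w})) (M F)"
      unfolding F by (subst BV_function_full_face)
        (auto simp: span_convex_cone_hull cyclic_lattice_def M_def ne convex_cone_hull_nonempty)
  next
    show "\<forall>\<^sub>F \<xi> in nhds 0. \<xi> \<in> convergence_domain (span {w}) (convex_cone hull {w}) \<longrightarrow>
       exp_sum (cyclic_lattice w) (convex_cone hull {w}) \<xi> =
       (\<Sum>F\<in>cone_faces (convex_cone hull {w}). M F (orth_proj (span {w} \<inter> (span F)\<^sup>\<bottom>) \<xi>) * exp_integral (cyclic_lattice w) F \<xi>)"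
      using eventually_inner_small[OF R(1), of w]
    proof eventually_elim
      case (elim \<xi>)
      show ?case
      proof
        assume "\<xi> \<in> convergence_domain (span {w}) (convex_cone hull {w})"
        hence \<xi>: "\<xi> \<in> span {w}" "\<xi> \<bullet> w < 0" by (simp_all add: convergence_domain_ray w)
        show "exp_sum (cyclic_lattice w) (convex_cone hull {w}) \<xi> =
          (\<Sum>F\<in>cone_faces (convex_cone hull {w}). M F (orth_proj (span {w} \<inter> (span F)\<^sup>\<bottom>) \<xi>) * exp_integral (cyclic_lattice w) F \<xi>)"
          unfolding ray_face_sum[OF w(1) \<xi>] exp_sum_ray[OF w(1) \<xi>(2)]
          using R(2)[of "\<xi> \<bullet> w"] elim \<xi> ne by (simp add: M_def)
      qed
    qed
  qed
  thus ?thesis by (simp add: M_def)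
qed

text \<open>
  The recursion determines the function only on the side \<open>\<langle>\<xi>, w\<rangle> < 0\<close>, where sum and integral
  converge. This half is all that the two-dimensional uniqueness argument uses.
\<close>
lemma BV_function_ray_unique:
  fixes w :: "real^'n"
  assumes w: "w \<noteq> 0" and f: "BV_function (span {w}) (cyclic_lattice w) (convex_cone hull {w}) f"
  shows "\<forall>\<^sub>F \<xi> in nhds 0. \<xi> \<in> span {w} \<and> \<xi> \<bullet> w < 0 \<longrightarrow> f \<xi> = eval_fps ray_series (\<xi> \<bullet> w)"
  using f
proof cases
  case zero
  then show ?thesis using w by (metis (no_types, lifting) insertI1 singletonD span_base)
next
  case (rec M)
  have ne: "convex_cone hull {w} \<noteq> {0}" using w hull_inc[of w "{w}" convex_cone] by auto
  have "convex_cone hull {w} \<in> cone_faces (convex_cone hull {w})" using cone_faces_ray[OF w] by blast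
  from rec(5)[OF this ne] have M: "M (convex_cone hull {w}) 0 = 1"
    by (subst (asm) BV_function_full_face)
        (auto simp: span_convex_cone_hull cyclic_lattice_def convex_cone_hull_nonempty)
  obtain R where R: "R > 0" "\<And>s. s \<noteq> 0 \<Longrightarrow> \<bar>s\<bar> < R \<Longrightarrow> eval_fps ray_series s = 1 / (1 - exp s) + 1 / s"
    by (rule eval_ray_series) blast
  show ?thesis using eventually_inner_small[OF R(1), of w] rec(7)
  proof eventually_elim
    case (elim \<xi>)
    show ?case
    proof
      assume \<xi>: "\<xi> \<in> span {w} \<and> \<xi> \<bullet> w < 0"
      hence "1 / (1 - exp (\<xi> \<bullet> w)) = f \<xi> - 1 / (\<xi> \<bullet> w)"
        using elim(2) ray_face_sum[OF w, of \<xi> M] exp_sum_ray[OF w, of \<xi>] M rec(1)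
        by (simp add: convergence_domain_ray[OF w])
      thus "f \<xi> = eval_fps ray_series (\<xi> \<bullet> w)" using R(2)[of "\<xi> \<bullet> w"] elim(1) \<xi> by simp
    qed
  qed
qed

section \<open>Berline--Vergne functions in dimension 2\<close>

text \<open>
  The generator of the lattice \<open>diagonal_lattice k u v\<close> projected along \<open>u\<close>, and of the
  transverse cone along the ray of \<open>u\<close>.
\<close>
abbreviation transverse :: "nat \<Rightarrow> real^'n \<Rightarrow> real^'n \<Rightarrow> real^'n" where
  "transverse k u v \<equiv> (1 / of_nat k) *\<^sub>R rejection u v"

text \<open>
  Put \<open>x = \<langle>\<xi>, u\<rangle>\<close>, \<open>y = \<langle>\<xi>, v\<rangle>\<close>, \<open>a = \<langle>u, v\<rangle> / \<langle>u, u\<rangle>\<close>, \<open>b = \<langle>u, v\<rangle> / \<langle>v, v\<rangle>\<close>, and let \<open>h\<close> be the function of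
  \<open>ray_series\<close>. The formula reads
  \<open>h(x) h(y) + (h(x/k) - h(x)) (h(y/k) - h(y)) - (h(y/k) - h((y - ax)/k)) / x - (h(x/k) - h((x - by)/k)) / y\<close>,
  where the two quotients are divided differences because the arguments differ by \<open>ax/k\<close> and \<open>by/k\<close>.
  This is the function for \<open>k \<in> {1, 2}\<close> only: for \<open>k = 1\<close> the second product vanishes; for \<open>k = 2\<close> it comes from the second point of the
  fundamental parallelogram.
\<close>
definition cone_BV :: "nat \<Rightarrow> real^'n \<Rightarrow> real^'n \<Rightarrow> real^'n \<Rightarrow> real" where
  "cone_BV k u v \<xi> =
     eval_fps ray_series (\<xi> \<bullet> u) * eval_fps ray_series (\<xi> \<bullet> v)
     + (eval_fps ray_series (\<xi> \<bullet> ((1 / of_nat k) *\<^sub>R u)) - eval_fps ray_series (\<xi> \<bullet> u))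
       * (eval_fps ray_series (\<xi> \<bullet> ((1 / of_nat k) *\<^sub>R v)) - eval_fps ray_series (\<xi> \<bullet> v))
     - (u \<bullet> v / (u \<bullet> u) / of_nat k) * divided_difference ray_series (\<xi> \<bullet> ((1 / of_nat k) *\<^sub>R v)) (\<xi> \<bullet> transverse k u v)
     - (u \<bullet> v / (v \<bullet> v) / of_nat k) * divided_difference ray_series (\<xi> \<bullet> ((1 / of_nat k) *\<^sub>R u)) (\<xi> \<bullet> transverse k v u)"

text \<open>
  \<open>h(0) = 1/2\<close>, and a divided difference at 0 is \<open>h'(0) = -1/12\<close>.
\<close>
lemma cone_BV_0: "cone_BV k u v 0 = 1/4 + (u \<bullet> v / (u \<bullet> u) + u \<bullet> v / (v \<bullet> v)) / (12 * of_nat k)"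
  by (simp add: cone_BV_def divided_difference_0 eval_fps_at_0 ray_series_nth add_divide_distrib del: One_nat_def)

lemma analytic_germ_cone_BV: "analytic_germ (cone_BV k u v)"
  unfolding cone_BV_def using ray_series_radius
  by (intro analytic_germ_diff analytic_germ_add analytic_germ_mult analytic_germ_const
      analytic_germ_eval_fps analytic_germ_divided_difference)

text \<open>
  With \<open>X = exp (x/k)\<close> and \<open>Y = exp (y/k)\<close>, the values \<open>h(x) = 1/(1 - X\<^sup>k) + 1/x\<close> and
  \<open>h(x/k) = 1/(1 - X) + k/x\<close> turn the claim into an identity of rational functions in \<open>x\<close>, \<open>y\<close>, \<open>X\<close>, \<open>Y\<close>.
  The values of \<open>h\<close> at the transverse arguments cancel without being evaluated, which matters because
  these arguments may be zero or positive.
\<close>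
lemma cone_BV_identity:
  fixes u v :: "real^'n"
  assumes k: "k = 1 \<or> k = 2"
  shows "\<forall>\<^sub>F \<xi> in nhds 0. \<xi> \<bullet> u < 0 \<and> \<xi> \<bullet> v < 0 \<longrightarrow>
    (\<Sum>j<k. exp (of_nat j * (\<xi> \<bullet> u + \<xi> \<bullet> v) / of_nat k)) / ((1 - exp (\<xi> \<bullet> u)) * (1 - exp (\<xi> \<bullet> v)))
    = cone_BV k u v \<xi> - eval_fps ray_series (\<xi> \<bullet> transverse k u v) / (\<xi> \<bullet> u)
      - eval_fps ray_series (\<xi> \<bullet> transverse k v u) / (\<xi> \<bullet> v) + of_nat k / ((\<xi> \<bullet> u) * (\<xi> \<bullet> v))"
proof -
  obtain R where R: "R > 0" "ereal R \<le> fps_conv_radius ray_series"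
    "\<And>s. s \<noteq> 0 \<Longrightarrow> \<bar>s\<bar> < R \<Longrightarrow> eval_fps ray_series s = 1 / (1 - exp s) + 1 / s"
    by (rule eval_ray_series) blast
  have radius: "ereal \<bar>s\<bar> < fps_conv_radius ray_series" if "\<bar>s\<bar> < R" for s
    using that R(2) by (metis ereal_less_eq(3) less_ereal.simps(1) less_le_trans)
  show ?thesis
    using eventually_inner_small[OF R(1), of u] eventually_inner_small[OF R(1), of v]
      eventually_inner_small[OF R(1), of "(1 / of_nat k) *\<^sub>R u"] eventually_inner_small[OF R(1), of "(1 / of_nat k) *\<^sub>R v"]
      eventually_inner_small[OF R(1), of "transverse k u v"] eventually_inner_small[OF R(1), of "transverse k v u"]
  proof eventually_elim
    case (elim \<xi>)
    show ?case
    proof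
      assume xy: "\<xi> \<bullet> u < 0 \<and> \<xi> \<bullet> v < 0"
      define x y where "x = \<xi> \<bullet> u" and "y = \<xi> \<bullet> v"
      define hu hv where "hu = eval_fps ray_series (\<xi> \<bullet> transverse k u v)"
        and "hv = eval_fps ray_series (\<xi> \<bullet> transverse k v u)"
      let ?h = "eval_fps ray_series"
      have nz: "x \<noteq> 0" "y \<noteq> 0" "k \<noteq> 0" "x < 0" "y < 0" using xy k by (auto simp: x_def y_def)
      have inner: "\<xi> \<bullet> ((1 / of_nat k) *\<^sub>R u) = x / k" "\<xi> \<bullet> ((1 / of_nat k) *\<^sub>R v) = y / k"
        "\<xi> \<bullet> transverse k u v = (y - u \<bullet> v / (u \<bullet> u) * x) / k" "\<xi> \<bullet> transverse k v u = (x - u \<bullet> v / (v \<bullet> v) * y) / k"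
        by (simp_all add: x_def y_def rejection_def inner_diff_right inner_commute)
      have "(y / k - \<xi> \<bullet> transverse k u v) * divided_difference ray_series (y / k) (\<xi> \<bullet> transverse k u v) = ?h (y / k) - hu"
        unfolding hu_def using elim(4)[unfolded inner(2)] elim(5) by (rule divided_difference[OF radius radius])
      hence du: "(u \<bullet> v / (u \<bullet> u) / k) * divided_difference ray_series (y / k) (\<xi> \<bullet> transverse k u v) = (?h (y / k) - hu) / x"
        unfolding inner using nz by (simp add: field_simps)
      have "(x / k - \<xi> \<bullet> transverse k v u) * divided_difference ray_series (x / k) (\<xi> \<bullet> transverse k v u) = ?h (x / k) - hv"
        unfolding hv_def using elim(3)[unfolded inner(1)] elim(6) by (rule divided_difference[OF radius radius])
      hence dv: "(u \<bullet> v / (v \<bullet> v) / k) * divided_difference ray_series (x / k) (\<xi> \<bullet> transverse k v u) = (?h (x / k) - hv) / y"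
        unfolding inner using nz by (simp add: field_simps)
      have BV: "cone_BV k u v \<xi> = ?h x * ?h y + (?h (x / k) - ?h x) * (?h (y / k) - ?h y) - (?h (y / k) - hu) / x - (?h (x / k) - hv) / y"
        unfolding cone_BV_def inner(1,2) du dv by (simp add: x_def y_def)
      define X Y where "X = exp (x / k)" and "Y = exp (y / k)"
      have XY: "0 < X" "X < 1" "0 < Y" "Y < 1" using nz by (auto simp: X_def Y_def divide_neg_pos)
      have exps: "exp x = X ^ k" "exp y = Y ^ k" using nz by (simp_all add: X_def Y_def exp_of_nat_mult[symmetric])
      have h: "?h x = 1 / (1 - X ^ k) + 1 / x" "?h y = 1 / (1 - Y ^ k) + 1 / y"
        "?h (x / k) = 1 / (1 - X) + k / x" "?h (y / k) = 1 / (1 - Y) + k / y"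
        using R(3)[of x] R(3)[of y] R(3)[of "x / k"] R(3)[of "y / k"] elim nz inner
        by (simp_all add: exps x_def[symmetric] y_def[symmetric] X_def[symmetric] Y_def[symmetric])
      have S: "(\<Sum>j<k. exp (of_nat j * (x + y) / of_nat k)) = (if k = 1 then 1 else 1 + X * Y)"
        using k by (auto simp: X_def Y_def exp_add[symmetric] add_divide_distrib numeral_2_eq_2)
      have "(if k = 1 then 1 else 1 + X * Y) / ((1 - X ^ k) * (1 - Y ^ k)) =
         ?h x * ?h y + (?h (x / k) - ?h x) * (?h (y / k) - ?h y) - ?h (y / k) / x - ?h (x / k) / y + k / (x * y)"
        using k
      proof
        assume k1: "k = 1"
        define p q where "p = 1 / (1 - X)" and "q = 1 / (1 - Y)"
        have "p * q = (p + 1 / x) * (q + 1 / y) - (q + 1 / y) / x - (p + 1 / x) / y + 1 / (x * y)"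
          using nz by (simp add: field_simps)
        then show ?thesis unfolding h using k1 by (simp add: p_def q_def)
      next
        assume k2: "k = 2"
        \<comment> \<open>in terms of \<open>p\<close> and \<open>q\<close> all denominators but \<open>x\<close> and \<open>y\<close> disappear\<close>
        define p q where "p = 1 / (1 - X\<^sup>2)" and "q = 1 / (1 - Y\<^sup>2)"
        have "X\<^sup>2 < 1" "Y\<^sup>2 < 1" using XY by (auto simp: power_less_one_iff)
        hence pq: "1 / (1 - X) = (1 + X) * p" "1 / (1 - Y) = (1 + Y) * q"
          using XY by (auto simp: p_def q_def power2_eq_square field_simps)
        have "(1 + X * Y) / ((1 - X\<^sup>2) * (1 - Y\<^sup>2)) = (1 + X * Y) * (p * q)" by (simp add: p_def q_def)
        also have "\<dots> = (p + 1 / x) * (q + 1 / y) + ((1 + X) * p + 2 / x - (p + 1 / x)) * ((1 + Y) * q + 2 / y - (q + 1 / y))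
           - ((1 + Y) * q + 2 / y) / x - ((1 + X) * p + 2 / x) / y + 2 / (x * y)"
          using nz by (simp add: field_simps)
        finally show ?thesis unfolding h using k2 by (simp add: pq flip: p_def q_def)
      qed
      also have "\<dots> = cone_BV k u v \<xi> - hu / x - hv / y + k / (x * y)"
        unfolding BV by (simp add: diff_divide_distrib)
      finally show "(\<Sum>j<k. exp (of_nat j * (\<xi> \<bullet> u + \<xi> \<bullet> v) / of_nat k)) / ((1 - exp (\<xi> \<bullet> u)) * (1 - exp (\<xi> \<bullet> v)))
        = cone_BV k u v \<xi> - eval_fps ray_series (\<xi> \<bullet> transverse k u v) / (\<xi> \<bullet> u)
        - eval_fps ray_series (\<xi> \<bullet> transverse k v u) / (\<xi> \<bullet> v) + of_nat k / ((\<xi> \<bullet> u) * (\<xi> \<bullet> v))"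
        unfolding x_def[symmetric] y_def[symmetric] hu_def[symmetric] hv_def[symmetric] S exps by simp
    qed
  qed
qed

lemma transverse_nonzero:
  "independent {u, v :: real^'n} \<Longrightarrow> u \<noteq> v \<Longrightarrow> k > 0 \<Longrightarrow> transverse k u v \<noteq> 0"
  using rejection_nonzero by auto

lemma transverse_ray_data:
  fixes u v :: "real^'n"
  assumes uv: "independent {u, v}" and k: "k > 0"
  shows "span {u, v} \<inter> (span (convex_cone hull {u}))\<^sup>\<bottom> = span {transverse k u v}"
    "span {u, v} \<inter> (span (convex_cone hull {v}))\<^sup>\<bottom> = span {transverse k v u}"
    "orth_proj (span {transverse k u v}) ` diagonal_lattice k u v = cyclic_lattice (transverse k u v)"
    "orth_proj (span {transverse k v u}) ` diagonal_lattice k u v = cyclic_lattice (transverse k v u)"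
    "orth_proj (span {transverse k u v}) ` (convex_cone hull {u, v}) = convex_cone hull {transverse k u v}"
    "orth_proj (span {transverse k v u}) ` (convex_cone hull {u, v}) = convex_cone hull {transverse k v u}"
proof -
  have nz: "u \<noteq> 0" "v \<noteq> 0" "1 / real k \<noteq> 0" using independent_pair_nonzero[OF uv] k by auto
  show "span {u, v} \<inter> (span (convex_cone hull {u}))\<^sup>\<bottom> = span {transverse k u v}"
    "span {u, v} \<inter> (span (convex_cone hull {v}))\<^sup>\<bottom> = span {transverse k v u}"
    using plane_orthogonal_line[OF nz(1,3), of v] plane_orthogonal_line[OF nz(2,3), of u]
    by (simp_all add: span_convex_cone_hull insert_commute)
  show "orth_proj (span {transverse k u v}) ` diagonal_lattice k u v = cyclic_lattice (transverse k u v)"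
    "orth_proj (span {transverse k v u}) ` diagonal_lattice k u v = cyclic_lattice (transverse k v u)"
    using orth_proj_diagonal_lattice[OF nz(1) k, of v] orth_proj_diagonal_lattice[OF nz(2) k, of u]
    by (simp_all add: diagonal_lattice_commute)
  show "orth_proj (span {transverse k u v}) ` (convex_cone hull {u, v}) = convex_cone hull {transverse k u v}"
    "orth_proj (span {transverse k v u}) ` (convex_cone hull {u, v}) = convex_cone hull {transverse k v u}"
    using orth_proj_cone[OF nz(1) k, of v] orth_proj_cone[OF nz(2) k, of u] by (simp_all add: insert_commute)
qed

lemma cone_face_sum:
  fixes u v :: "real^'n"
  assumes uv: "independent {u, v}" "u \<noteq> v" and k: "k > 0"
    and \<xi>: "\<xi> \<in> span {u, v}" "\<xi> \<bullet> u < 0" "\<xi> \<bullet> v < 0"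
  shows "(\<Sum>F\<in>cone_faces (convex_cone hull {u, v}). M F (orth_proj (span {u, v} \<inter> (span F)\<^sup>\<bottom>) \<xi>) * exp_integral (diagonal_lattice k u v) F \<xi>)
    = M {0} \<xi> - M (convex_cone hull {u}) (orth_proj (span {transverse k u v}) \<xi>) / (\<xi> \<bullet> u)
      - M (convex_cone hull {v}) (orth_proj (span {transverse k v u}) \<xi>) / (\<xi> \<bullet> v)
      + M (convex_cone hull {u, v}) 0 * (of_nat k / ((\<xi> \<bullet> u) * (\<xi> \<bullet> v)))"
proof -
  have vu: "independent {v, u}" "v \<noteq> u" using uv by (auto simp: insert_commute)
  note distinct = rays_distinct[OF uv] rays_distinct[OF vu, unfolded insert_commute[of v u]]
  note nz = independent_pair_nonzero[OF uv(1)]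
  have zero: "0 \<in> diagonal_lattice k u v" unfolding diagonal_lattice_def by (intro CollectI exI[of _ 0]) simp
  have lines: "diagonal_lattice k u v \<inter> span {u} = cyclic_lattice u" "diagonal_lattice k u v \<inter> span {v} = cyclic_lattice v"
    using diagonal_lattice_Int_line[OF uv k] diagonal_lattice_Int_line[OF vu k] by (simp_all add: diagonal_lattice_commute)
  let ?T = "\<lambda>F. M F (orth_proj (span {u, v} \<inter> (span F)\<^sup>\<bottom>) \<xi>) * exp_integral (diagonal_lattice k u v) F \<xi>"
  have "?T {0} = M {0} \<xi>" using \<xi> zero by (simp add: orth_proj_id exp_integral_zero subspace_span)
  moreover have "?T (convex_cone hull {u}) = - M (convex_cone hull {u}) (orth_proj (span {transverse k u v}) \<xi>) / (\<xi> \<bullet> u)"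
    unfolding transverse_ray_data(1)[OF uv(1) k] using exp_integral_ray[OF nz(1) lines(1) \<xi>(2)] by simp
  moreover have "?T (convex_cone hull {v}) = - M (convex_cone hull {v}) (orth_proj (span {transverse k v u}) \<xi>) / (\<xi> \<bullet> v)"
    unfolding transverse_ray_data(2)[OF uv(1) k] using exp_integral_ray[OF nz(2) lines(2) \<xi>(3)] by simp
  moreover have "?T (convex_cone hull {u, v}) = M (convex_cone hull {u, v}) 0 * (of_nat k / ((\<xi> \<bullet> u) * (\<xi> \<bullet> v)))"
    unfolding exp_integral_cone[OF uv k \<xi>(2,3)] span_convex_cone_hull Int_orthogonal_comp_self[OF subspace_span]
    by (simp add: orth_proj_zero_space)
  moreover have "sum ?T (cone_faces (convex_cone hull {u, v})) =
    ?T {0} + ?T (convex_cone hull {u}) + ?T (convex_cone hull {v}) + ?T (convex_cone hull {u, v})"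
    unfolding cone_faces_pair[OF uv] using distinct by (simp add: eq_commute[of "{0}"])
  ultimately show ?thesis by simp
qed

lemma inner_orth_proj_line: "w \<noteq> 0 \<Longrightarrow> orth_proj (span {w}) \<xi> \<bullet> w = \<xi> \<bullet> w"
  by (simp add: orth_proj_line)

lemma BV_function_cone:
  fixes u v :: "real^'n"
  assumes uv: "independent {u, v}" "u \<noteq> v" and k: "k = 1 \<or> k = 2"
    and rat: "u \<in> rational_points" "v \<in> rational_points"
  shows "BV_function (span {u, v}) (diagonal_lattice k u v) (convex_cone hull {u, v}) (cone_BV k u v)"
proof -
  have k0: "k > 0" using k by auto
  have vu: "independent {v, u}" "v \<noteq> u" using uv by (auto simp: insert_commute)
  note distinct = rays_distinct[OF uv] rays_distinct[OF vu, unfolded insert_commute[of v u]]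
  note nz = independent_pair_nonzero[OF uv(1)]
  have wnz: "transverse k u v \<noteq> 0" "transverse k v u \<noteq> 0"
    using transverse_nonzero[OF uv k0] transverse_nonzero[OF vu k0] by auto
  have wrat: "transverse k u v \<in> rational_points" "transverse k v u \<in> rational_points"
    using rat by (auto intro!: rational_points_scale rational_points_rejection)
  define M where "M F = (if F = {0} then cone_BV k u v
     else if F = convex_cone hull {u} then (\<lambda>\<xi>. eval_fps ray_series (\<xi> \<bullet> transverse k u v))
     else if F = convex_cone hull {v} then (\<lambda>\<xi>. eval_fps ray_series (\<xi> \<bullet> transverse k v u)) else (\<lambda>_. 1))" for F :: "(real^'n) set"
  have M: "M {0} = cone_BV k u v" "M (convex_cone hull {u}) = (\<lambda>\<xi>. eval_fps ray_series (\<xi> \<bullet> transverse k u v))"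
    "M (convex_cone hull {v}) = (\<lambda>\<xi>. eval_fps ray_series (\<xi> \<bullet> transverse k v u))" "M (convex_cone hull {u, v}) = (\<lambda>_. 1)"
    using distinct unfolding M_def by metis+
  have "BV_function (span {u, v}) (diagonal_lattice k u v) (convex_cone hull {u, v}) (M {0})"
  proof (rule BV_function.rec)
    let ?b = "(1 / of_nat k) *\<^sub>R (u + v)"
    have b: "?b \<in> rational_points" using rat by (intro rational_points_scale rational_points_add) auto
    show "rational_lattice_in (span {u, v}) (diagonal_lattice k u v)"
      unfolding rational_lattice_in_def using lattice_basis_diagonal(2,3)[OF uv k0] rat(1) b
      by (intro exI[of _ "{u, ?b}"]) auto
    show "pointed_rational_cone (convex_cone hull {u, v})"
      unfolding pointed_rational_cone_def using rat zero_face_of_cone[OF uv] by (intro conjI exI[of _ "{u, v}"]) auto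
    show "convex_cone hull {u, v} \<subseteq> span {u, v}" by (metis span_convex_cone_hull span_superset)
    show "analytic_near_0_on (span {u, v}) (M {0})" unfolding M
      by (rule analytic_germ_imp_analytic_near_0_on[OF analytic_germ_cone_BV])
    fix F assume F: "F \<in> cone_faces (convex_cone hull {u, v})" "F \<noteq> {0}"
    let ?L = "span {u, v} \<inter> (span F)\<^sup>\<bottom>"
    consider "F = convex_cone hull {u}" | "F = convex_cone hull {v}" | "F = convex_cone hull {u, v}"
      using F cone_faces_pair[OF uv] by blast
    thus "BV_function ?L (orth_proj ?L ` diagonal_lattice k u v) (orth_proj ?L ` (convex_cone hull {u, v})) (M F)"
    proof cases
      case 1
      show ?thesis unfolding 1 M transverse_ray_data(1)[OF uv(1) k0]
        unfolding transverse_ray_data[OF uv(1) k0] by (rule BV_function_ray[OF wnz(1) wrat(1)])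
    next
      case 2
      show ?thesis unfolding 2 M transverse_ray_data(2)[OF uv(1) k0]
        unfolding transverse_ray_data[OF uv(1) k0] by (rule BV_function_ray[OF wnz(2) wrat(2)])
    next
      case 3
      show ?thesis unfolding 3 using lattice_basis_subset[OF lattice_basis_diagonal(2)[OF uv k0]]
        by (subst BV_function_full_face) (auto simp: M span_convex_cone_hull convex_cone_hull_nonempty)
    qed
  next
    show "\<forall>\<^sub>F \<xi> in nhds 0. \<xi> \<in> convergence_domain (span {u, v}) (convex_cone hull {u, v}) \<longrightarrow>
       exp_sum (diagonal_lattice k u v) (convex_cone hull {u, v}) \<xi> =
       (\<Sum>F\<in>cone_faces (convex_cone hull {u, v}). M F (orth_proj (span {u, v} \<inter> (span F)\<^sup>\<bottom>) \<xi>) * exp_integral (diagonal_lattice k u v) F \<xi>)"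
      using cone_BV_identity[OF k, of u v]
    proof eventually_elim
      case (elim \<xi>)
      show ?case
      proof
        assume "\<xi> \<in> convergence_domain (span {u, v}) (convex_cone hull {u, v})"
        hence \<xi>: "\<xi> \<in> span {u, v}" "\<xi> \<bullet> u < 0" "\<xi> \<bullet> v < 0" using convergence_domain_cone[OF nz] by auto
        show "exp_sum (diagonal_lattice k u v) (convex_cone hull {u, v}) \<xi> =
           (\<Sum>F\<in>cone_faces (convex_cone hull {u, v}). M F (orth_proj (span {u, v} \<inter> (span F)\<^sup>\<bottom>) \<xi>) * exp_integral (diagonal_lattice k u v) F \<xi>)"
          unfolding cone_face_sum[OF uv k0 \<xi>] exp_sum_cone[OF uv k0 \<xi>(2,3)] M inner_orth_proj_line[OF wnz(1)] inner_orth_proj_line[OF wnz(2)]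
          using elim \<xi> by simp
      qed
    qed
  qed
  thus ?thesis by (simp add: M)
qed

text \<open>
  The functions of the transverse rays enter at projections of \<open>\<xi>\<close>, where they are known only if the
  projections lie in the convergence domains of these rays; hence the two extra sign conditions.
\<close>
lemma BV_function_cone_unique:
  fixes u v :: "real^'n"
  assumes uv: "independent {u, v}" "u \<noteq> v" and k: "k = 1 \<or> k = 2"
    and f: "BV_function (span {u, v}) (diagonal_lattice k u v) (convex_cone hull {u, v}) f"
  shows "analytic_near_0_on (span {u, v}) f"
    "\<forall>\<^sub>F \<xi> in nhds 0. \<xi> \<in> span {u, v} \<and> \<xi> \<bullet> u < 0 \<and> \<xi> \<bullet> v < 0 \<and> \<xi> \<bullet> transverse k u v < 0 \<and> \<xi> \<bullet> transverse k v u < 0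
       \<longrightarrow> f \<xi> = cone_BV k u v \<xi>"
proof -
  have k0: "k > 0" using k by auto
  have vu: "independent {v, u}" "v \<noteq> u" using uv by (auto simp: insert_commute)
  note distinct = rays_distinct[OF uv] rays_distinct[OF vu, unfolded insert_commute[of v u]]
  note nz = independent_pair_nonzero[OF uv(1)]
  have wnz: "transverse k u v \<noteq> 0" "transverse k v u \<noteq> 0"
    using transverse_nonzero[OF uv k0] transverse_nonzero[OF vu k0] by auto
  have "u \<in> span {u, v}" by (simp add: span_base)
  hence L: "span {u, v} \<noteq> {0}" using nz by blast
  from f L obtain M where f_M: "f = M {0}"
    and faces: "\<And>F. F \<in> cone_faces (convex_cone hull {u, v}) \<Longrightarrow> F \<noteq> {0} \<Longrightarrow>
           BV_function (span {u, v} \<inter> (span F)\<^sup>\<bottom>) (orth_proj (span {u, v} \<inter> (span F)\<^sup>\<bottom>) ` diagonal_lattice k u v)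
             (orth_proj (span {u, v} \<inter> (span F)\<^sup>\<bottom>) ` (convex_cone hull {u, v})) (M F)"
    and analytic: "analytic_near_0_on (span {u, v}) (M {0})"
    and eq: "\<forall>\<^sub>F \<xi> in nhds 0. \<xi> \<in> convergence_domain (span {u, v}) (convex_cone hull {u, v}) \<longrightarrow>
       exp_sum (diagonal_lattice k u v) (convex_cone hull {u, v}) \<xi> =
       (\<Sum>F\<in>cone_faces (convex_cone hull {u, v}). M F (orth_proj (span {u, v} \<inter> (span F)\<^sup>\<bottom>) \<xi>) * exp_integral (diagonal_lattice k u v) F \<xi>)"
    by cases blast+
  show "analytic_near_0_on (span {u, v}) f" using analytic f_M by simp
  have mem: "convex_cone hull {u} \<in> cone_faces (convex_cone hull {u, v})" "convex_cone hull {v} \<in> cone_faces (convex_cone hull {u, v})"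
    "convex_cone hull {u, v} \<in> cone_faces (convex_cone hull {u, v})"
    unfolding cone_faces_pair[OF uv] by auto
  have M2: "M (convex_cone hull {u, v}) 0 = 1"
    using faces[OF mem(3) distinct(5)] lattice_basis_subset[OF lattice_basis_diagonal(2)[OF uv k0]]
    by (subst (asm) BV_function_full_face) (auto simp: span_convex_cone_hull convex_cone_hull_nonempty)
  have proj: "((\<lambda>\<xi>. orth_proj (span {w}) \<xi>) \<longlongrightarrow> 0) (nhds 0)" if "w \<noteq> 0" for w :: "real^'n"
  proof -
    have "((\<lambda>\<xi>. (\<xi> \<bullet> w / (w \<bullet> w)) *\<^sub>R w) \<longlongrightarrow> (0 \<bullet> w / (w \<bullet> w)) *\<^sub>R w) (nhds 0)"
      using that by (intro tendsto_intros filterlim_ident) auto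
    thus ?thesis using that by (simp add: orth_proj_line)
  qed
  have orth_proj_mem: "orth_proj (span {w}) \<xi> \<in> span {w}" if "w \<noteq> 0" for w \<xi> :: "real^'n"
    using that by (simp add: orth_proj_line span_scale span_base)
  have ray: "\<forall>\<^sub>F \<xi> in nhds 0. \<xi> \<bullet> w < 0 \<longrightarrow> g (orth_proj (span {w}) \<xi>) = eval_fps ray_series (\<xi> \<bullet> w)"
    if "w \<noteq> 0" "BV_function (span {w}) (cyclic_lattice w) (convex_cone hull {w}) g" for g and w :: "real^'n"
    using eventually_compose_filterlim[OF BV_function_ray_unique[OF that] proj[OF that(1)]]
    by eventually_elim (simp add: orth_proj_mem[OF that(1)] inner_orth_proj_line[OF that(1)])
  note Mu = ray[OF wnz(1) faces[OF mem(1) distinct(1), unfolded transverse_ray_data(1)[OF uv(1) k0],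
    unfolded transverse_ray_data(3,5)[OF uv(1) k0]]]
  note Mv = ray[OF wnz(2) faces[OF mem(2) distinct(6), unfolded transverse_ray_data(2)[OF uv(1) k0],
    unfolded transverse_ray_data(4,6)[OF uv(1) k0]]]
  show "\<forall>\<^sub>F \<xi> in nhds 0. \<xi> \<in> span {u, v} \<and> \<xi> \<bullet> u < 0 \<and> \<xi> \<bullet> v < 0 \<and> \<xi> \<bullet> transverse k u v < 0 \<and> \<xi> \<bullet> transverse k v u < 0
       \<longrightarrow> f \<xi> = cone_BV k u v \<xi>"
    using Mu Mv eq cone_BV_identity[OF k, of u v]
  proof eventually_elim
    case (elim \<xi>)
    show ?case
    proof
      assume \<xi>: "\<xi> \<in> span {u, v} \<and> \<xi> \<bullet> u < 0 \<and> \<xi> \<bullet> v < 0 \<and> \<xi> \<bullet> transverse k u v < 0 \<and> \<xi> \<bullet> transverse k v u < 0"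
      have "\<xi> \<in> convergence_domain (span {u, v}) (convex_cone hull {u, v})" using \<xi> convergence_domain_cone[OF nz] by blast
      hence eq1: "exp_sum (diagonal_lattice k u v) (convex_cone hull {u, v}) \<xi> =
         M {0} \<xi> - M (convex_cone hull {u}) (orth_proj (span {transverse k u v}) \<xi>) / (\<xi> \<bullet> u)
      - M (convex_cone hull {v}) (orth_proj (span {transverse k v u}) \<xi>) / (\<xi> \<bullet> v)
      + M (convex_cone hull {u, v}) 0 * (of_nat k / ((\<xi> \<bullet> u) * (\<xi> \<bullet> v)))"
        using elim(3) cone_face_sum[OF uv k0, of \<xi> M] \<xi> by metis
      have eq2: "exp_sum (diagonal_lattice k u v) (convex_cone hull {u, v}) \<xi> =
         cone_BV k u v \<xi> - eval_fps ray_series (\<xi> \<bullet> transverse k u v) / (\<xi> \<bullet> u)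
      - eval_fps ray_series (\<xi> \<bullet> transverse k v u) / (\<xi> \<bullet> v) + of_nat k / ((\<xi> \<bullet> u) * (\<xi> \<bullet> v))"
        using elim(4) exp_sum_cone[OF uv k0, of \<xi>] \<xi> by metis
      have rays: "M (convex_cone hull {u}) (orth_proj (span {transverse k u v}) \<xi>) = eval_fps ray_series (\<xi> \<bullet> transverse k u v)"
        "M (convex_cone hull {v}) (orth_proj (span {transverse k v u}) \<xi>) = eval_fps ray_series (\<xi> \<bullet> transverse k v u)"
        using elim(1,2) \<xi> by blast+
      show "f \<xi> = cone_BV k u v \<xi>" using eq1[unfolded rays M2] eq2 unfolding f_M by linarith
    qed
  qed
qed

text \<open>
  The negative of the bisector of the cone works: its products with \<open>u\<close> and \<open>v\<close> are negative by the
  strict Cauchy--Schwarz inequality, and its projection along either generator is a negative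
  multiple of the projection of the other one.
\<close>
lemma exists_strictly_negative_direction:
  fixes u v :: "real^'n"
  assumes uv: "independent {u, v}" "u \<noteq> v" and k: "k > 0"
  obtains \<eta> where "\<eta> \<in> span {u, v}" "\<eta> \<bullet> u < 0" "\<eta> \<bullet> v < 0" "\<eta> \<bullet> transverse k u v < 0" "\<eta> \<bullet> transverse k v u < 0"
proof
  define \<eta> where "\<eta> = - (norm v *\<^sub>R u + norm u *\<^sub>R v)"
  have vu: "independent {v, u}" "v \<noteq> u" using uv by (auto simp: insert_commute)
  have pos: "norm u > 0" "norm v > 0" using independent_pair_nonzero[OF uv(1)] by auto
  show "\<eta> \<in> span {u, v}" unfolding \<eta>_def by (intro span_neg span_add span_scale span_base) auto
  have "(u \<bullet> v / (u \<bullet> u)) * (u \<bullet> v) < v \<bullet> v" using rejection_inner_pos[OF uv] by (simp add: rejection_def inner_diff_left)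
  hence "(u \<bullet> v)\<^sup>2 < (norm u * norm v)\<^sup>2"
    using pos by (simp add: power_mult_distrib power2_norm_eq_inner field_simps power2_eq_square[of "u \<bullet> v"])
  hence "\<bar>u \<bullet> v\<bar>\<^sup>2 < (norm u * norm v)\<^sup>2" by simp
  hence "\<bar>u \<bullet> v\<bar> < norm u * norm v" by (rule power2_less_imp_less) simp
  hence cs: "- (norm u * norm v) < u \<bullet> v" by linarith
  have "\<eta> \<bullet> u = - (norm u * (norm u * norm v + u \<bullet> v))"
    by (simp add: \<eta>_def inner_add_left inner_commute algebra_simps flip: power2_norm_eq_inner) (simp add: power2_eq_square)
  thus "\<eta> \<bullet> u < 0" using pos cs by simp
  have "\<eta> \<bullet> v = - (norm v * (norm u * norm v + u \<bullet> v))"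
    by (simp add: \<eta>_def inner_add_left inner_commute algebra_simps flip: power2_norm_eq_inner) (simp add: power2_eq_square)
  thus "\<eta> \<bullet> v < 0" using pos cs by simp
  have "\<eta> \<bullet> transverse k u v = - (norm u * (rejection u v \<bullet> v) / k)"
    by (simp add: \<eta>_def inner_add_left inner_diff_left rejection_orthogonal inner_commute[of "rejection u v" v])
  thus "\<eta> \<bullet> transverse k u v < 0" using pos k rejection_inner_pos[OF uv] by simp
  have "\<eta> \<bullet> transverse k v u = - (norm v * (rejection v u \<bullet> u) / k)"
    by (simp add: \<eta>_def inner_add_left inner_diff_left rejection_orthogonal inner_commute[of "rejection v u" u])
  thus "\<eta> \<bullet> transverse k v u < 0" using pos k rejection_inner_pos[OF vu] by simp
qed

text \<open>
  On the ray of a strictly negative direction any representative agrees near 0 with the explicit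
  function. Both are continuous at 0 along this ray, so their values at 0 agree.
\<close>
lemma BV_function_cone_value:
  fixes u v :: "real^'n"
  assumes uv: "independent {u, v}" "u \<noteq> v" and k: "k = 1 \<or> k = 2"
    and f: "BV_function (span {u, v}) (diagonal_lattice k u v) (convex_cone hull {u, v}) f"
  shows "f 0 = 1/4 + (u \<bullet> v / (u \<bullet> u) + u \<bullet> v / (v \<bullet> v)) / (12 * of_nat k)"
proof -
  have k0: "k > 0" using k by auto
  obtain \<eta> where \<eta>: "\<eta> \<in> span {u, v}" "\<eta> \<bullet> u < 0" "\<eta> \<bullet> v < 0" "\<eta> \<bullet> transverse k u v < 0" "\<eta> \<bullet> transverse k v u < 0"
    by (rule exists_strictly_negative_direction[OF uv k0])
  have "((\<lambda>t. t *\<^sub>R \<eta>) \<longlongrightarrow> 0 *\<^sub>R \<eta>) (at_right 0)" by (intro tendsto_intros)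
  hence lim: "((\<lambda>t. t *\<^sub>R \<eta>) \<longlongrightarrow> 0) (at_right 0)" by simp
  have "\<forall>\<^sub>F t in at_right 0. f (t *\<^sub>R \<eta>) = cone_BV k u v (t *\<^sub>R \<eta>)"
    using eventually_compose_filterlim[OF BV_function_cone_unique(2)[OF uv k f] lim] eventually_at_right_less[of 0]
  proof eventually_elim
    case (elim t)
    have "(t *\<^sub>R \<eta>) \<bullet> l < 0" if "\<eta> \<bullet> l < 0" for l
      using that elim(2) by (simp add: mult_pos_neg)
    thus ?case using elim(1) \<eta> span_scale[OF \<eta>(1)] by blast
  qed
  moreover have "((\<lambda>t. cone_BV k u v (t *\<^sub>R \<eta>)) \<longlongrightarrow> cone_BV k u v 0) (at_right 0)"
    by (rule analytic_near_0_on_tendsto[OF analytic_germ_imp_analytic_near_0_on[OF analytic_germ_cone_BV] subspace_UNIV]) simp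
  ultimately have "((\<lambda>t. f (t *\<^sub>R \<eta>)) \<longlongrightarrow> cone_BV k u v 0) (at_right 0)"
    using tendsto_cong[of "\<lambda>t. f (t *\<^sub>R \<eta>)" "\<lambda>t. cone_BV k u v (t *\<^sub>R \<eta>)"] by simp
  moreover have "((\<lambda>t. f (t *\<^sub>R \<eta>)) \<longlongrightarrow> f 0) (at_right 0)"
    by (rule analytic_near_0_on_tendsto[OF BV_function_cone_unique(1)[OF uv k f] subspace_span \<eta>(1)])
  ultimately have "f 0 = cone_BV k u v 0" using tendsto_unique trivial_limit_at_right_real by blast
  thus ?thesis by (simp add: cone_BV_0)
qed

section \<open>Weights of two-dimensional normal cones\<close>

lemma independent_pair_if_span_eq:
  assumes "independent {m, n :: real^'n}" "m \<noteq> n" "u \<noteq> v" "span {u, v} = span {m, n}"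
  shows "independent {u, v}"
proof -
  have "dim {u, v} = card {u, v}"
    using dim_eq_card_independent[OF assms(1)] assms(2,3) dim_span[of "{u, v}"] dim_span[of "{m, n}"]
    unfolding assms(4) by simp
  thus ?thesis using card_eq_dim[of "{u, v}" "{u, v}"] span_superset[of "{u, v}"] by simp
qed

lemma BV_weight_eqI:
  assumes uv: "independent {u, v :: real^'n}" "u \<noteq> v" and k: "k = 1 \<or> k = 2"
    and rat: "u \<in> rational_points" "v \<in> rational_points"
    and N: "span N = span {u, v}" "orth_proj (span N) ` integer_points = diagonal_lattice k u v"
      "polar_in_span N = convex_cone hull {u, v}"
  shows "BV_weight N = 1/4 + (u \<bullet> v / (u \<bullet> u) + u \<bullet> v / (v \<bullet> v)) / (12 * of_nat k)"
  unfolding BV_weight_def N(2,3) unfolding N(1)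
proof (rule the_equality)
  show "\<exists>f. BV_function (span {u, v}) (diagonal_lattice k u v) (convex_cone hull {u, v}) f \<and>
    1/4 + (u \<bullet> v / (u \<bullet> u) + u \<bullet> v / (v \<bullet> v)) / (12 * of_nat k) = f 0"
    using BV_function_cone[OF uv k rat] BV_function_cone_value[OF uv k] by metis
qed (use BV_function_cone_value[OF uv k] in blast)

text \<open>
  Let \<open>u\<close> and \<open>v\<close> be \<open>-k\<close> times the basis of the plane dual to \<open>m\<close> and \<open>n\<close>. They generate the polar cone, and
  the projection of \<open>z\<close> to the plane has coordinates \<open>-\<langle>z, m\<rangle>/k\<close> and \<open>-\<langle>z, n\<rangle>/k\<close>, so the assumption on the
  pairs \<open>(\<langle>z, m\<rangle>, \<langle>z, n\<rangle>)\<close> identifies the projected lattice. The signs change because the Gram matrix of a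
  dual basis is the inverse Gram matrix: \<open>\<langle>u, v\<rangle> / \<langle>u, u\<rangle> = - \<langle>m, n\<rangle> / \<langle>n, n\<rangle>\<close>.
\<close>
lemma BV_weight_pair:
  fixes m n :: "real^'n"
  assumes mn: "independent {m, n}" "m \<noteq> n" and k: "k = 1 \<or> k = 2"
    and rat: "m \<in> rational_points" "n \<in> rational_points"
    and img: "(\<lambda>z. (z \<bullet> m, z \<bullet> n)) ` integer_points = {(of_int i, of_int j) | i j :: int. int k dvd i - j}"
  shows "BV_weight (convex_cone hull {m, n}) = 1/4 - (m \<bullet> n / (m \<bullet> m) + m \<bullet> n / (n \<bullet> n)) / (12 * of_nat k)"
proof -
  have k0: "real k > 0" using k by auto
  have nm: "independent {n, m}" "n \<noteq> m" using mn by (auto simp: insert_commute)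
  define a b where "a = rejection n m \<bullet> m" and "b = rejection m n \<bullet> n"
  have ab: "a > 0" "b > 0" using rejection_inner_pos[OF mn] rejection_inner_pos[OF nm] by (simp_all add: a_def b_def)
  define u v where "u = - (k / a) *\<^sub>R rejection n m" and "v = - (k / b) *\<^sub>R rejection m n"
  have um: "u \<bullet> m = - k" "u \<bullet> n = 0" "v \<bullet> m = 0" "v \<bullet> n = - k"
    using ab by (simp_all add: u_def v_def rejection_orthogonal flip: a_def b_def)
  hence mu: "m \<bullet> u = - k" "n \<bullet> u = 0" "m \<bullet> v = 0" "n \<bullet> v = - k"
    by (simp_all add: inner_commute)
  have mem: "u \<in> span {m, n}" "v \<in> span {m, n}" unfolding u_def v_def rejection_def
    by (intro span_scale span_diff span_base; simp)+
  have expand: "x = (- (x \<bullet> m) / k) *\<^sub>R u + (- (x \<bullet> n) / k) *\<^sub>R v" if x: "x \<in> span {m, n}" for x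
  proof -
    define d where "d = x - ((- (x \<bullet> m) / k) *\<^sub>R u + (- (x \<bullet> n) / k) *\<^sub>R v)"
    have "d \<in> span {m, n}" unfolding d_def by (intro span_diff span_add span_scale x mem)
    then obtain s t where "d = s *\<^sub>R m + t *\<^sub>R n" by (auto simp: span_pair)
    moreover have "d \<bullet> m = 0" "d \<bullet> n = 0" using k0 by (simp_all add: d_def inner_diff_left inner_add_left um)
    ultimately have "d \<bullet> d = 0" by (metis inner_add_right inner_scaleR_right mult_zero_right add_0)
    thus ?thesis by (simp add: d_def)
  qed
  have span: "span (convex_cone hull {m, n}) = span {u, v}"
  proof -
    have "span {m, n} \<subseteq> span {u, v}" using expand span_pair[of _ u v] by blast
    moreover have "span {u, v} \<subseteq> span {m, n}" using mem by (intro span_minimal subspace_span) auto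
    ultimately show ?thesis by (simp add: span_convex_cone_hull)
  qed
  have uv: "u \<noteq> v" using um k0 by auto
  have ind: "independent {u, v}"
    by (rule independent_pair_if_span_eq[OF mn uv]) (use span in \<open>simp add: span_convex_cone_hull\<close>)
  have rat_uv: "u \<in> rational_points" "v \<in> rational_points" unfolding u_def v_def a_def b_def
    using rat by (intro rational_points_scale rational_points_rejection rational_points_inner Rats_minus_iff[THEN iffD2] Rats_divide; simp)+
  have polar: "polar_in_span (convex_cone hull {m, n}) = convex_cone hull {u, v}"
  proof (intro equalityI subsetI)
    fix x assume x: "x \<in> polar_in_span (convex_cone hull {m, n})"
    hence x: "x \<in> span {m, n}" "x \<bullet> m \<le> 0" "x \<bullet> n \<le> 0"
      by (auto simp: polar_in_span_def span_convex_cone_hull intro: hull_inc)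
    hence "0 \<le> - (x \<bullet> m) / k" "0 \<le> - (x \<bullet> n) / k" using k0 by (auto intro: divide_nonpos_pos)
    thus "x \<in> convex_cone hull {u, v}" unfolding convex_cone_hull_pair using expand[OF x(1)] by blast
  next
    fix x assume "x \<in> convex_cone hull {u, v}"
    then obtain s t where x: "x = s *\<^sub>R u + t *\<^sub>R v" "0 \<le> s" "0 \<le> t" by (auto simp: convex_cone_hull_pair)
    have "x \<in> span {m, n}" unfolding x by (intro span_add span_scale mem)
    moreover have "x \<bullet> y \<le> 0" if ymem: "y \<in> convex_cone hull {m, n}" for y
    proof -
      obtain p q where y: "y = p *\<^sub>R m + q *\<^sub>R n" "0 \<le> p" "0 \<le> q" using ymem unfolding convex_cone_hull_pair by blast
      have "x \<bullet> y = - (k * (p * s) + k * (q * t))" by (simp add: x(1) y(1) inner_add_left inner_add_right um)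
      moreover have "0 \<le> k * (p * s) + k * (q * t)" using x y k0 by (intro add_nonneg_nonneg mult_nonneg_nonneg) auto
      ultimately show ?thesis by linarith
    qed
    ultimately show "x \<in> polar_in_span (convex_cone hull {m, n})"
      by (simp add: polar_in_span_def span_convex_cone_hull)
  qed
  have proj: "orth_proj (span {m, n}) z = (- (z \<bullet> m) / k) *\<^sub>R u + (- (z \<bullet> n) / k) *\<^sub>R v" for z
  proof (rule orth_proj_eqI)
    show "(- (z \<bullet> m) / k) *\<^sub>R u + (- (z \<bullet> n) / k) *\<^sub>R v \<in> span {m, n}" by (intro span_add span_scale mem)
    let ?d = "z - ((- (z \<bullet> m) / k) *\<^sub>R u + (- (z \<bullet> n) / k) *\<^sub>R v)"
    have "m \<bullet> ?d = 0" "n \<bullet> ?d = 0" using k0 um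
      by (simp_all add: inner_diff_right inner_add_right inner_commute)
    thus "?d \<in> (span {m, n})\<^sup>\<bottom>"
      by (auto simp: orthogonal_comp_def orthogonal_def span_pair inner_add_left)
  qed simp
  have lattice: "orth_proj (span (convex_cone hull {m, n})) ` integer_points = diagonal_lattice k u v"
  proof -
    have "orth_proj (span {m, n}) ` integer_points
      = (\<lambda>(x, y). (- x / k) *\<^sub>R u + (- y / k) *\<^sub>R v) ` (\<lambda>z. (z \<bullet> m, z \<bullet> n)) ` integer_points"
      by (simp add: proj image_image)
    also have "\<dots> = {(of_int i / of_nat k) *\<^sub>R u + (of_int j / of_nat k) *\<^sub>R v | i j :: int. int k dvd i - j}"
      unfolding img
    proof (intro equalityI subsetI)
      fix x assume "x \<in> (\<lambda>(x, y). (- x / k) *\<^sub>R u + (- y / k) *\<^sub>R v) ` {(of_int i, of_int j) | i j :: int. int k dvd i - j}"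
      then obtain i j :: int where "int k dvd i - j" "x = (- of_int i / k) *\<^sub>R u + (- of_int j / k) *\<^sub>R v" by auto
      thus "x \<in> {(of_int i / of_nat k) *\<^sub>R u + (of_int j / of_nat k) *\<^sub>R v | i j :: int. int k dvd i - j}"
        by (intro CollectI exI[of _ "- i"] exI[of _ "- j"]) (auto simp: dvd_diff_commute)
    next
      fix x assume "x \<in> {(of_int i / of_nat k) *\<^sub>R u + (of_int j / of_nat k) *\<^sub>R v | i j :: int. int k dvd i - j}"
      then obtain i j :: int where "int k dvd i - j" "x = (of_int i / k) *\<^sub>R u + (of_int j / k) *\<^sub>R v" by auto
      thus "x \<in> (\<lambda>(x, y). (- x / k) *\<^sub>R u + (- y / k) *\<^sub>R v) ` {(of_int i, of_int j) | i j :: int. int k dvd i - j}"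
        by (intro image_eqI[of _ _ "(of_int (- i), of_int (- j))"] CollectI exI[of _ "- i"] exI[of _ "- j"])
           (auto simp: dvd_diff_commute)
    qed
    finally show ?thesis by (simp add: diagonal_lattice_def span_convex_cone_hull)
  qed
  have uu: "u \<bullet> u = k\<^sup>2 / a" "v \<bullet> v = k\<^sup>2 / b"
  proof -
    have "rejection n m \<bullet> u = - k" "rejection m n \<bullet> v = - k"
      using mu by (simp_all add: rejection_def inner_diff_left)
    moreover have "u \<bullet> u = - (k / a) * (rejection n m \<bullet> u)" "v \<bullet> v = - (k / b) * (rejection m n \<bullet> v)"
      by (metis u_def inner_scaleR_left, metis v_def inner_scaleR_left)
    ultimately show "u \<bullet> u = k\<^sup>2 / a" "v \<bullet> v = k\<^sup>2 / b"
      by (simp_all add: power2_eq_square)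
  qed
  have uv1: "u \<bullet> v = - (k\<^sup>2 / a) * (m \<bullet> n / (n \<bullet> n))"
  proof -
    have "rejection n m \<bullet> v = (m \<bullet> n / (n \<bullet> n)) * k"
      using mu by (simp add: rejection_def inner_diff_left inner_commute[of n m])
    thus ?thesis by (subst u_def) (simp add: power2_eq_square)
  qed
  have uv2: "u \<bullet> v = - (k\<^sup>2 / b) * (m \<bullet> n / (m \<bullet> m))"
  proof -
    have "u \<bullet> rejection m n = (m \<bullet> n / (m \<bullet> m)) * k"
      using um by (simp add: rejection_def inner_diff_right)
    thus ?thesis by (subst v_def) (simp add: power2_eq_square)
  qed
  have "u \<bullet> v / (u \<bullet> u) = - (m \<bullet> n / (n \<bullet> n))" unfolding uv1 uu using ab k0 by simp
  moreover have "u \<bullet> v / (v \<bullet> v) = - (m \<bullet> n / (m \<bullet> m))" unfolding uv2 uu using ab k0 by simp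
  ultimately show ?thesis
    using BV_weight_eqI[OF ind uv k rat_uv span lattice polar] by (simp add: diff_divide_distrib add_divide_distrib)
qed

section \<open>Integer vectors in three dimensions\<close>

type_synonym int3 = "int \<times> int \<times> int"

definition int_vec :: "int3 \<Rightarrow> real^3" where
  "int_vec = (\<lambda>(x, y, z). vector [of_int x, of_int y, of_int z])"

fun int_dot :: "int3 \<Rightarrow> int3 \<Rightarrow> int" where
  "int_dot (a, b, c) (x, y, z) = a * x + b * y + c * z"

fun int_cross :: "int3 \<Rightarrow> int3 \<Rightarrow> int3" where
  "int_cross (a, b, c) (x, y, z) = (b * z - c * y, c * x - a * z, a * y - b * x)"

fun int_neg :: "int3 \<Rightarrow> int3" where
  "int_neg (x, y, z) = (- x, - y, - z)"

lemma int_vec_nth: "int_vec (x, y, z) $ 1 = of_int x" "int_vec (x, y, z) $ 2 = of_int y" "int_vec (x, y, z) $ 3 = of_int z"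
  by (simp_all add: int_vec_def)

lemma int_vec_inner: "int_vec p \<bullet> int_vec q = of_int (int_dot p q)"
  by (cases p; cases q) (simp add: inner_vec_def sum_3 int_vec_nth)

lemma int_vec_eq_iff: "int_vec p = int_vec q \<longleftrightarrow> p = q"
  by (cases p; cases q) (auto simp: vec_eq_iff forall_3 int_vec_nth)

lemma int_vec_cross: "cross3 (int_vec p) (int_vec q) = int_vec (int_cross p q)"
  by (cases p; cases q) (simp add: vec_eq_iff forall_3 int_vec_nth cross3_def)

lemma int_vec_zero: "int_vec (0, 0, 0) = 0"
  by (simp add: vec_eq_iff forall_3 int_vec_nth)

lemma parallel_int_vec: "parallel (int_vec p) (int_vec q) \<longleftrightarrow> int_cross p q = (0, 0, 0)"
  unfolding parallel_def cross_eq_0[symmetric] int_vec_cross by (metis int_vec_eq_iff int_vec_zero)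

lemma integer_points_int_vec: "integer_points = range int_vec"
proof (intro equalityI subsetI)
  fix z :: "real^3" assume "z \<in> integer_points"
  hence "z $ 1 \<in> \<int>" "z $ 2 \<in> \<int>" "z $ 3 \<in> \<int>" by (auto simp: integer_points_def)
  then obtain a b c where "z $ 1 = of_int a" "z $ 2 = of_int b" "z $ 3 = of_int c" by (auto elim!: Ints_cases)
  hence "z = int_vec (a, b, c)" by (simp add: vec_eq_iff forall_3 int_vec_nth)
  thus "z \<in> range int_vec" by blast
next
  fix z assume "z \<in> range int_vec"
  then obtain a b c where "z = int_vec (a, b, c)" by (metis imageE prod_cases3)
  thus "z \<in> integer_points" by (simp add: integer_points_def forall_3 int_vec_nth)
qed

lemma int_vec_rational: "int_vec p \<in> rational_points"
  by (cases p) (simp add: rational_points_def forall_3 int_vec_nth)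

lemma independent_if_not_parallel:
  assumes "\<not> parallel x y"
  shows "independent {x, y}" "x \<noteq> y"
proof -
  have *: "x \<noteq> 0" "y \<noteq> 0" "\<And>c. y \<noteq> c *\<^sub>R x" using assms by (auto simp: parallel_def collinear_lemma)
  show "x \<noteq> y" using *(3)[of 1] by simp
  have "y \<notin> span {x}" using * by (auto simp: span_singleton)
  thus "independent {x, y}" using * by (simp add: insert_commute[of x] independent_insert)
qed

text \<open>
  A computable condition for the image of \<open>\<int>\<^sup>3\<close> under \<open>z \<mapsto> (\<langle>z, p\<rangle>, \<langle>z, q\<rangle>)\<close> to consist of all pairs of
  integers that are congruent modulo \<open>k\<close>: the congruences of the coordinates force this of every pair
  in the image, and a minor of absolute value \<open>k\<close> produces all of them by Cramer's rule.
\<close>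
fun lattice_index :: "nat \<Rightarrow> int3 \<Rightarrow> int3 \<Rightarrow> bool" where
  "lattice_index k (a, b, c) (x, y, z) \<longleftrightarrow>
     int k dvd a - x \<and> int k dvd b - y \<and> int k dvd c - z \<and>
     (\<bar>b * z - c * y\<bar> = int k \<or> \<bar>c * x - a * z\<bar> = int k \<or> \<bar>a * y - b * x\<bar> = int k)"

text \<open>
  Cramer's rule has the denominator \<open>\<plusminus>k\<close>, and both numerators are divisible by \<open>k\<close> because the two
  equations coincide modulo \<open>k\<close>.
\<close>
lemma cramer_int:
  fixes a b x y i j :: int
  assumes "k dvd a - x" "k dvd b - y" "k dvd i - j" "\<bar>a * y - b * x\<bar> = k" "k \<noteq> 0"
  obtains s t where "s * a + t * b = i" "s * x + t * y = j"
proof -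
  let ?D = "a * y - b * x"
  have D: "?D \<noteq> 0" "?D dvd w \<longleftrightarrow> k dvd w" for w using assms(4,5) by auto
  have "i * y - j * b = (i - j) * b - i * (b - y)" "j * a - i * x = (j - i) * a + i * (a - x)" by (simp_all add: algebra_simps)
  hence "k dvd i * y - j * b" "k dvd j * a - i * x"
    using assms(1-3) by (auto simp: dvd_diff_commute[of k j i])
  then obtain s t where st: "i * y - j * b = ?D * s" "j * a - i * x = ?D * t" unfolding D(2)[symmetric] by (elim dvdE)
  have "?D * (s * a + t * b) = (?D * s) * a + (?D * t) * b" "?D * (s * x + t * y) = (?D * s) * x + (?D * t) * y"
    by (simp_all add: algebra_simps)
  hence "?D * (s * a + t * b) = ?D * i" "?D * (s * x + t * y) = ?D * j"
    unfolding st[symmetric] by (simp_all add: algebra_simps)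
  hence "s * a + t * b = i" "s * x + t * y = j" using D(1) by simp_all
  thus ?thesis by (rule that)
qed

lemma lattice_index_image:
  assumes "lattice_index k p q" "k \<noteq> 0"
  shows "(\<lambda>z. (z \<bullet> int_vec p, z \<bullet> int_vec q)) ` integer_points = {(of_int i, of_int j) | i j :: int. int k dvd i - j}"
proof -
  obtain a b c x y z where pq: "p = (a, b, c)" "q = (x, y, z)" by (metis prod_cases3)
  have dvd: "int k dvd a - x" "int k dvd b - y" "int k dvd c - z" using assms(1) by (simp_all add: pq)
  have 1: "int k dvd int_dot w p - int_dot w q" for w
  proof -
    obtain r s t where w: "w = (r, s, t)" by (metis prod_cases3)
    have "int_dot w p - int_dot w q = r * (a - x) + s * (b - y) + t * (c - z)" by (simp add: w pq algebra_simps)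
    thus ?thesis using dvd by simp
  qed
  have 2: "\<exists>w. int_dot w p = i \<and> int_dot w q = j" if ij: "int k dvd i - j" for i j
  proof -
    have k: "int k \<noteq> 0" using assms(2) by simp
    consider "\<bar>a * y - b * x\<bar> = int k" | "\<bar>b * z - c * y\<bar> = int k" | "\<bar>a * z - c * x\<bar> = int k"
      using assms(1) by (auto simp: pq abs_minus_commute)
    thus ?thesis
    proof cases
      case 1
      obtain s t where "s * a + t * b = i" "s * x + t * y = j" by (rule cramer_int[OF dvd(1,2) ij 1 k])
      thus ?thesis by (intro exI[of _ "(s, t, 0)"]) (simp add: pq)
    next
      case 2
      obtain s t where "s * b + t * c = i" "s * y + t * z = j" by (rule cramer_int[OF dvd(2,3) ij 2 k])
      thus ?thesis by (intro exI[of _ "(0, s, t)"]) (simp add: pq)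
    next
      case 3
      obtain s t where "s * a + t * c = i" "s * x + t * z = j" by (rule cramer_int[OF dvd(1,3) ij 3 k])
      thus ?thesis by (intro exI[of _ "(s, 0, t)"]) (simp add: pq)
    qed
  qed
  show ?thesis
  proof (intro equalityI subsetI)
    fix w assume "w \<in> (\<lambda>z. (z \<bullet> int_vec p, z \<bullet> int_vec q)) ` integer_points"
    then obtain r where "w = (of_int (int_dot r p), of_int (int_dot r q))"
      by (auto simp: integer_points_int_vec int_vec_inner)
    thus "w \<in> {(of_int i, of_int j) | i j :: int. int k dvd i - j}" using 1[of r] by blast
  next
    fix w :: "real \<times> real" assume "w \<in> {(of_int i, of_int j) | i j :: int. int k dvd i - j}"
    then obtain i j :: int where w: "w = (of_int i, of_int j)" "int k dvd i - j" by blast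
    then obtain r where "int_dot r p = i" "int_dot r q = j" using 2 by blast
    hence "w = (int_vec r \<bullet> int_vec p, int_vec r \<bullet> int_vec q)" by (simp add: w int_vec_inner)
    thus "w \<in> (\<lambda>z. (z \<bullet> int_vec p, z \<bullet> int_vec q)) ` integer_points"
      unfolding integer_points_int_vec by blast
  qed
qed

lemma BV_weight_int_vec:
  assumes "int_cross p q \<noteq> (0, 0, 0)" "lattice_index k p q" "k = 1 \<or> k = 2"
  shows "BV_weight (convex_cone hull {int_vec p, int_vec q}) =
    1/4 - (of_int (int_dot p q) / of_int (int_dot p p) + of_int (int_dot p q) / of_int (int_dot q q)) / (12 * of_nat k)"
proof -
  have "\<not> parallel (int_vec p) (int_vec q)" using assms(1) by (simp add: parallel_int_vec)
  note ind = independent_if_not_parallel[OF this]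
  have "k \<noteq> 0" using assms(3) by auto
  from BV_weight_pair[OF ind assms(3) int_vec_rational int_vec_rational lattice_index_image[OF assms(2) this]]
  show ?thesis by (simp add: int_vec_inner)
qed

section \<open>Hive normals\<close>

definition positive_roots :: "int3 list" where
  "positive_roots = [(1, 0, 0), (0, 1, 0), (0, 0, 1), (1, -1, 0), (1, 0, -1), (0, 1, -1)]"

definition hive_normals :: "int3 list" where
  "hive_normals = positive_roots @ map int_neg positive_roots @ [(1, -1, -1), (-1, 1, -1), (-1, -1, 1)]"

lemma N4_hive_normals: "N4 = int_vec ` set hive_normals"
  unfolding N4_def hive_normals_def positive_roots_def by (simp add: int_vec_def) blast

text \<open>
  The last inequality is the bound \<open>1/9\<close> on the weight with denominators cleared. The condition holds
  with \<open>k = 1\<close> except for pairs among the three vectors with all coordinates odd, which need \<open>k = 2\<close>.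
\<close>
lemma hive_normals_check:
  "\<forall>p\<in>set hive_normals. \<forall>q\<in>set hive_normals. int_cross p q \<noteq> (0, 0, 0) \<longrightarrow>
     (\<exists>k\<in>set [1, 2]. lattice_index k p q \<and> int_dot p p > 0 \<and> int_dot q q > 0 \<and>
        3 * int_dot p q * (int_dot p p + int_dot q q) \<le> 5 * int k * int_dot p p * int_dot q q)"
  by code_simp

lemma BV_weight_hive_normals_ge:
  assumes "p \<in> set hive_normals" "q \<in> set hive_normals" "int_cross p q \<noteq> (0, 0, 0)"
  shows "BV_weight (convex_cone hull {int_vec p, int_vec q}) \<ge> 1/9"
proof -
  obtain k where k: "k = 1 \<or> k = 2" "lattice_index k p q" and pos: "int_dot p p > 0" "int_dot q q > 0"
    and le: "3 * int_dot p q * (int_dot p p + int_dot q q) \<le> 5 * int k * int_dot p p * int_dot q q"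
    using hive_normals_check assms by (metis (no_types, lifting) empty_iff insert_iff list.set)
  define P Q S K where "P = real_of_int (int_dot p p)" and "Q = real_of_int (int_dot q q)"
    and "S = real_of_int (int_dot p q)" and "K = real k"
  have "real_of_int (3 * int_dot p q * (int_dot p p + int_dot q q)) \<le> real_of_int (5 * int k * int_dot p p * int_dot q q)"
    using le by (rule of_int_le_iff[THEN iffD2])
  hence le': "3 * S * (P + Q) \<le> 5 * K * P * Q" by (simp add: P_def Q_def S_def K_def)
  have pos': "P > 0" "Q > 0" "K > 0" using pos k by (auto simp: P_def Q_def K_def)
  have "(S / P + S / Q) / (12 * K) \<le> 5/36" using le' pos' by (simp add: field_simps)
  moreover have "BV_weight (convex_cone hull {int_vec p, int_vec q}) = 1/4 - (S / P + S / Q) / (12 * K)"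
    unfolding BV_weight_int_vec[OF assms(3) k(2,1)] P_def Q_def S_def K_def ..
  ultimately show ?thesis by linarith
qed

text \<open>
  Here \<open>\<langle>p, q\<rangle> = 2\<close>, \<open>\<langle>p, p\<rangle> = 3\<close> and \<open>\<langle>q, q\<rangle> = 2\<close>, so the weight is \<open>1/4 - (2/3 + 1)/12\<close>.
\<close>
lemma BV_weight_minimal_pair: "BV_weight (convex_cone hull {int_vec (1, -1, -1), int_vec (1, -1, 0)}) = 1/9"
  by (subst BV_weight_int_vec[where k = 1]) auto

definition nonparallel_int_pairs :: "int3 set set" where
  "nonparallel_int_pairs = {{p, q} | p q. p \<in> set hive_normals \<and> q \<in> set hive_normals \<and> int_cross p q \<noteq> (0, 0, 0)}"

lemma nonparallel_pairs_int: "nonparallel_pairs = (`) int_vec ` nonparallel_int_pairs"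
proof (intro equalityI subsetI)
  fix B assume "B \<in> nonparallel_pairs"
  then obtain p q where "B = {int_vec p, int_vec q}" "p \<in> set hive_normals" "q \<in> set hive_normals"
    "\<not> parallel (int_vec p) (int_vec q)"
    unfolding nonparallel_pairs_def N4_hive_normals by blast
  moreover from this have "{p, q} \<in> nonparallel_int_pairs"
    unfolding nonparallel_int_pairs_def parallel_int_vec by blast
  ultimately show "B \<in> (`) int_vec ` nonparallel_int_pairs" by (intro image_eqI[of _ _ "{p, q}"]) simp_all
next
  fix B assume "B \<in> (`) int_vec ` nonparallel_int_pairs"
  then obtain p q where "B = int_vec ` {p, q}" "p \<in> set hive_normals" "q \<in> set hive_normals"
    "\<not> parallel (int_vec p) (int_vec q)"
    unfolding nonparallel_int_pairs_def parallel_int_vec by blast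
  thus "B \<in> nonparallel_pairs" unfolding nonparallel_pairs_def N4_hive_normals by auto
qed

lemma parallel_hive_normals_check:
  "\<forall>p\<in>set hive_normals. \<forall>q\<in>set hive_normals. int_cross p q = (0, 0, 0) \<longleftrightarrow>
     p = q \<or> (p \<in> set positive_roots \<and> q = int_neg p) \<or> (q \<in> set positive_roots \<and> p = int_neg q)"
  by code_simp

text \<open>
  The only parallel pairs are the six opposite ones, so the number of nonparallel pairs is
  \<open>15 \<cdot> 14 / 2 - 6 = 99\<close>.
\<close>
lemma nonparallel_int_pairs_eq:
  "nonparallel_int_pairs =
     {B. B \<subseteq> set hive_normals \<and> card B = 2} - (\<lambda>r. {r, int_neg r}) ` set positive_roots"
proof (intro equalityI subsetI)
  fix B assume "B \<in> nonparallel_int_pairs"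
  then obtain p q where B: "B = {p, q}" "p \<in> set hive_normals" "q \<in> set hive_normals" "int_cross p q \<noteq> (0, 0, 0)"
    unfolding nonparallel_int_pairs_def by blast
  hence *: "p \<noteq> q" "\<not> (p \<in> set positive_roots \<and> q = int_neg p)" "\<not> (q \<in> set positive_roots \<and> p = int_neg q)"
    using parallel_hive_normals_check by blast+
  hence "B \<notin> (\<lambda>r. {r, int_neg r}) ` set positive_roots" unfolding B(1) by (auto simp: doubleton_eq_iff)
  thus "B \<in> {B. B \<subseteq> set hive_normals \<and> card B = 2} - (\<lambda>r. {r, int_neg r}) ` set positive_roots"
    using B * by auto
next
  fix B assume B: "B \<in> {B. B \<subseteq> set hive_normals \<and> card B = 2} - (\<lambda>r. {r, int_neg r}) ` set positive_roots"
  then obtain p q where pq: "B = {p, q}" "p \<noteq> q" by (auto simp: card_2_iff)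
  have "\<not> (p \<in> set positive_roots \<and> q = int_neg p)" "\<not> (q \<in> set positive_roots \<and> p = int_neg q)"
    using B unfolding pq(1) by (auto simp: insert_commute)
  hence "int_cross p q \<noteq> (0, 0, 0)" using parallel_hive_normals_check B pq by blast
  thus "B \<in> nonparallel_int_pairs" unfolding nonparallel_int_pairs_def using B pq by blast
qed

lemma distinct_hive_normals: "distinct hive_normals" "length hive_normals = 15"
  by code_simp+

lemma card_N4: "card N4 = 15"
proof -
  have "inj_on int_vec (set hive_normals)" by (simp add: inj_on_def int_vec_eq_iff)
  thus ?thesis unfolding N4_hive_normals using distinct_hive_normals by (simp add: card_image distinct_card)
qed

lemma card_nonparallel_pairs: "card nonparallel_pairs = 99"
proof -
  have two: "card {B. B \<subseteq> set hive_normals \<and> card B = 2} = 105"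
    using n_subsets[of "set hive_normals" 2] distinct_card[OF distinct_hive_normals(1)] distinct_hive_normals(2)
    by (simp add: choose_two)
  have roots: "set positive_roots \<subseteq> set hive_normals" "\<forall>r\<in>set positive_roots. int_neg r \<in> set hive_normals \<and> int_neg r \<notin> set positive_roots"
    "distinct positive_roots" "length positive_roots = 6"
    by code_simp+
  have "inj_on (\<lambda>r. {r, int_neg r}) (set positive_roots)"
    using roots(2) by (auto simp: inj_on_def doubleton_eq_iff)
  hence six: "card ((\<lambda>r. {r, int_neg r}) ` set positive_roots) = 6"
    using roots(3,4) by (simp add: card_image distinct_card)
  have sub: "(\<lambda>r. {r, int_neg r}) ` set positive_roots \<subseteq> {B. B \<subseteq> set hive_normals \<and> card B = 2}"
  proof
    fix B assume "B \<in> (\<lambda>r. {r, int_neg r}) ` set positive_roots"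
    then obtain r where r: "B = {r, int_neg r}" "r \<in> set positive_roots" by blast
    hence "r \<noteq> int_neg r" using roots(2) by metis
    thus "B \<in> {B. B \<subseteq> set hive_normals \<and> card B = 2}" using r roots by auto
  qed
  have "card nonparallel_int_pairs = 99"
    unfolding nonparallel_int_pairs_eq by (subst card_Diff_subset[OF _ sub]) (simp_all add: two six)
  moreover have "inj_on ((`) int_vec) nonparallel_int_pairs"
    by (metis inj_image_eq_iff inj_on_def int_vec_eq_iff)
  ultimately show ?thesis unfolding nonparallel_pairs_int by (simp add: card_image)
qed

theorem proposition9:
  "card N4 = 15 \<and>
   (\<forall>n\<in>N4. \<forall>n'\<in>N4. \<not> parallel n n' \<longrightarrow> BV_weight (convex_cone hull {n, n'}) > 0) \<and>
   card nonparallel_pairs = 99 \<and>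
   Min ((\<lambda>P. BV_weight (convex_cone hull P)) ` nonparallel_pairs) = 1 / 9"
proof (intro conjI ballI impI)
  have ge: "BV_weight (convex_cone hull {n, n'}) \<ge> 1/9" if "n \<in> N4" "n' \<in> N4" "\<not> parallel n n'" for n n'
    using that BV_weight_hive_normals_ge unfolding N4_hive_normals by (auto simp: parallel_int_vec simp del: int_cross.simps)
  show "BV_weight (convex_cone hull {n, n'}) > 0" if "n \<in> N4" "n' \<in> N4" "\<not> parallel n n'" for n n'
    using ge[OF that] by linarith
  show "Min ((\<lambda>P. BV_weight (convex_cone hull P)) ` nonparallel_pairs) = 1 / 9"
  proof (rule Min_eqI)
    have "finite nonparallel_pairs" using card_nonparallel_pairs card.infinite by fastforce
    thus "finite ((\<lambda>P. BV_weight (convex_cone hull P)) ` nonparallel_pairs)" by simp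
    show "1 / 9 \<le> x" if "x \<in> (\<lambda>P. BV_weight (convex_cone hull P)) ` nonparallel_pairs" for x
      using that ge unfolding nonparallel_pairs_def by blast
    have "(1, -1, -1) \<in> set hive_normals" "(1, -1, 0) \<in> set hive_normals"
      "int_cross (1, -1, -1) (1, -1, 0) \<noteq> (0, 0, 0)" by code_simp+
    hence "{(1, -1, -1), (1, -1, 0)} \<in> nonparallel_int_pairs"
      unfolding nonparallel_int_pairs_def by blast
    hence "int_vec ` {(1, -1, -1), (1, -1, 0)} \<in> nonparallel_pairs"
      unfolding nonparallel_pairs_int by (rule imageI)
    hence "{int_vec (1, -1, -1), int_vec (1, -1, 0)} \<in> nonparallel_pairs" by simp
    thus "1 / 9 \<in> (\<lambda>P. BV_weight (convex_cone hull P)) ` nonparallel_pairs"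
      using BV_weight_minimal_pair by (metis image_eqI)
  qed
qed (rule card_N4 card_nonparallel_pairs)+

end
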